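(* Let $(A_0,A_1)$ be a compatible couple of quasi-normed spaces, let $0<q_0,q_1\le\infty$ with $q_0\neq q_1$, and let $b_j\in SV_{0,q_j}$ for $j=0,1$. For $t>0$ put $$\rho(t)=\frac{\|u^{-1/q_0}b_0(u)\|_{q_0,(t,\infty)}}{\|u^{-1/q_1}b_1(u)\|_{q_1,(t,\infty)}},\qquad \rho_\epsilon(t)=\frac{\|u^{-1/q_0}b_0(u)\|_{q_0,(t,\infty)}^{1+\epsilon}}{\|u^{-1/q_1}b_1(u)\|_{q_1,(t,\infty)}}\quad(\epsilon>0),$$ and for $f\in A_0+A_1$ $$I(t,f)=\|u^{-1/q_0}b_0(u)K(u,f;A_0,A_1)\|_{q_0,(0,t)},\qquad J(t,f)=\|u^{-1/q_1}b_1(u)K(u,f;A_0,A_1)\|_{q_1,(t,\infty)}.$$ Assume that ( * ) $\rho_\epsilon$ is equivalent to a non-decreasing function for some $\epsilon>0$. Then, for all $f\in A_0+A_1$ and all $t>0$, $$( ** )\qquad K(\rho(t),f;\bar A_{0,q_0;b_0},\bar A_{0,q_1;b_1})\approx I(t,f)+\rho(t)\,J(t,f).$$ Moreover, condition ( * ) is also necessary for ( ** ) (to hold for all $f\in A_0+A_1$ and all $t>0$), provided that the couple $(A_0,A_1)$ is $K$-surjective.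
   Context: Notation: $\|\cdot\|_{q,(a,b)}$ is the $L^q$-quasi-norm on $(a,b)$ with respect to Lebesgue measure ($1/q=0$ if $q=\infty$). $A\lesssim B$ means $A\le cB$ with a positive constant $c$ independent of the appropriate parameters (here independent of $f$ and $t$); $A\approx B$ means $A\lesssim B$ and $B\lesssim A$. A positive function $g$ on $(0,\infty)$ is equivalent to a function $h$ if $g(t)\approx h(t)$ for all $t>0$. Slowly varying functions: a Lebesgue measurable $b:(0,\infty)\to(0,\infty)$ is slowly varying, $b\in SV$, if for every $\varepsilon>0$ there are positive functions $g_\varepsilon$ (non-decreasing) and $g_{-\varepsilon}$ (non-increasing) on $(0,\infty)$ with $t^{\varepsilon}b(t)\approx g_\varepsilon(t)$ and $t^{-\varepsilon}b(t)\approx g_{-\varepsilon}(t)$ for all $t>0$. For $0<q\le\infty$, $b\in SV_{0,q}$ means $b\in SV$ and $\|u^{-1/q}b(u)\|_{q,(1,\infty)}<\infty$. Compatible couple: quasi-normed spaces $A_0,A_1$ continuously embedded in the same Hausdorff topological vector space. For $f\in A_0+A_1$, $t>0$, $K(t,f;A_0,A_1)=\inf\{\|f_0\|_{A_0}+t\|f_1\|_{A_1}: f_0\in A_0,\ f_1\in A_1,\ f=f_0+f_1\}$, with the convention $\inf\emptyset=\infty$ when a $K$-functional is taken at an element outside the sum of the couple. For $0<q\le\infty$, $0\le\theta\le1$, $b\in SV$, $\bar A_{\theta,q;b}=(A_0,A_1)_{\theta,q;b}$ is the space of $f\in A_0+A_1$ with $\|f\|_{\bar A_{\theta,q;b}}=\|t^{-\theta-1/q}b(t)K(t,f;A_0,A_1)\|_{q,(0,\infty)}<\infty$.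 A function $\phi:(0,\infty)\to(0,\infty)$ is quasi-concave if both $\phi(t)$ and $t\phi(1/t)$ are non-decreasing. The couple $(A_0,A_1)$ is $K$-surjective if for every quasi-concave $\phi$ there is $f\in A_0+A_1$ with $\phi(t)\approx K(t,f;A_0,A_1)$, $t>0$. *)

theory Defs
  imports "HOL-Analysis.Analysis" "HOL-Library.Set_Algebras" "HOL-Probability.Essential_Supremum"
begin

section \<open>Quasi-normed spaces and compatible couples\<close>

class hausdorff_tvs = real_vector + topological_ab_group_add + t2_space +
  assumes tendsto_scaleR_Pair:
    "((\<lambda>p. fst p *\<^sub>R snd p) \<longlongrightarrow> a *\<^sub>R x) (nhds a \<times>\<^sub>F nhds x)"

instance real_normed_vector \<subseteq> hausdorff_tvs
proof
  fix a :: real and x :: 'a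
  have "((\<lambda>p. fst p) \<longlongrightarrow> a) (nhds a \<times>\<^sub>F nhds x)" "((\<lambda>p. snd p) \<longlongrightarrow> x) (nhds a \<times>\<^sub>F nhds x)"
    by (auto intro: filterlim_fst filterlim_snd)
  then show "((\<lambda>p. fst p *\<^sub>R snd p) \<longlongrightarrow> a *\<^sub>R x) (nhds a \<times>\<^sub>F nhds x)"
    by (rule tendsto_scaleR)
qed

text \<open>A space lying inside an ambient vector space; the values of \<open>qnorm\<close> outside
  \<open>qspace\<close> are irrelevant. Complex spaces are covered by restricting scalars to the reals, which
  changes neither the quasi-norms nor the \<open>K\<close>-functional.\<close>

record 'a quasi_normed =
  qspace :: "'a set"
  qnorm :: "'a \<Rightarrow> real"

definition quasi_normed_space :: "'a::real_vector quasi_normed \<Rightarrow> bool" where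
  "quasi_normed_space A \<longleftrightarrow>
     subspace (qspace A) \<and>
     (\<forall>x\<in>qspace A. 0 \<le> qnorm A x) \<and>
     (\<forall>x\<in>qspace A. qnorm A x = 0 \<longleftrightarrow> x = 0) \<and>
     (\<forall>c. \<forall>x\<in>qspace A. qnorm A (c *\<^sub>R x) = \<bar>c\<bar> * qnorm A x) \<and>
     (\<exists>C\<ge>1. \<forall>x\<in>qspace A. \<forall>y\<in>qspace A. qnorm A (x + y) \<le> C * (qnorm A x + qnorm A y))"

text \<open>Continuity of the inclusion map. A set is a neighbourhood of \<open>x\<close> in the topology of a
  quasi-norm iff it contains some ball around \<open>x\<close> (the balls themselves need not be open).\<close>

definition continuously_embedded :: "'a::hausdorff_tvs quasi_normed \<Rightarrow> bool" where
  "continuously_embedded A \<longleftrightarrow>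
     (\<forall>U. open U \<longrightarrow>
        (\<forall>x\<in>qspace A \<inter> U. \<exists>r>0. \<forall>y\<in>qspace A. qnorm A (y - x) < r \<longrightarrow> y \<in> U))"

definition compatible_couple :: "'a::hausdorff_tvs quasi_normed \<Rightarrow> 'a quasi_normed \<Rightarrow> bool" where
  "compatible_couple A0 A1 \<longleftrightarrow>
     quasi_normed_space A0 \<and> continuously_embedded A0 \<and>
     quasi_normed_space A1 \<and> continuously_embedded A1"

definition sum_space :: "'a::real_vector quasi_normed \<Rightarrow> 'a quasi_normed \<Rightarrow> 'a set" where
  "sum_space A0 A1 = qspace A0 + qspace A1"

text \<open>The infimum of the empty set in \<^typ>\<open>ennreal\<close> is \<open>\<infinity>\<close>, so \<open>K_fun A0 A1 t f = \<infinity>\<close> for \<open>f\<close>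
  outside the sum.\<close>

definition K_fun ::
    "'a::real_vector quasi_normed \<Rightarrow> 'a quasi_normed \<Rightarrow> ennreal \<Rightarrow> 'a \<Rightarrow> ennreal" where
  "K_fun A0 A1 t f =
     Inf {ennreal (qnorm A0 f0) + t * ennreal (qnorm A1 f1) | f0 f1.
            f0 \<in> qspace A0 \<and> f1 \<in> qspace A1 \<and> f = f0 + f1}"

section \<open>Lebesgue quasi-norms\<close>

text \<open>Real powers of extended nonnegative numbers, for positive exponents only.\<close>

definition epowr :: "ennreal \<Rightarrow> real \<Rightarrow> ennreal" where
  "epowr x p = (if x = \<infinity> then \<infinity> else ennreal (enn2real x powr p))"

definition Lq_norm :: "ennreal \<Rightarrow> real set \<Rightarrow> (real \<Rightarrow> ennreal) \<Rightarrow> ennreal" where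
  "Lq_norm q S F =
     (if q = \<infinity> then esssup (lebesgue_on S) F
      else epowr (\<integral>\<^sup>+u. epowr (F u) (enn2real q) \<partial>lebesgue_on S) (1 / enn2real q))"

text \<open>In \<^typ>\<open>ennreal\<close>, \<open>1 / \<infinity> = 0\<close>, so the exponent below is \<open>- \<theta>\<close> for \<open>q = \<infinity>\<close>.\<close>

definition weight :: "real \<Rightarrow> ennreal \<Rightarrow> (real \<Rightarrow> real) \<Rightarrow> real \<Rightarrow> ennreal" where
  "weight \<theta> q b u = ennreal (u powr (- \<theta> - enn2real (1 / q)) * b u)"

section \<open>Equivalence and slowly varying functions\<close>

definition lesssim_on :: "'i set \<Rightarrow> ('i \<Rightarrow> ennreal) \<Rightarrow> ('i \<Rightarrow> ennreal) \<Rightarrow> bool" where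
  "lesssim_on X F G \<longleftrightarrow> (\<exists>c::real. 0 < c \<and> (\<forall>x\<in>X. F x \<le> ennreal c * G x))"

definition approx_on :: "'i set \<Rightarrow> ('i \<Rightarrow> ennreal) \<Rightarrow> ('i \<Rightarrow> ennreal) \<Rightarrow> bool" where
  "approx_on X F G \<longleftrightarrow> lesssim_on X F G \<and> lesssim_on X G F"

definition equiv_nondecreasing :: "(real \<Rightarrow> ennreal) \<Rightarrow> bool" where
  "equiv_nondecreasing F \<longleftrightarrow>
     (\<exists>g::real \<Rightarrow> real. (\<forall>t>0. 0 < g t) \<and> mono_on {0<..} g \<and>
        approx_on {0<..} F (\<lambda>t. ennreal (g t)))"

definition equiv_nonincreasing :: "(real \<Rightarrow> ennreal) \<Rightarrow> bool" where
  "equiv_nonincreasing F \<longleftrightarrow>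
     (\<exists>g::real \<Rightarrow> real. (\<forall>t>0. 0 < g t) \<and> antimono_on {0<..} g \<and>
        approx_on {0<..} F (\<lambda>t. ennreal (g t)))"

definition SV :: "(real \<Rightarrow> real) set" where
  "SV = {b. b \<in> borel_measurable (lebesgue_on {0<..}) \<and> (\<forall>t>0. 0 < b t) \<and>
        (\<forall>\<epsilon>>0. equiv_nondecreasing (\<lambda>t. ennreal (t powr \<epsilon> * b t)) \<and>
                equiv_nonincreasing (\<lambda>t. ennreal (t powr (- \<epsilon>) * b t)))}"

definition SV0 :: "ennreal \<Rightarrow> (real \<Rightarrow> real) set" where
  "SV0 q = {b \<in> SV. Lq_norm q {1<..} (weight 0 q b) < \<infinity>}"

section \<open>Interpolation spaces and \<open>K\<close>-surjectivity\<close>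

definition interp_norm ::
    "'a::real_vector quasi_normed \<Rightarrow> 'a quasi_normed \<Rightarrow> real \<Rightarrow> ennreal \<Rightarrow> (real \<Rightarrow> real) \<Rightarrow> 'a \<Rightarrow> ennreal"
  where
  "interp_norm A0 A1 \<theta> q b f =
     Lq_norm q {0<..} (\<lambda>u. weight \<theta> q b u * K_fun A0 A1 (ennreal u) f)"

definition interp_space ::
    "'a::real_vector quasi_normed \<Rightarrow> 'a quasi_normed \<Rightarrow> real \<Rightarrow> ennreal \<Rightarrow> (real \<Rightarrow> real) \<Rightarrow> 'a quasi_normed"
  where
  "interp_space A0 A1 \<theta> q b =
     \<lparr>qspace = {f \<in> sum_space A0 A1. interp_norm A0 A1 \<theta> q b f < \<infinity>},
      qnorm = (\<lambda>f. enn2real (interp_norm A0 A1 \<theta> q b f))\<rparr>"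

definition quasi_concave :: "(real \<Rightarrow> real) \<Rightarrow> bool" where
  "quasi_concave \<phi> \<longleftrightarrow>
     (\<forall>t>0. 0 < \<phi> t) \<and> mono_on {0<..} \<phi> \<and> mono_on {0<..} (\<lambda>t. t * \<phi> (1 / t))"

definition K_surjective :: "'a::real_vector quasi_normed \<Rightarrow> 'a quasi_normed \<Rightarrow> bool" where
  "K_surjective A0 A1 \<longleftrightarrow>
     (\<forall>\<phi>. quasi_concave \<phi> \<longrightarrow>
        (\<exists>f\<in>sum_space A0 A1.
           approx_on {0<..} (\<lambda>t. ennreal (\<phi> t)) (\<lambda>t. K_fun A0 A1 (ennreal t) f)))"

section \<open>The quantities of the reiteration formula\<close>

text \<open>The two norms in the quotients are positive and finite for \<open>b0 \<in> SV0 q0\<close>, \<open>b1 \<in> SV0 q1\<close>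
  and \<open>t > 0\<close>.\<close>

definition rho :: "ennreal \<Rightarrow> (real \<Rightarrow> real) \<Rightarrow> ennreal \<Rightarrow> (real \<Rightarrow> real) \<Rightarrow> real \<Rightarrow> ennreal" where
  "rho q0 b0 q1 b1 t = Lq_norm q0 {t<..} (weight 0 q0 b0) / Lq_norm q1 {t<..} (weight 0 q1 b1)"

definition rho_eps ::
    "real \<Rightarrow> ennreal \<Rightarrow> (real \<Rightarrow> real) \<Rightarrow> ennreal \<Rightarrow> (real \<Rightarrow> real) \<Rightarrow> real \<Rightarrow> ennreal" where
  "rho_eps \<epsilon> q0 b0 q1 b1 t =
     epowr (Lq_norm q0 {t<..} (weight 0 q0 b0)) (1 + \<epsilon>) / Lq_norm q1 {t<..} (weight 0 q1 b1)"

definition I_fun ::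
    "'a::real_vector quasi_normed \<Rightarrow> 'a quasi_normed \<Rightarrow> ennreal \<Rightarrow> (real \<Rightarrow> real) \<Rightarrow> real \<Rightarrow> 'a \<Rightarrow> ennreal"
  where
  "I_fun A0 A1 q0 b0 t f =
     Lq_norm q0 {0<..<t} (\<lambda>u. weight 0 q0 b0 u * K_fun A0 A1 (ennreal u) f)"

definition J_fun ::
    "'a::real_vector quasi_normed \<Rightarrow> 'a quasi_normed \<Rightarrow> ennreal \<Rightarrow> (real \<Rightarrow> real) \<Rightarrow> real \<Rightarrow> 'a \<Rightarrow> ennreal"
  where
  "J_fun A0 A1 q1 b1 t f =
     Lq_norm q1 {t<..} (\<lambda>u. weight 0 q1 b1 u * K_fun A0 A1 (ennreal u) f)"

text \<open>The equivalence is over pairs \<open>(f, t)\<close>, so its constants depend on neither \<open>f\<close> nor \<open>t\<close>.\<close>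

definition reiteration_formula ::
    "'a::real_vector quasi_normed \<Rightarrow> 'a quasi_normed \<Rightarrow>
     ennreal \<Rightarrow> (real \<Rightarrow> real) \<Rightarrow> ennreal \<Rightarrow> (real \<Rightarrow> real) \<Rightarrow> bool" where
  "reiteration_formula A0 A1 q0 b0 q1 b1 \<longleftrightarrow>
     approx_on (sum_space A0 A1 \<times> {0<..})
       (\<lambda>(f, t). K_fun (interp_space A0 A1 0 q0 b0) (interp_space A0 A1 0 q1 b1)
                   (rho q0 b0 q1 b1 t) f)
       (\<lambda>(f, t). I_fun A0 A1 q0 b0 t f + rho q0 b0 q1 b1 t * J_fun A0 A1 q1 b1 t f)"

end

theory Submission
  imports Defs
begin

text \<open>
Write \<open>w\<^sub>j(u) = u\<^bsup>-1/q\<^sub>j\<^esup> b\<^sub>j(u)\<close>, let \<open>n\<^sub>j(t)\<close> be the \<open>L\<^bsup>q\<^sub>j\<^esup>\<close>-norm of \<open>w\<^sub>j\<close> on \<open>(t, \<infinity>)\<close>, so that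
\<open>\<rho> = n\<^sub>0 / n\<^sub>1\<close>, and write \<open>k(u) = K(u, f)\<close>. The norm estimates use only two properties of \<open>k\<close>: \<open>k\<close> is
nondecreasing and \<open>k(u)/u\<close> is nonincreasing (a \<^emph>\<open>profile\<close> below). The monotonicity gives
\<open>k(t) n\<^sub>j(t) \<le> \<parallel>w\<^sub>j k\<parallel>\<close> on \<open>(t, \<infinity>)\<close>; slow variation enters through \<open>b\<^sub>j(t) \<lesssim> n\<^sub>j(t)\<close> and through
\<open>\<parallel>w\<^sub>j min(1, u/t)\<parallel> \<lesssim> n\<^sub>j(t)\<close> on \<open>(0, \<infinity>)\<close>.

\<^emph>\<open>Upper estimate.\<close> Split \<open>f = f\<^sub>0 + f\<^sub>1\<close> nearly optimally for \<open>K(t, f)\<close>. Then \<open>K(\<cdot>, f\<^sub>0)\<close> is controlled by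
\<open>k\<close> on \<open>(0, t)\<close> plus \<open>k(t) min(1, u/t)\<close>, and \<open>K(\<cdot>, f\<^sub>1)\<close> by \<open>k\<close> on \<open>(t, \<infinity>)\<close> plus the same truncation.
Taking norms, the truncations cost \<open>k(t) n\<^sub>0(t) = \<rho>(t) k(t) n\<^sub>1(t) \<le> \<rho>(t) J(t, f)\<close>.

\<^emph>\<open>Lower estimate.\<close> By the quasi-triangle inequality it reduces to two embeddings for a single profile:
the norm of \<open>w\<^sub>0 k\<close> on \<open>(0, t)\<close> is at most a constant times \<open>\<rho>(t)\<close> times that of \<open>w\<^sub>1 k\<close> on \<open>(0, \<infinity>)\<close>,
and the norm of \<open>w\<^sub>1 k\<close> on \<open>(t, \<infinity>)\<close> is at most a constant times \<open>1/\<rho>(t)\<close> times that of \<open>w\<^sub>0 k\<close>.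
Bound \<open>k\<close> pointwise by a multiple of \<open>1/n\<^sub>1\<close>, respectively \<open>1/n\<^sub>0\<close>, and use that \<open>n\<^sub>0\<^bsup>1+\<epsilon>\<^esup>/n\<^sub>1\<close> is almost increasing to
replace \<open>1/n\<^sub>1\<close> by a power of \<open>n\<^sub>0\<close> and vice versa; the gain \<open>\<epsilon>\<close> makes the resulting Hardy-type
integrals of powers of the tails converge (\<open>Lq_norm_hardy_left\<close>, \<open>Lq_norm_hardy_right\<close>).

\<^emph>\<open>Necessity.\<close> Let the formula hold and let the couple be \<open>K\<close>-surjective. Each positive profile is then equivalent to
some \<open>K(\<cdot>, f)\<close>, so both embeddings hold for every positive profile with a constant that depends on it;
a gliding-hump argument (\<open>uniform_bound\<close>) makes the constant uniform. Testing the second embedding with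
\<open>min(1, u/t)\<close> shows that \<open>\<rho>\<close> is almost increasing. Suppose now \<open>q\<^sub>0 < q\<^sub>1\<close>, and that \<open>\<rho>\<close> is essentially
constant on an interval \<open>[s, t]\<close> along which \<open>n\<^sub>0\<close> drops by the factor \<open>2\<^bsup>K\<^esup>\<close>. Choose \<open>x\<^sub>k\<close> in it with
\<open>n\<^sub>0(x\<^sub>k) = 2\<^bsup>-k\<^esup> n\<^sub>0(s)\<close> and test the first embedding with the maximum of the \<open>2\<^bsup>k\<^esup> min(1, u/x\<^sub>k)\<close>. All \<open>K\<close>
layers contribute equally to both sides, so \<open>K\<^bsup>1/q\<^sub>0\<^esup> \<lesssim> (K+1)\<^bsup>1/q\<^sub>1\<^esup>\<close>, which bounds \<open>K\<close>
(\<open>no_long_plateau\<close>). Hence for a fixed \<open>K\<close> the function \<open>\<rho>\<close> doubles whenever \<open>n\<^sub>0\<close> drops by \<open>2\<^bsup>K\<^esup>\<close>, which means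
that \<open>\<rho> n\<^sub>0\<^bsup>1/K\<^esup> = n\<^sub>0\<^bsup>1+1/K\<^esup>/n\<^sub>1\<close> is almost increasing (\<open>dyadic_growth\<close>). If \<open>q\<^sub>1 < q\<^sub>0\<close>, the same argument with the
two weights exchanged and the second embedding shows that \<open>\<rho> n\<^sub>1\<^bsup>\<epsilon>\<^esup> = n\<^sub>0/n\<^sub>1\<^bsup>1-\<epsilon>\<^esup>\<close> is almost increasing,
and raising it to the power \<open>1/(1-\<epsilon>)\<close> gives the condition.
\<close>

section \<open>Extended real powers and Lebesgue quasi-norms\<close>

lemma epowr_ennreal: "0 \<le> x \<Longrightarrow> epowr (ennreal x) p = ennreal (x powr p)"
  by (simp add: epowr_def)

lemma epowr_top [simp]: "epowr top p = top"
  by (simp add: epowr_def)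

lemma epowr_mono:
  assumes "x \<le> y" "0 < p"
  shows "epowr x p \<le> epowr y p"
proof (cases y)
  case (real r)
  then obtain s where "x = ennreal s" "0 \<le> s" "s \<le> r"
    using assms(1) by (cases x) (auto simp: top_unique)
  with real assms(2) show ?thesis
    by (simp add: epowr_ennreal powr_mono2)
qed simp

lemma epowr_epowr: "epowr (epowr x p) r = epowr x (p * r)"
  by (cases x) (simp_all add: epowr_ennreal powr_powr)

lemma epowr_one [simp]: "epowr x 1 = x"
  by (cases x) (simp_all add: epowr_ennreal)

lemma epowr_mult: "0 < p \<Longrightarrow> epowr (x * y) p = epowr x p * epowr y p"
proof -
  assume p: "0 < p"
  have 1: "epowr (top * ennreal r) p = top * epowr (ennreal r) p" if "0 \<le> r" for r
    using that p by (cases "r = 0") (auto simp: epowr_ennreal ennreal_top_mult epowr_def)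
  show ?thesis
    by (cases x; cases y)
      (use p 1 in \<open>auto simp: epowr_ennreal powr_mult mult.commute ennreal_mult[symmetric]\<close>)
qed

lemma epowr_le_iff: "0 < p \<Longrightarrow> epowr x p \<le> y \<longleftrightarrow> x \<le> epowr y (1 / p)"
  using epowr_mono[of x "epowr y (1/p)" p] epowr_mono[of "epowr x p" y "1/p"]
  by (auto simp: epowr_epowr)

lemma epowr_add_le:
  assumes "0 < p"
  shows "epowr (x + y) p \<le> epowr 2 p * (epowr x p + epowr y p)"
proof -
  have *: "x + y \<le> 2 * max x y"
    by (metis add_mono max.cobounded1 max.cobounded2 mult_2)
  have "epowr (x + y) p \<le> epowr 2 p * epowr (max x y) p"
    using epowr_mono[OF * assms] by (simp add: epowr_mult assms)
  also have "epowr (max x y) p \<le> epowr x p + epowr y p"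
    by (auto simp: max_def)
  finally show ?thesis by (simp add: mult_left_mono)
qed

lemma epowr_SUP_le:
  assumes "0 < p"
  shows "epowr (SUP i\<in>I. f i) p \<le> (SUP i\<in>I. epowr (f i) p)"
  unfolding epowr_le_iff[OF assms]
  by (intro SUP_least) (auto simp: epowr_le_iff[OF assms, symmetric] intro: SUP_upper)

lemma measurable_epowr [measurable]:
  assumes [measurable]: "f \<in> borel_measurable M"
  shows "(\<lambda>x. epowr (f x) p) \<in> borel_measurable M"
  unfolding epowr_def by measurable

lemma enn2real_inverse:
  fixes q :: ennreal
  assumes "0 < q" "q \<noteq> \<infinity>"
  shows "enn2real q > 0" "enn2real (1 / q) = 1 / enn2real q"
proof -
  obtain p where p: "q = ennreal p" "0 < p"
    using assms by (cases q) auto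
  then show "enn2real q > 0" by simp
  show "enn2real (1 / q) = 1 / enn2real q"
    using p divide_ennreal[of 1 p] by simp
qed

text \<open>On \<^typ>\<open>ennreal\<close> this includes \<open>y = \<infinity>\<close>, where the reciprocal exponent is \<open>0\<close>.\<close>

lemma enn2real_inverse_less:
  fixes x y :: ennreal
  assumes "0 < x" "x < y"
  shows "enn2real (1 / y) < enn2real (1 / x)"
proof -
  have x: "x \<noteq> \<infinity>" using assms by auto
  note px = enn2real_inverse[OF assms(1) x]
  show ?thesis
  proof (cases "y = \<infinity>")
    case True
    then show ?thesis using px by simp
  next
    case False
    have y: "0 < y" using assms by simp
    note py = enn2real_inverse[OF y False]
    have "enn2real x < enn2real y"
      using assms x False by (cases x; cases y) (auto simp: ennreal_less_iff)
    then show ?thesis unfolding px(2) py(2) using px(1) by (simp add: frac_less2)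
  qed
qed

lemma Lq_norm_finite_eq:
  "q \<noteq> \<infinity> \<Longrightarrow> Lq_norm q S F =
     epowr (\<integral>\<^sup>+u. epowr (F u) (enn2real q) \<partial>lebesgue_on S) (1 / enn2real q)"
  by (simp add: Lq_norm_def)

lemma Lq_norm_top: "Lq_norm top S F = esssup (lebesgue_on S) F"
  by (simp add: Lq_norm_def)

lemma epowr_Lq_norm:
  assumes "0 < q" "q \<noteq> \<infinity>"
  shows "epowr (Lq_norm q S F) (enn2real q) = (\<integral>\<^sup>+u. epowr (F u) (enn2real q) \<partial>lebesgue_on S)"
  using enn2real_inverse(1)[OF assms] assms(2) by (simp add: Lq_norm_finite_eq epowr_epowr)

lemma Lq_norm_mono:
  assumes "0 < q" "F \<in> borel_measurable (lebesgue_on S)" "\<And>u. u \<in> S \<Longrightarrow> F u \<le> G u"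
  shows "Lq_norm q S F \<le> Lq_norm q S G"
proof (cases "q = \<infinity>")
  case True
  then show ?thesis
    using assms by (auto simp: Lq_norm_top intro!: esssup_AE_mono AE_I2)
next
  case False
  note p = enn2real_inverse[OF assms(1) False]
  show ?thesis
    unfolding Lq_norm_finite_eq[OF False]
    by (intro epowr_mono nn_integral_mono) (use p assms(3) in auto)
qed

lemma Lq_norm_mono_set:
  assumes "0 < q" "F \<in> borel_measurable (lebesgue_on T)" "S \<subseteq> T" "S \<in> sets lebesgue" "T \<in> sets lebesgue"
  shows "Lq_norm q S F \<le> Lq_norm q T F"
proof (cases "q = \<infinity>")
  case True
  have "AE u in lebesgue_on T. F u \<le> esssup (lebesgue_on T) F"
    by (rule esssup_AE)
  then have "AE u in lebesgue_on S. F u \<le> esssup (lebesgue_on T) F"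
    using assms by (subst AE_restrict_space_iff; simp) (auto simp: AE_restrict_space_iff elim: eventually_mono)
  then show ?thesis
    using measurable_restrict_mono[OF assms(2,3)] by (auto simp: True Lq_norm_top)
next
  case False
  note p = enn2real_inverse[OF assms(1) False]
  have "(\<integral>\<^sup>+u. epowr (F u) (enn2real q) \<partial>lebesgue_on S)
      \<le> (\<integral>\<^sup>+u. epowr (F u) (enn2real q) \<partial>lebesgue_on T)"
    using assms by (auto simp: nn_integral_restrict_space intro!: nn_integral_mono split: split_indicator)
  then show ?thesis
    unfolding Lq_norm_finite_eq[OF False] using p(1) by (intro epowr_mono) auto
qed

lemma Lq_norm_cmult:
  assumes "0 < q" "F \<in> borel_measurable (lebesgue_on S)"
  shows "Lq_norm q S (\<lambda>u. c * F u) \<le> c * Lq_norm q S F"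
proof (cases "q = \<infinity>")
  case True
  have "AE u in lebesgue_on S. c * F u \<le> c * esssup (lebesgue_on S) F"
    using esssup_AE[of F "lebesgue_on S"] by eventually_elim (rule mult_left_mono, auto)
  then show ?thesis
    using assms by (auto simp: True Lq_norm_top)
next
  case False
  note p = enn2real_inverse[OF assms(1) False]
  have "epowr (epowr c (enn2real q)) (1 / enn2real q) = c"
    using p(1) by (simp add: epowr_epowr)
  then show ?thesis
    unfolding Lq_norm_finite_eq[OF False] using p(1) assms
    by (simp add: epowr_mult nn_integral_cmult)
qed

lemma Lq_norm_cmult_eq:
  assumes "0 < q" "F \<in> borel_measurable (lebesgue_on S)" "c < \<infinity>"
  shows "Lq_norm q S (\<lambda>u. c * F u) = c * Lq_norm q S F"
proof (rule antisym)
  show "Lq_norm q S (\<lambda>u. c * F u) \<le> c * Lq_norm q S F"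
    by (rule Lq_norm_cmult) fact+
  show "c * Lq_norm q S F \<le> Lq_norm q S (\<lambda>u. c * F u)"
  proof (cases "c = 0")
    case False
    obtain r where r: "c = ennreal r" "0 < r"
      using assms(3) False by (cases c) auto
    have 1: "ennreal (1 / r) * c = 1" "c * ennreal (1 / r) = 1"
      using r by (simp_all add: ennreal_mult[symmetric])
    have "c * Lq_norm q S F = c * Lq_norm q S (\<lambda>u. ennreal (1 / r) * (c * F u))"
      by (simp add: mult.assoc[symmetric] 1)
    also have "\<dots> \<le> c * (ennreal (1 / r) * Lq_norm q S (\<lambda>u. c * F u))"
      using assms by (intro mult_left_mono Lq_norm_cmult) auto
    also have "\<dots> = Lq_norm q S (\<lambda>u. c * F u)"
      by (simp add: mult.assoc[symmetric] 1)
    finally show ?thesis .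
  qed simp
qed

lemma Lq_norm_indicator:
  assumes "0 < q" "F \<in> borel_measurable (lebesgue_on T)" "S \<subseteq> T" "S \<in> sets lebesgue" "T \<in> sets lebesgue"
  shows "Lq_norm q T (\<lambda>u. F u * indicator S u) \<le> Lq_norm q S F"
proof (cases "q = \<infinity>")
  case True
  have "AE u in lebesgue. u \<in> S \<longrightarrow> F u \<le> esssup (lebesgue_on S) F"
    using esssup_AE[of F "lebesgue_on S"] assms by (simp add: AE_restrict_space_iff)
  then have "AE u in lebesgue_on T. F u * indicator S u \<le> esssup (lebesgue_on S) F"
    using assms(5) by (simp add: AE_restrict_space_iff) (auto elim!: eventually_mono split: split_indicator)
  moreover have "indicator S \<in> borel_measurable (lebesgue_on T)"
    using assms by (intro measurable_restrict_space1 borel_measurable_indicator)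
  ultimately show ?thesis
    using assms(2) unfolding True infinity_ennreal_def Lq_norm_top
    by (intro esssup_I borel_measurable_times_ennreal)
next
  case False
  note p = enn2real_inverse[OF assms(1) False]
  have "(\<integral>\<^sup>+u. epowr (F u * indicator S u) (enn2real q) \<partial>lebesgue_on T)
      \<le> (\<integral>\<^sup>+u. epowr (F u) (enn2real q) \<partial>lebesgue_on S)"
    using assms p(1) by (auto simp: nn_integral_restrict_space epowr_def intro!: nn_integral_mono split: split_indicator)
  then show ?thesis
    unfolding Lq_norm_finite_eq[OF False] using p(1) by (intro epowr_mono) auto
qed

text \<open>A quasi-triangle constant for every \<open>0 < q \<le> \<infinity>\<close>, crude for \<open>q \<ge> 1\<close>; it serves for sums of functions and for
unions of domains alike.\<close>

definition Lq_const :: "ennreal \<Rightarrow> real" where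
  "Lq_const q = 2 powr (1 + enn2real (1 / q))"

lemma Lq_const_ge_1: "1 \<le> Lq_const q"
  unfolding Lq_const_def by (rule ge_one_powr_ge_zero) auto

lemma epowr_root_add_le:
  assumes "0 < q" "q \<noteq> \<infinity>"
  shows "epowr (epowr 2 (enn2real q) * (x + y)) (1 / enn2real q)
       \<le> Lq_const q * (epowr x (1 / enn2real q) + epowr y (1 / enn2real q))"
proof -
  note p = enn2real_inverse[OF assms]
  let ?p = "1 / enn2real q"
  have "epowr (epowr 2 (enn2real q) * (x + y)) ?p = 2 * epowr (x + y) ?p"
    using p(1) by (simp add: epowr_mult epowr_epowr)
  also have "\<dots> \<le> 2 * (epowr 2 ?p * (epowr x ?p + epowr y ?p))"
    using p(1) by (intro mult_left_mono epowr_add_le) auto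
  also have "\<dots> = (2 * epowr 2 ?p) * (epowr x ?p + epowr y ?p)"
    by (simp add: mult.assoc)
  also have "2 * epowr 2 ?p = ennreal (2 powr (1 + ?p))"
    using p epowr_ennreal[of 2 ?p] by (simp add: powr_add ennreal_mult)
  also have "\<dots> = ennreal (Lq_const q)"
    by (simp add: Lq_const_def p(2))
  finally show ?thesis by (simp add: mult_right_mono)
qed

lemma Lq_norm_add:
  assumes "0 < q" "F \<in> borel_measurable (lebesgue_on S)" "G \<in> borel_measurable (lebesgue_on S)"
  shows "Lq_norm q S (\<lambda>u. F u + G u) \<le> Lq_const q * (Lq_norm q S F + Lq_norm q S G)"
proof (cases "q = \<infinity>")
  case True
  let ?M = "lebesgue_on S"
  have "AE u in ?M. F u + G u \<le> esssup ?M F + esssup ?M G"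
    using esssup_AE[of F ?M] esssup_AE[of G ?M] by eventually_elim (rule add_mono)
  then have "esssup ?M (\<lambda>u. F u + G u) \<le> 1 * (esssup ?M F + esssup ?M G)"
    using assms by auto
  also have "\<dots> \<le> Lq_const q * (esssup ?M F + esssup ?M G)"
    using Lq_const_ge_1 by (intro mult_right_mono) auto
  finally show ?thesis by (simp add: True Lq_norm_top)
next
  case False
  note p = enn2real_inverse[OF assms(1) False]
  let ?p = "enn2real q"
  have "(\<integral>\<^sup>+u. epowr (F u + G u) ?p \<partial>lebesgue_on S)
      \<le> (\<integral>\<^sup>+u. epowr 2 ?p * (epowr (F u) ?p + epowr (G u) ?p) \<partial>lebesgue_on S)"
    using p(1) by (intro nn_integral_mono epowr_add_le) auto
  also have "\<dots> = epowr 2 ?p * ((\<integral>\<^sup>+u. epowr (F u) ?p \<partial>lebesgue_on S) + (\<integral>\<^sup>+u. epowr (G u) ?p \<partial>lebesgue_on S))"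
    using assms by (simp add: nn_integral_cmult nn_integral_add)
  finally show ?thesis
    unfolding Lq_norm_finite_eq[OF False] using p(1) assms(1) False
    by (intro order.trans[OF epowr_mono epowr_root_add_le]) auto
qed

lemma Lq_norm_Un:
  assumes "0 < q" "F \<in> borel_measurable (lebesgue_on (S \<union> T))" "S \<in> sets lebesgue" "T \<in> sets lebesgue"
  shows "Lq_norm q (S \<union> T) F \<le> Lq_const q * (Lq_norm q S F + Lq_norm q T F)"
proof (cases "q = \<infinity>")
  case True
  have 1: "AE u in lebesgue. u \<in> S \<longrightarrow> F u \<le> esssup (lebesgue_on S) F"
    using esssup_AE[of F "lebesgue_on S"] assms by (simp add: AE_restrict_space_iff)
  have 2: "AE u in lebesgue. u \<in> T \<longrightarrow> F u \<le> esssup (lebesgue_on T) F"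
    using esssup_AE[of F "lebesgue_on T"] assms by (simp add: AE_restrict_space_iff)
  have "AE u in lebesgue. u \<in> S \<union> T \<longrightarrow> F u \<le> esssup (lebesgue_on S) F + esssup (lebesgue_on T) F"
    using 1 2 by eventually_elim (auto intro: add_increasing add_increasing2)
  then have "esssup (lebesgue_on (S \<union> T)) F \<le> 1 * (esssup (lebesgue_on S) F + esssup (lebesgue_on T) F)"
    using assms by (intro esssup_I) (auto simp: AE_restrict_space_iff)
  also have "\<dots> \<le> Lq_const q * (esssup (lebesgue_on S) F + esssup (lebesgue_on T) F)"
    using Lq_const_ge_1 by (intro mult_right_mono) auto
  finally show ?thesis by (simp add: True Lq_norm_top)
next
  case False
  note p = enn2real_inverse[OF assms(1) False]
  let ?p = "enn2real q" and ?G = "\<lambda>u. epowr (F u) (enn2real q)"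
  have FS: "?G \<in> borel_measurable (lebesgue_on S)" and FT: "?G \<in> borel_measurable (lebesgue_on T)"
    using measurable_restrict_mono[OF assms(2)] by auto
  have "(\<integral>\<^sup>+u. ?G u \<partial>lebesgue_on (S \<union> T))
      \<le> (\<integral>\<^sup>+u. ?G u * indicator S u + ?G u * indicator T u \<partial>lebesgue)"
    using assms by (auto simp: nn_integral_restrict_space intro!: nn_integral_mono split: split_indicator)
  also have "\<dots> = (\<integral>\<^sup>+u. ?G u \<partial>lebesgue_on S) + (\<integral>\<^sup>+u. ?G u \<partial>lebesgue_on T)"
    using assms FS FT by (subst nn_integral_add) (auto simp: nn_integral_restrict_space borel_measurable_restrict_space_iff_ennreal)
  also have "\<dots> \<le> epowr 2 ?p * \<dots>"
  proof -
    have "(1::ennreal) \<le> epowr 2 ?p"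
      using p epowr_ennreal[of 2 ?p] by (simp add: ge_one_powr_ge_zero)
    then show ?thesis using mult_right_mono by fastforce
  qed
  finally show ?thesis
    unfolding Lq_norm_finite_eq[OF False] using p(1) assms(1) False
    by (intro order.trans[OF epowr_mono epowr_root_add_le]) auto
qed

lemma Lq_norm_const:
  assumes "0 < q" "a < b"
  shows "Lq_norm q {a<..<b} (\<lambda>_. c) = c * ennreal ((b - a) powr enn2real (1 / q))"
proof (cases "q = \<infinity>")
  case True
  then show ?thesis
    using assms by (simp add: Lq_norm_top esssup_const emeasure_restrict_space)
next
  case False
  note p = enn2real_inverse[OF assms(1) False]
  show ?thesis
    unfolding Lq_norm_finite_eq[OF False] p(2) using p(1) assms
    by (simp add: epowr_mult epowr_epowr epowr_ennreal emeasure_restrict_space)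
qed

lemma Lq_norm_SUP_top:
  assumes "\<And>n::nat. F n \<in> borel_measurable (lebesgue_on S)" "\<And>n. Lq_norm top S (F n) \<le> c"
  shows "Lq_norm top S (\<lambda>u. SUP n. F n u) \<le> c"
proof -
  have "AE u in lebesgue_on S. F n u \<le> c" for n
    using esssup_AE[of "F n" "lebesgue_on S"] assms(2)[of n] unfolding Lq_norm_top
    by (auto elim: eventually_mono)
  then have "AE u in lebesgue_on S. \<forall>n. F n u \<le> c"
    by (simp add: AE_all_countable)
  then have "AE u in lebesgue_on S. (SUP n. F n u) \<le> c"
    by eventually_elim (auto intro: SUP_least)
  then show ?thesis
    using assms(1) by (auto simp: Lq_norm_top)
qed

lemma Lq_norm_SUP_finite:
  assumes "0 < q" "q \<noteq> \<infinity>" "\<And>n::nat. F n \<in> borel_measurable (lebesgue_on S)"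
  shows "epowr (Lq_norm q S (\<lambda>u. SUP n. F n u)) (enn2real q) \<le> (\<Sum>n. epowr (Lq_norm q S (F n)) (enn2real q))"
proof -
  note p = enn2real_inverse[OF assms(1,2)]
  let ?p = "enn2real q"
  have "(\<integral>\<^sup>+u. epowr (SUP n. F n u) ?p \<partial>lebesgue_on S) \<le> (\<integral>\<^sup>+u. (\<Sum>n. epowr (F n u) ?p) \<partial>lebesgue_on S)"
  proof (intro nn_integral_mono)
    fix u
    have "epowr (F n u) ?p \<le> (\<Sum>n. epowr (F n u) ?p)" for n
      using sum_le_suminf[of "\<lambda>n. epowr (F n u) ?p" "{n}"] by auto
    then show "epowr (SUP n. F n u) ?p \<le> (\<Sum>n. epowr (F n u) ?p)"
      using p(1) by (intro order.trans[OF epowr_SUP_le] SUP_least) auto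
  qed
  also have "\<dots> = (\<Sum>n. \<integral>\<^sup>+u. epowr (F n u) ?p \<partial>lebesgue_on S)"
    using assms by (intro nn_integral_suminf) auto
  finally show ?thesis
    unfolding epowr_Lq_norm[OF assms(1,2)] .
qed

text \<open>Suprema are better behaved than sums here: for \<open>q < \<infinity>\<close> the \<open>q\<close>-th power of a supremum is at most
the sum of the \<open>q\<close>-th powers, so geometric decay suffices also for \<open>q < 1\<close>, where the triangle inequality fails.\<close>

lemma Lq_norm_SUP_geometric:
  assumes "0 < q" "\<And>n::nat. F n \<in> borel_measurable (lebesgue_on S)"
    "\<And>n. Lq_norm q S (F n) \<le> ennreal ((1/2)^n)"
  shows "Lq_norm q S (\<lambda>u. SUP n. F n u) < \<infinity>"
proof (cases "q = \<infinity>")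
  case True
  have "Lq_norm q S (F n) \<le> 1" for n
    by (rule order.trans[OF assms(3)]) (simp add: power_le_one)
  then have "Lq_norm q S (\<lambda>u. SUP n. F n u) \<le> 1"
    using Lq_norm_SUP_top[OF assms(2), where c = 1] True by simp
  then show ?thesis
    by (rule order.strict_trans1) simp
next
  case False
  note p = enn2real_inverse[OF assms(1) False]
  let ?p = "enn2real q"
  have "(1/2::real) powr ?p < 1"
    using p(1) powr_less_mono2[of ?p "1/2" 1] by simp
  then have s: "summable (\<lambda>n. ((1/2::real) powr ?p) ^ n)"
    by (intro summable_geometric) auto
  have "epowr (Lq_norm q S (F n)) ?p \<le> ennreal (((1/2) powr ?p) ^ n)" for n
  proof -
    have "((1/2::real) ^ n) powr ?p = ((1/2) powr ?p) ^ n"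
      using powr_powr_swap[of "1/2" "real n" ?p] by (simp add: powr_realpow)
    then show ?thesis
      using epowr_mono[OF assms(3)[of n] p(1)] by (simp only: epowr_ennreal zero_le_power zero_le_divide_1_iff zero_le_numeral)
  qed
  then have "(\<Sum>n. epowr (Lq_norm q S (F n)) ?p) \<le> (\<Sum>n. ennreal (((1/2) powr ?p) ^ n))"
    by (intro suminf_le) auto
  also have "\<dots> < \<infinity>"
    using s by (subst suminf_ennreal2) auto
  finally have "epowr (Lq_norm q S (\<lambda>u. SUP n. F n u)) ?p < \<infinity>"
    by (rule order.strict_trans1[OF Lq_norm_SUP_finite[OF assms(1) False assms(2)]])
  then show ?thesis
    by (auto simp: epowr_def less_top split: if_splits)
qed

text \<open>The factor \<open>(N + 1)\<^bsup>1/q\<^esup>\<close>, and not \<open>N + 1\<close>, is what distinguishes the exponents \<open>q\<^sub>0\<close> and \<open>q\<^sub>1\<close> in the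
necessity proof.\<close>

lemma Lq_norm_SUP_upto:
  assumes "0 < q" "\<And>n::nat. F n \<in> borel_measurable (lebesgue_on S)"
    "\<And>n. n \<le> N \<Longrightarrow> Lq_norm q S (F n) \<le> c"
  shows "Lq_norm q S (\<lambda>u. SUP n\<in>{..N}. F n u) \<le> ennreal (real (Suc N) powr enn2real (1 / q)) * c"
proof -
  define G where "G n u = (if n \<le> N then F n u else 0)" for n u
  have G: "G n \<in> borel_measurable (lebesgue_on S)" for n
    unfolding G_def using assms(2) by (cases "n \<le> N") auto
  have GF: "(SUP n\<in>{..N}. F n u) = (SUP n. G n u)" for u
  proof (rule antisym)
    show "(SUP n\<in>{..N}. F n u) \<le> (SUP n. G n u)"
    proof (rule SUP_least)
      fix n assume "n \<in> {..N}"
      then have "F n u = G n u" by (simp add: G_def)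
      then show "F n u \<le> (SUP n. G n u)" by (auto intro: SUP_upper)
    qed
    show "(SUP n. G n u) \<le> (SUP n\<in>{..N}. F n u)"
      unfolding G_def by (intro SUP_least) (auto intro: SUP_upper)
  qed
  have L0: "Lq_norm q S (\<lambda>_. 0) \<le> 0"
    using Lq_norm_cmult[OF assms(1), of "\<lambda>_. 0" S 0] by simp
  have Gc: "Lq_norm q S (G n) \<le> (if n \<le> N then c else 0)" for n
    unfolding G_def using assms(3)[of n] L0 by (cases "n \<le> N") auto
  show ?thesis
  proof (cases "q = \<infinity>")
    case True
    have "Lq_norm q S (G n) \<le> c" for n
      using Gc[of n] by (auto split: if_splits)
    then show ?thesis
      using Lq_norm_SUP_top[OF G, where c = c] unfolding GF True by simp
  next
    case False
    note p = enn2real_inverse[OF assms(1) False]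
    let ?p = "enn2real q"
    have "epowr (Lq_norm q S (\<lambda>u. SUP n. G n u)) ?p \<le> (\<Sum>n. epowr (Lq_norm q S (G n)) ?p)"
      by (rule Lq_norm_SUP_finite[OF assms(1) False G])
    also have "\<dots> \<le> (\<Sum>n. if n \<le> N then epowr c ?p else 0)"
    proof (intro suminf_le)
      fix n
      show "epowr (Lq_norm q S (G n)) ?p \<le> (if n \<le> N then epowr c ?p else 0)"
        using epowr_mono[OF Gc[of n] p(1)] by (auto simp: epowr_def split: if_splits)
    qed auto
    also have "\<dots> = (\<Sum>n\<le>N. epowr c ?p)"
      by (subst suminf_finite[of "{..N}"]) auto
    also have "\<dots> = ennreal (real (Suc N)) * epowr c ?p"
      by (simp add: ennreal_of_nat_eq_real_of_nat[symmetric])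
    finally show ?thesis
      unfolding GF epowr_le_iff[OF p(1)] p(2) using p(1)
      by (simp add: epowr_mult epowr_epowr epowr_ennreal del: of_nat_Suc)
  qed
qed

lemma borel_imp_lebesgue_on: "f \<in> borel_measurable borel \<Longrightarrow> f \<in> borel_measurable (lebesgue_on S)"
  by (intro measurable_restrict_space1 measurable_completion) simp

text \<open>The model integral for the behaviour near \<open>0\<close> of \<open>u/t\<close> times a slowly varying weight: half a power
of \<open>u\<close> absorbs the slow variation, the other half is integrated here.\<close>

lemma Lq_norm_sqrt_weight:
  assumes "0 < q"
  shows "\<exists>C>0. \<forall>t>0. Lq_norm q {0<..t} (\<lambda>u. ennreal (u powr (1/2 - enn2real (1 / q)))) \<le> ennreal (C * t powr (1/2))"
proof (cases "q = \<infinity>")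
  case True
  have "esssup (lebesgue_on {0<..t}) (\<lambda>u. ennreal (u powr (1/2))) \<le> ennreal (t powr (1/2))" if "0 < t" for t
    by (rule esssup_I) (auto intro!: AE_I2 ennreal_leI powr_mono2 borel_imp_lebesgue_on)
  then show ?thesis
    by (intro exI[of _ 1]) (simp add: True Lq_norm_top)
next
  case False
  note p = enn2real_inverse[OF assms False]
  define p where "p = enn2real q"
  have p0: "0 < p" unfolding p_def by (rule p(1))
  define C where "C = (2 / p) powr (1 / p)"
  have "Lq_norm q {0<..t} (\<lambda>u. ennreal (u powr (1/2 - enn2real (1 / q)))) = ennreal (C * t powr (1/2))"
    if t: "0 < t" for t
  proof -
    have "(\<integral>\<^sup>+u. epowr (ennreal (u powr (1/2 - 1/p))) p \<partial>lebesgue_on {0<..t})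
        = (\<integral>\<^sup>+u. epowr (ennreal (u powr (1/2 - 1/p))) p * indicator {0<..t} u \<partial>lebesgue)"
      by (rule nn_integral_restrict_space) auto
    also have "\<dots> = (\<integral>\<^sup>+u. ennreal (u powr (p/2 - 1)) * indicator {0..t} u \<partial>lebesgue)"
      using p0 by (intro nn_integral_cong) (auto simp: epowr_ennreal powr_powr left_diff_distrib split: split_indicator)
    also have "\<dots> = (\<integral>\<^sup>+u. ennreal (u powr (p/2 - 1)) * indicator {0..t} u \<partial>lborel)"
      by (intro nn_integral_completion)
    also have "\<dots> = ennreal (t powr (p/2 - 1 + 1) / (p/2 - 1 + 1))"
      using p0 t by (intro nn_integral_has_integral_lebesgue' has_integral_powr_from_0) auto
    finally have *: "(\<integral>\<^sup>+u. epowr (ennreal (u powr (1/2 - 1/p))) p \<partial>lebesgue_on {0<..t}) = ennreal ((2 / p) * t powr (p/2))"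
      by (simp add: mult.commute)
    have "Lq_norm q {0<..t} (\<lambda>u. ennreal (u powr (1/2 - enn2real (1 / q)))) = epowr (ennreal ((2 / p) * t powr (p/2))) (1/p)"
      unfolding Lq_norm_finite_eq[OF False] p(2) p_def[symmetric] * ..
    also have "\<dots> = ennreal (C * t powr (1/2))"
    proof -
      have "(2 / p * t powr (p/2)) powr (1/p) = C * t powr (1/2)"
        using p0 by (subst powr_mult) (auto simp: powr_powr C_def)
      moreover have "epowr (ennreal (2 / p * t powr (p/2))) (1 / p) = ennreal ((2 / p * t powr (p/2)) powr (1/p))"
        using p0 by (intro epowr_ennreal) simp
      ultimately show ?thesis by simp
    qed
    finally show ?thesis .
  qed
  then show ?thesis using p0 by (intro exI[of _ C]) (auto simp: C_def)
qed

section \<open>Slowly varying weights and their tails\<close>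

text \<open>A positive function is equivalent to a nondecreasing one iff it is almost increasing; the running
supremum is an equivalent nondecreasing function. All monotonicity conditions are used in this form.\<close>

lemma equiv_nondecreasing_iff:
  assumes h: "\<And>t. 0 < t \<Longrightarrow> 0 < h t" and F: "\<And>t. 0 < t \<Longrightarrow> F t = ennreal (h t)"
  shows "equiv_nondecreasing F \<longleftrightarrow> (\<exists>c>0. \<forall>s t. 0 < s \<and> s \<le> t \<longrightarrow> h s \<le> c * h t)"
proof
  assume "equiv_nondecreasing F"
  then obtain g c1 c2 where g: "\<And>t. 0 < t \<Longrightarrow> 0 < g t" "mono_on {0<..} g" and c: "0 < c1" "0 < c2"
    and le: "\<And>t. 0 < t \<Longrightarrow> F t \<le> ennreal c1 * ennreal (g t)" "\<And>t. 0 < t \<Longrightarrow> ennreal (g t) \<le> ennreal c2 * F t"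
    unfolding equiv_nondecreasing_def approx_on_def lesssim_on_def by (fastforce simp: Ball_def)
  have hg: "h t \<le> c1 * g t" "g t \<le> c2 * h t" if "0 < t" for t
    using le[OF that] F[OF that] c g(1)[OF that] h[OF that]
    by (auto simp: ennreal_mult[symmetric] ennreal_le_iff less_imp_le)
  have "h s \<le> (c1 * c2) * h t" if "0 < s" "s \<le> t" for s t
  proof -
    have "h s \<le> c1 * g s" using hg that by simp
    also have "\<dots> \<le> c1 * g t" using g(2) that c by (auto simp: mono_on_def)
    also have "\<dots> \<le> c1 * (c2 * h t)" using hg[of t] that c by auto
    finally show ?thesis by (simp add: mult.assoc)
  qed
  then show "\<exists>c>0. \<forall>s t. 0 < s \<and> s \<le> t \<longrightarrow> h s \<le> c * h t"
    using c by (intro exI[of _ "c1 * c2"]) auto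
next
  assume "\<exists>c>0. \<forall>s t. 0 < s \<and> s \<le> t \<longrightarrow> h s \<le> c * h t"
  then obtain c where c: "0 < c" "\<And>s t. 0 < s \<Longrightarrow> s \<le> t \<Longrightarrow> h s \<le> c * h t" by blast
  define g where "g t = Sup (h ` {0<..t})" for t
  have bdd: "bdd_above (h ` {0<..t})" for t
    using c(2)[of _ t] by (intro bdd_aboveI[of _ "c * h t"]) auto
  have hg: "h t \<le> g t" if "0 < t" for t
    unfolding g_def using that by (intro cSup_upper bdd) auto
  have gh: "g t \<le> c * h t" if "0 < t" for t
    unfolding g_def using that c(2)[of _ t] by (intro cSup_least) auto
  have mono: "mono_on {0<..} g"
    unfolding g_def by (intro mono_onI cSup_subset_mono bdd image_mono) auto
  show "equiv_nondecreasing F"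
    unfolding equiv_nondecreasing_def approx_on_def lesssim_on_def
  proof (intro exI[of _ g] conjI)
    show "\<forall>t>0. 0 < g t" using h hg by (meson less_le_trans)
    show "\<exists>c>0. \<forall>x\<in>{0<..}. F x \<le> ennreal c * ennreal (g x)"
      using hg F by (intro exI[of _ 1]) (auto intro: ennreal_leI)
    show "\<exists>c>0. \<forall>x\<in>{0<..}. ennreal (g x) \<le> ennreal c * F x"
      using gh F h c by (intro exI[of _ c]) (auto intro!: ennreal_leI simp: ennreal_mult[symmetric] less_imp_le)
  qed (rule mono)
qed

lemma mono_on_imp_lebesgue_on:
  fixes f :: "real \<Rightarrow> real"
  assumes "mono_on {0<..} f" "S \<subseteq> {0<..}"
  shows "f \<in> borel_measurable (lebesgue_on S)"
proof -
  have "f \<in> borel_measurable (restrict_space borel {0<..})"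
    using assms(1) by (rule borel_measurable_mono_on_fnc)
  then have "(\<lambda>x. indicator {0<..} x *\<^sub>R f x) \<in> borel_measurable borel"
    by (subst (asm) borel_measurable_restrict_space_iff) auto
  then have "(\<lambda>x. indicator {0<..} x *\<^sub>R f x) \<in> borel_measurable (lebesgue_on S)"
    by (rule borel_imp_lebesgue_on)
  then show ?thesis
    by (rule measurable_cong_simp[THEN iffD1, rotated -1]) (use assms(2) in auto)
qed

locale sv_weight =
  fixes q :: ennreal and b :: "real \<Rightarrow> real"
  assumes q_pos: "0 < q" and b_SV0: "b \<in> SV0 q"
begin

abbreviation w :: "real \<Rightarrow> ennreal" where "w \<equiv> weight 0 q b"

definition tail :: "real \<Rightarrow> real" where "tail t = enn2real (Lq_norm q {t<..} w)"

lemma w_eq: "w u = ennreal (u powr (- enn2real (1 / q)) * b u)"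
  by (simp add: weight_def)

lemma b_pos: "0 < u \<Longrightarrow> 0 < b u"
  using b_SV0 by (simp add: SV0_def SV_def)

lemma w_finite: "w u < \<infinity>"
  by (simp add: w_eq)

lemma measurable_w: "S \<subseteq> {0<..} \<Longrightarrow> w \<in> borel_measurable (lebesgue_on S)"
proof -
  assume S: "S \<subseteq> {0<..}"
  have "b \<in> borel_measurable (lebesgue_on {0<..})"
    using b_SV0 by (simp add: SV0_def SV_def)
  moreover have "(\<lambda>u. u powr (- enn2real (1 / q))) \<in> borel_measurable (lebesgue_on {0<..})"
    by (auto intro!: borel_imp_lebesgue_on)
  ultimately have "w \<in> borel_measurable (lebesgue_on {0<..})"
    unfolding w_eq by measurable
  then show ?thesis using S by (rule measurable_restrict_mono)
qed

lemma b_almost_increasing: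
  assumes "0 < e"
  shows "\<exists>c>0. \<forall>s t. 0 < s \<and> s \<le> t \<longrightarrow> s powr e * b s \<le> c * (t powr e * b t)"
proof -
  have "equiv_nondecreasing (\<lambda>t. ennreal (t powr e * b t))"
    using b_SV0 assms by (simp add: SV0_def SV_def)
  then show ?thesis
    by (subst (asm) equiv_nondecreasing_iff[of "\<lambda>t. t powr e * b t"]) (auto simp: b_pos)
qed

text \<open>Finiteness is given only for \<open>t = 1\<close>; on a bounded interval away from \<open>0\<close> the weight is bounded, as \<open>u b(u)\<close> is
almost increasing.\<close>

lemma tail_finite:
  assumes t: "0 < t"
  shows "Lq_norm q {t<..} w < \<infinity>"
proof -
  obtain c where c: "c > 0" "\<And>s t. 0 < s \<Longrightarrow> s \<le> t \<Longrightarrow> s powr 1 * b s \<le> c * (t powr 1 * b t)"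
    using b_almost_increasing[of 1] by auto
  let ?r = "enn2real (1 / q)"
  define K where "K = t powr (- ?r) * (c * ((t + 2) * b (t + 2)) / t)"
  have le: "w u \<le> ennreal K" if "u \<in> {t<..<t+2}" for u
  proof -
    have "u * b u \<le> c * ((t + 2) * b (t + 2))"
      using c(2)[of u "t+2"] that t by simp
    then have "b u \<le> c * ((t + 2) * b (t + 2)) / u"
      using that t by (simp add: field_simps)
    also have "\<dots> \<le> c * ((t + 2) * b (t + 2)) / t"
      using that t c(1) b_pos[of "t+2"] by (intro divide_left_mono) auto
    finally have "b u \<le> c * ((t + 2) * b (t + 2)) / t" .
    moreover have "u powr (- ?r) \<le> t powr (- ?r)"
      using that t by (intro powr_mono2') auto
    ultimately show ?thesis
      unfolding w_eq K_def using b_pos[of u] that t by (intro ennreal_leI mult_mono) auto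
  qed
  have fin1: "Lq_norm q {t<..<t+2} w < \<infinity>"
  proof (rule order.strict_trans1)
    show "Lq_norm q {t<..<t+2} w \<le> Lq_norm q {t<..<t+2} (\<lambda>_. ennreal K)"
      using le t by (intro Lq_norm_mono[OF q_pos measurable_w]) auto
    show "Lq_norm q {t<..<t+2} (\<lambda>_. ennreal K) < \<infinity>"
      using Lq_norm_const[OF q_pos, of t "t+2" "ennreal K"] by (simp add: ennreal_mult_less_top)
  qed
  have fin2: "Lq_norm q {1<..} w < \<infinity>"
    using b_SV0 by (simp add: SV0_def)
  have "Lq_norm q {t<..} w \<le> Lq_norm q ({t<..<t+2} \<union> {1<..}) w"
    using t by (intro Lq_norm_mono_set[OF q_pos] measurable_w) auto
  also have "\<dots> \<le> Lq_const q * (Lq_norm q {t<..<t+2} w + Lq_norm q {1<..} w)"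
    using t by (intro Lq_norm_Un[OF q_pos] measurable_w) auto
  also have "\<dots> < \<infinity>"
    using fin1 fin2 by (simp add: ennreal_mult_less_top)
  finally show ?thesis .
qed

lemma tail_eq: "0 < t \<Longrightarrow> Lq_norm q {t<..} w = ennreal (tail t)"
  using tail_finite[of t] by (simp add: tail_def)

lemma tail_antimono: "0 < s \<Longrightarrow> s \<le> t \<Longrightarrow> tail t \<le> tail s"
  unfolding tail_def using tail_finite[of s]
  by (intro enn2real_mono Lq_norm_mono_set[OF q_pos] measurable_w) auto

lemma measurable_tail: "S \<subseteq> {0<..} \<Longrightarrow> tail \<in> borel_measurable (lebesgue_on S)"
proof -
  assume S: "S \<subseteq> {0<..}"
  have "(\<lambda>u. - tail u) \<in> borel_measurable (lebesgue_on S)"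
    using S by (intro mono_on_imp_lebesgue_on) (auto intro!: mono_onI tail_antimono)
  then show ?thesis by simp
qed

lemma measurable_w_tail:
  assumes "S \<subseteq> {0<..}"
  shows "(\<lambda>u. w u * ennreal (tail u powr x)) \<in> borel_measurable (lebesgue_on S)"
  using measurable_w[OF assms] measurable_tail[OF assms] by measurable

text \<open>On \<open>(t, 2t)\<close> a slowly varying function is at least a multiple of \<open>b(t)\<close>, and this interval has fixed
mass with respect to \<open>du/u\<close>.\<close>

lemma b_le_tail: "\<exists>C>0. \<forall>t>0. b t \<le> C * tail t"
proof -
  obtain c where c: "c > 0" "\<And>s t. 0 < s \<Longrightarrow> s \<le> t \<Longrightarrow> s powr 1 * b s \<le> c * (t powr 1 * b t)"
    using b_almost_increasing[of 1] by auto
  let ?r = "enn2real (1 / q)"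
  have "b t \<le> (2 * c * 2 powr ?r) * tail t" if t: "0 < t" for t
  proof -
    define K where "K = (2 * t) powr (- ?r) * (b t / (2 * c))"
    have K: "0 \<le> K" using b_pos[OF t] c by (simp add: K_def)
    have le: "ennreal K \<le> w u" if "u \<in> {t<..<2*t}" for u
    proof -
      have "t * b t \<le> c * (u * b u)"
        using c(2)[of t u] that t by simp
      also have "\<dots> \<le> c * ((2 * t) * b u)"
        using that t c(1) b_pos[of u] by (intro mult_left_mono mult_right_mono) auto
      finally have "b t / (2 * c) \<le> b u"
        using t c by (simp add: field_simps)
      moreover have "(2 * t) powr (- ?r) \<le> u powr (- ?r)"
        using that t by (intro powr_mono2') auto
      ultimately show ?thesis
        unfolding w_eq K_def using b_pos[of t] t c(1) by (intro ennreal_leI mult_mono) auto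
    qed
    have "ennreal K * ennreal (t powr ?r) = Lq_norm q {t<..<2*t} (\<lambda>_. ennreal K)"
      using Lq_norm_const[OF q_pos, of t "2*t" "ennreal K"] t by simp
    also have "\<dots> \<le> Lq_norm q {t<..<2*t} w"
      using le by (intro Lq_norm_mono[OF q_pos]) auto
    also have "\<dots> \<le> ennreal (tail t)"
      unfolding tail_eq[OF t, symmetric] using t
      by (intro Lq_norm_mono_set[OF q_pos] measurable_w) auto
    finally have "K * t powr ?r \<le> tail t"
      using K t by (simp add: ennreal_mult[symmetric] tail_def)
    moreover have "K * t powr ?r = b t / (2 * c * 2 powr ?r)"
      using t by (simp add: K_def powr_mult powr_minus field_simps)
    ultimately show ?thesis
      using c(1) by (simp add: field_simps)
  qed
  then show ?thesis
    using c(1) by (intro exI[of _ "2 * c * 2 powr ?r"]) auto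
qed

lemma tail_pos: "0 < t \<Longrightarrow> 0 < tail t"
  using b_le_tail b_pos by (metis mult_zero_right mult_pos_pos not_less order.strict_trans2 zero_less_mult_pos)

text \<open>The truncation \<open>min(1, u/t)\<close> is nondecreasing in \<open>u\<close>, while its quotient by \<open>u\<close> is nonincreasing, and it is
the smallest such function with value \<open>1\<close> at \<open>t\<close>. Its norm near \<open>0\<close> is of order \<open>b(t)\<close>, hence
dominated by the tail.\<close>

lemma Lq_norm_truncation:
  "\<exists>C>0. \<forall>t>0. Lq_norm q {0<..} (\<lambda>u. w u * ennreal (min 1 (u / t))) \<le> ennreal (C * tail t)"
proof -
  let ?r = "enn2real (1 / q)" and ?k = "Lq_const q"
  obtain c where c: "c > 0" "\<And>s t. 0 < s \<Longrightarrow> s \<le> t \<Longrightarrow> s powr (1/2) * b s \<le> c * (t powr (1/2) * b t)"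
    using b_almost_increasing[of "1/2"] by auto
  obtain C1 where C1: "C1 > 0" "\<And>t. t > 0 \<Longrightarrow> Lq_norm q {0<..t} (\<lambda>u. ennreal (u powr (1/2 - ?r))) \<le> ennreal (C1 * t powr (1/2))"
    using Lq_norm_sqrt_weight[OF q_pos] by auto
  obtain C2 where C2: "C2 > 0" "\<And>t. t > 0 \<Longrightarrow> b t \<le> C2 * tail t"
    using b_le_tail by auto
  define C where "C = ?k * (c * C1 * C2 + 1)"
  have k: "0 < ?k" using Lq_const_ge_1[of q] by simp
  have "Lq_norm q {0<..} (\<lambda>u. w u * ennreal (min 1 (u / t))) \<le> ennreal (C * tail t)" if t: "0 < t" for t
  proof -
    let ?F = "\<lambda>u. w u * ennreal (min 1 (u / t))"
    have m: "?F \<in> borel_measurable (lebesgue_on S)" if "S \<subseteq> {0<..}" for S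
    proof -
      have "(\<lambda>u. ennreal (min 1 (u / t))) \<in> borel_measurable (lebesgue_on S)"
        by (rule borel_imp_lebesgue_on) measurable
      then show ?thesis using measurable_w[OF that] by measurable
    qed
    \<comment> \<open>Below \<open>t\<close>, trade \<open>u\<^bsup>1/2\<^esup> b(u)\<close> for its value at \<open>t\<close>, of which \<open>K\<close> collects the factors free of \<open>u\<close>.\<close>
    define K where "K = c * b t * t powr (- 1/2)"
    have K: "0 \<le> K" using c b_pos[OF t] by (simp add: K_def)
    have le: "?F u \<le> ennreal K * ennreal (u powr (1/2 - ?r))" if u: "u \<in> {0<..t}" for u
    proof -
      have "u powr (- ?r) * b u * (u / t) = (u powr (1/2) * b u) * u powr (1/2 - ?r) / t"
        using u powr_add[of u "-?r" 1] powr_add[of u "1/2" "1/2 - ?r"] by (simp add: powr_add)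
      also have "\<dots> \<le> (c * (t powr (1/2) * b t)) * u powr (1/2 - ?r) / t"
        using c(2)[of u t] u t by (intro divide_right_mono mult_right_mono) auto
      also have "\<dots> = K * u powr (1/2 - ?r)"
        using t powr_add[of t "1/2" "-1"] by (simp add: K_def powr_minus field_simps)
      finally have *: "u powr (- ?r) * b u * (u / t) \<le> K * u powr (1/2 - ?r)" .
      have "?F u = ennreal (u powr (- ?r) * b u * (u / t))"
      proof -
        have "min 1 (u / t) = u / t" using u t by simp
        then show ?thesis using u t b_pos[of u] by (simp add: w_eq ennreal_mult[symmetric])
      qed
      also have "\<dots> \<le> ennreal (K * u powr (1/2 - ?r))"
        using * by (rule ennreal_leI)
      finally show ?thesis using K by (simp add: ennreal_mult)
    qed
    have "Lq_norm q {0<..t} ?F \<le> Lq_norm q {0<..t} (\<lambda>u. ennreal K * ennreal (u powr (1/2 - ?r)))"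
      using le by (intro Lq_norm_mono[OF q_pos] m) auto
    also have "\<dots> \<le> ennreal K * Lq_norm q {0<..t} (\<lambda>u. ennreal (u powr (1/2 - ?r)))"
      by (intro Lq_norm_cmult[OF q_pos]) (auto intro!: borel_imp_lebesgue_on)
    also have "\<dots> \<le> ennreal K * ennreal (C1 * t powr (1/2))"
      by (intro mult_left_mono C1 t) auto
    also have "\<dots> = ennreal (c * C1 * b t)"
    proof -
      have "K * (C1 * t powr (1/2)) = (c * C1 * b t) * (t powr (- 1/2) * t powr (1/2))"
        by (simp add: K_def)
      also have "t powr (- 1/2) * t powr (1/2) = 1"
        using t powr_add[of t "-1/2" "1/2"] by simp
      finally have eq: "K * (C1 * t powr (1/2)) = (c * C1 * b t) * 1" .
      have "0 \<le> C1 * t powr (1/2)" using C1(1) by simp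
      from ennreal_mult[OF K this] show ?thesis
        unfolding eq by simp
    qed
    also have "\<dots> \<le> ennreal (c * C1 * (C2 * tail t))"
      using C2(2)[OF t] c(1) C1(1) by (intro ennreal_leI mult_left_mono) auto
    finally have 1: "Lq_norm q {0<..t} ?F \<le> ennreal (c * C1 * C2 * tail t)"
      by (simp add: mult.assoc)
    have "Lq_norm q {t<..} ?F \<le> Lq_norm q {t<..} w"
    proof (rule Lq_norm_mono[OF q_pos m])
      show "?F u \<le> w u" if "u \<in> {t<..}" for u
        using that t by (simp add: min_def)
    qed (use t in auto)
    also have "\<dots> = ennreal (tail t)" by (rule tail_eq[OF t])
    finally have 2: "Lq_norm q {t<..} ?F \<le> ennreal (tail t)" .
    have "{0<..} = {0<..t} \<union> {t<..}" using t by auto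
    then have "Lq_norm q {0<..} ?F \<le> ?k * (Lq_norm q {0<..t} ?F + Lq_norm q {t<..} ?F)"
      using Lq_norm_Un[OF q_pos, of ?F "{0<..t}" "{t<..}"] m by auto
    also have "\<dots> \<le> ?k * (ennreal (c * C1 * C2 * tail t) + ennreal (tail t))"
      by (intro mult_left_mono add_mono 1 2) auto
    also have "\<dots> = ennreal (C * tail t)"
      using k c(1) C1(1) C2(1) tail_pos[OF t]
      by (simp add: ennreal_plus[symmetric] ennreal_mult[symmetric] C_def field_simps del: ennreal_plus)
    finally show ?thesis .
  qed
  moreover have "C > 0" using k c(1) C1(1) C2(1) by (simp add: C_def add_pos_pos)
  ultimately show ?thesis by blast
qed

end

section \<open>Profiles\<close>

text \<open>The properties shared by \<open>K\<close>-functionals and quasi-concave functions; the second condition says that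
\<open>k(t)/t\<close> is nonincreasing. Values lie in \<^typ>\<open>ennreal\<close> so that suprema and the norms above apply directly,
and positivity is not included, so that \<open>K(\<cdot>, 0)\<close> is a profile.\<close>

definition profile :: "(real \<Rightarrow> ennreal) \<Rightarrow> bool" where
  "profile k \<longleftrightarrow> (\<forall>t>0. k t < \<infinity>) \<and>
     (\<forall>s t. 0 < s \<and> s \<le> t \<longrightarrow> k s \<le> k t \<and> ennreal (s / t) * k t \<le> k s)"

lemma profileD:
  assumes "profile k"
  shows "0 < t \<Longrightarrow> k t < \<infinity>" "0 < s \<Longrightarrow> s \<le> t \<Longrightarrow> k s \<le> k t"
    "0 < s \<Longrightarrow> s \<le> t \<Longrightarrow> ennreal (s / t) * k t \<le> k s"
  using assms by (auto simp: profile_def)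

lemma measurable_profile:
  assumes "profile k" "S \<subseteq> {0<..}"
  shows "k \<in> borel_measurable (lebesgue_on S)"
proof -
  have "mono_on {0<..} (\<lambda>t. enn2real (k t))"
    using profileD[OF assms(1)] by (intro mono_onI enn2real_mono) auto
  then have "(\<lambda>t. enn2real (k t)) \<in> borel_measurable (lebesgue_on S)"
    using assms(2) by (rule mono_on_imp_lebesgue_on)
  then have "(\<lambda>t. ennreal (enn2real (k t))) \<in> borel_measurable (lebesgue_on S)"
    by measurable
  then show ?thesis
    by (rule measurable_cong_simp[THEN iffD1, rotated -1])
       (use profileD(1)[OF assms(1)] assms(2) in auto)
qed

lemma quasi_concave_of_profile:
  assumes "profile k" "\<And>u. 0 < u \<Longrightarrow> 0 < k u"
  shows "quasi_concave (\<lambda>u. enn2real (k u))"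
  unfolding quasi_concave_def
proof (intro conjI allI impI mono_onI)
  fix t :: real assume "0 < t"
  then show "0 < enn2real (k t)"
    using assms profileD(1)[OF assms(1)] by (simp add: enn2real_positive_iff)
next
  fix s t :: real assume st: "s \<in> {0<..}" "t \<in> {0<..}" "s \<le> t"
  then show "enn2real (k s) \<le> enn2real (k t)"
    using profileD[OF assms(1)] by (intro enn2real_mono) auto
  have "ennreal ((1/t) / (1/s)) * k (1/s) \<le> k (1/t)"
    using st by (intro profileD(3)[OF assms(1)]) (auto simp: field_simps)
  then have "enn2real (ennreal (s / t) * k (1/s)) \<le> enn2real (k (1/t))"
    using st profileD(1)[OF assms(1), of "1/t"] by (intro enn2real_mono) auto
  then show "s * enn2real (k (1/s)) \<le> t * enn2real (k (1/t))"
    using st by (simp add: enn2real_mult field_simps)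
qed

lemma profile_cmult:
  assumes "profile f" "c < \<infinity>"
  shows "profile (\<lambda>t. c * f t)"
  unfolding profile_def
proof (intro conjI allI impI)
  fix t :: real assume "0 < t"
  then show "c * f t < \<infinity>" using profileD(1)[OF assms(1)] assms(2) by (simp add: ennreal_mult_less_top)
next
  fix s t :: real assume st: "0 < s \<and> s \<le> t"
  then show "c * f s \<le> c * f t"
    by (intro mult_left_mono profileD(2)[OF assms(1)]) auto
  have "c * (ennreal (s / t) * f t) \<le> c * f s"
    using st by (intro mult_left_mono profileD(3)[OF assms(1)]) auto
  then show "ennreal (s / t) * (c * f t) \<le> c * f s"
    by (simp add: mult.left_commute)
qed

lemma profile_SUP:
  assumes "\<And>i. i \<in> I \<Longrightarrow> profile (f i)" "\<And>t. 0 < t \<Longrightarrow> (SUP i\<in>I. f i t) < \<infinity>"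
  shows "profile (\<lambda>t. SUP i\<in>I. f i t)"
  unfolding profile_def
proof (intro conjI allI impI)
  fix s t :: real assume st: "0 < s \<and> s \<le> t"
  then show "(SUP i\<in>I. f i s) \<le> (SUP i\<in>I. f i t)"
    by (intro SUP_mono) (auto intro!: bexI profileD(2)[OF assms(1)])
  have "ennreal (s / t) * (SUP i\<in>I. f i t) = (SUP i\<in>I. ennreal (s / t) * f i t)"
    by (rule SUP_mult_left_ennreal)
  also have "\<dots> \<le> (SUP i\<in>I. f i s)"
    using st by (intro SUP_least SUP_upper2) (auto intro!: profileD(3)[OF assms(1)])
  finally show "ennreal (s / t) * (SUP i\<in>I. f i t) \<le> (SUP i\<in>I. f i s)" .
qed (rule assms(2))

lemma profile_truncation:
  assumes "0 < a"
  shows "profile (\<lambda>u. ennreal (min 1 (u / a)))"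
  unfolding profile_def
proof (intro conjI allI impI)
  fix s t :: real assume st: "0 < s \<and> s \<le> t"
  then show "ennreal (min 1 (s / a)) \<le> ennreal (min 1 (t / a))"
    using assms by (intro ennreal_leI min.mono divide_right_mono) auto
  have "(s / t) * min 1 (t / a) \<le> min 1 (s / a)"
  proof (rule min.boundedI)
    have "(s / t) * min 1 (t / a) \<le> 1 * 1"
      using st assms by (intro mult_mono) auto
    then show "(s / t) * min 1 (t / a) \<le> 1" by simp
    have "(s / t) * min 1 (t / a) \<le> (s / t) * (t / a)"
      using st by (intro mult_left_mono) auto
    then show "(s / t) * min 1 (t / a) \<le> s / a" using st by simp
  qed
  then show "ennreal (s / t) * ennreal (min 1 (t / a)) \<le> ennreal (min 1 (s / a))"
    using st assms by (simp add: ennreal_mult[symmetric] ennreal_leI)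
qed simp

context sv_weight
begin

lemma measurable_w_profile:
  "profile k \<Longrightarrow> S \<subseteq> {0<..} \<Longrightarrow> (\<lambda>u. w u * k u) \<in> borel_measurable (lebesgue_on S)"
  by (intro borel_measurable_times_ennreal measurable_w measurable_profile)

lemma profile_tail_le:
  assumes "profile k" "0 < t"
  shows "k t * ennreal (tail t) \<le> Lq_norm q {t<..} (\<lambda>u. w u * k u)"
proof -
  have "k t * ennreal (tail t) = Lq_norm q {t<..} (\<lambda>u. k t * w u)"
    using assms(2) profileD(1)[OF assms] by (subst Lq_norm_cmult_eq[OF q_pos measurable_w]) (auto simp: tail_eq)
  also have "\<dots> \<le> Lq_norm q {t<..} (\<lambda>u. w u * k u)"
  proof (rule Lq_norm_mono[OF q_pos])
    show "(\<lambda>u. k t * w u) \<in> borel_measurable (lebesgue_on {t<..})"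
      using assms(2) by (intro borel_measurable_times_ennreal measurable_w) auto
    show "k t * w u \<le> w u * k u" if "u \<in> {t<..}" for u
      using profileD(2)[OF assms(1), of t u] assms(2) that mult_left_mono[of "k t" "k u" "w u"] by (simp add: mult.commute)
  qed
  finally show ?thesis .
qed

text \<open>The pointwise bound by the reciprocal of the tail, which starts both embeddings.\<close>

lemma profile_le_total:
  assumes "profile k" "0 < t"
  shows "k t \<le> Lq_norm q {0<..} (\<lambda>u. w u * k u) * ennreal (1 / tail t)"
proof -
  have n: "0 < tail t" by (rule tail_pos[OF assms(2)])
  have "k t = k t * ennreal (tail t) * ennreal (1 / tail t)"
    using n by (simp add: mult.assoc ennreal_mult[symmetric])
  also have "\<dots> \<le> Lq_norm q {0<..} (\<lambda>u. w u * k u) * ennreal (1 / tail t)"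
    by (intro mult_right_mono order.trans[OF profile_tail_le[OF assms]] Lq_norm_mono_set[OF q_pos] measurable_w_profile)
      (use assms in auto)
  finally show ?thesis .
qed

lemma Lq_norm_profile_mono:
  assumes "profile f" "profile g" "S \<subseteq> {0<..}" "\<And>u. 0 < u \<Longrightarrow> f u \<le> c * g u"
  shows "Lq_norm q S (\<lambda>u. w u * f u) \<le> c * Lq_norm q S (\<lambda>u. w u * g u)"
proof -
  have "Lq_norm q S (\<lambda>u. w u * f u) \<le> Lq_norm q S (\<lambda>u. c * (w u * g u))"
  proof (rule Lq_norm_mono[OF q_pos measurable_w_profile[OF assms(1,3)]])
    fix u assume "u \<in> S"
    then have "w u * f u \<le> w u * (c * g u)" using assms(3) by (intro mult_left_mono assms(4)) auto
    then show "w u * f u \<le> c * (w u * g u)" by (simp add: mult.left_commute)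
  qed
  also have "\<dots> \<le> c * Lq_norm q S (\<lambda>u. w u * g u)"
    by (rule Lq_norm_cmult[OF q_pos measurable_w_profile[OF assms(2,3)]])
  finally show ?thesis .
qed

lemma Lq_norm_profile_hom:
  assumes "profile f" "profile g" "S \<subseteq> {0<..}" "\<And>u. 0 < u \<Longrightarrow> ennreal c * f u \<le> g u"
  shows "ennreal a * Lq_norm q S (\<lambda>u. w u * f u) * ennreal c \<le> ennreal a * Lq_norm q S (\<lambda>u. w u * g u)"
proof -
  have "ennreal c * Lq_norm q S (\<lambda>u. w u * f u) = Lq_norm q S (\<lambda>u. ennreal c * (w u * f u))"
    by (rule Lq_norm_cmult_eq[OF q_pos measurable_w_profile[OF assms(1,3)], symmetric]) simp
  also have "(\<lambda>u. ennreal c * (w u * f u)) = (\<lambda>u. w u * (ennreal c * f u))"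
    by (simp add: mult.left_commute)
  also have "Lq_norm q S (\<lambda>u. w u * (ennreal c * f u)) \<le> 1 * Lq_norm q S (\<lambda>u. w u * g u)"
    using assms by (intro Lq_norm_profile_mono profile_cmult) auto
  finally have "ennreal a * (ennreal c * Lq_norm q S (\<lambda>u. w u * f u)) \<le> ennreal a * Lq_norm q S (\<lambda>u. w u * g u)"
    by (intro mult_left_mono) auto
  then show ?thesis by (simp add: mult_ac)
qed

lemma Lq_norm_profile_add:
  assumes "profile f" "profile g" "profile h" "S \<subseteq> {0<..}"
    "\<And>u. 0 < u \<Longrightarrow> h u \<le> ennreal C * (f u + g u)"
  shows "Lq_norm q S (\<lambda>u. w u * h u) \<le> ennreal C * (Lq_const q * (Lq_norm q S (\<lambda>u. w u * f u) + Lq_norm q S (\<lambda>u. w u * g u)))"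
proof -
  have m: "(\<lambda>u. w u * f u) \<in> borel_measurable (lebesgue_on S)" "(\<lambda>u. w u * g u) \<in> borel_measurable (lebesgue_on S)"
    "(\<lambda>u. w u * h u) \<in> borel_measurable (lebesgue_on S)"
    by (intro measurable_w_profile assms)+
  have "Lq_norm q S (\<lambda>u. w u * h u) \<le> Lq_norm q S (\<lambda>u. ennreal C * (w u * f u + w u * g u))"
  proof (rule Lq_norm_mono[OF q_pos m(3)])
    fix u assume "u \<in> S"
    then have "w u * h u \<le> w u * (ennreal C * (f u + g u))"
      using assms(4) by (intro mult_left_mono assms(5)) auto
    then show "w u * h u \<le> ennreal C * (w u * f u + w u * g u)"
      by (simp add: distrib_left mult_ac)
  qed
  also have "\<dots> \<le> ennreal C * Lq_norm q S (\<lambda>u. w u * f u + w u * g u)"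
    by (rule Lq_norm_cmult[OF q_pos borel_measurable_add[OF m(1,2)]])
  also have "\<dots> \<le> ennreal C * (Lq_const q * (Lq_norm q S (\<lambda>u. w u * f u) + Lq_norm q S (\<lambda>u. w u * g u)))"
    by (intro mult_left_mono Lq_norm_add[OF q_pos m(1,2)]) auto
  finally show ?thesis .
qed

text \<open>Norm bound for one part of a decomposition at level \<open>t\<close>: \<open>S\<close> is the side of \<open>t\<close> on which the profile of the
whole element controls it, and on the rest a truncation of height \<open>M\<close> does.\<close>

lemma Lq_norm_le_part_plus_truncation:
  assumes C: "0 < C"
  shows "\<exists>B>0. \<forall>f g t M S. profile f \<and> profile g \<and> 0 < t \<and> S \<in> sets lebesgue \<and> S \<subseteq> {0<..} \<and> 0 \<le> M \<and>
     (\<forall>u>0. g u \<le> ennreal C * (f u * indicator S u + ennreal M * ennreal (min 1 (u / t)))) \<longrightarrow>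
       Lq_norm q {0<..} (\<lambda>u. w u * g u) \<le> ennreal B * (Lq_norm q S (\<lambda>u. w u * f u) + ennreal (M * tail t))"
proof -
  obtain T where T: "T > 0" "\<And>t. 0 < t \<Longrightarrow> Lq_norm q {0<..} (\<lambda>u. w u * ennreal (min 1 (u / t))) \<le> ennreal (T * tail t)"
    using Lq_norm_truncation by blast
  define T' where "T' = max 1 T"
  have T': "1 \<le> T'" "T \<le> T'" by (auto simp: T'_def)
  define B where "B = C * (Lq_const q * T')"
  have B: "0 < B" using C Lq_const_ge_1[of q] T' by (simp add: B_def)
  have "Lq_norm q {0<..} (\<lambda>u. w u * g u) \<le> ennreal B * (Lq_norm q S (\<lambda>u. w u * f u) + ennreal (M * tail t))"
    if f: "profile f" and g: "profile g" and t: "0 < t" and S: "S \<in> sets lebesgue" "S \<subseteq> {0<..}" and M: "0 \<le> M"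
      and le: "\<And>u. 0 < u \<Longrightarrow> g u \<le> ennreal C * (f u * indicator S u + ennreal M * ennreal (min 1 (u / t)))" for f g t M S
  proof -
    let ?F = "\<lambda>u. w u * f u * indicator S u" and ?G = "\<lambda>u. w u * ennreal (min 1 (u / t))"
    let ?L = "Lq_norm q S (\<lambda>u. w u * f u)"
    have mf: "(\<lambda>u. w u * f u) \<in> borel_measurable (lebesgue_on {0<..})"
      by (intro measurable_w_profile f) auto
    have mF: "?F \<in> borel_measurable (lebesgue_on {0<..})"
      using S by (intro borel_measurable_times_ennreal[OF mf] measurable_restrict_space1 borel_measurable_indicator)
    have "(\<lambda>u. ennreal (min 1 (u / t))) \<in> borel_measurable (lebesgue_on {0<..})"
      by (rule borel_imp_lebesgue_on) measurable
    then have mG: "?G \<in> borel_measurable (lebesgue_on {0<..})"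
      by (intro borel_measurable_times_ennreal measurable_w) auto
    have mMG: "(\<lambda>u. ennreal M * ?G u) \<in> borel_measurable (lebesgue_on {0<..})"
      by (rule borel_measurable_times_ennreal[OF borel_measurable_const mG])
    have "Lq_norm q {0<..} (\<lambda>u. w u * g u) \<le> Lq_norm q {0<..} (\<lambda>u. ennreal C * (?F u + ennreal M * ?G u))"
    proof (rule Lq_norm_mono[OF q_pos])
      show "(\<lambda>u. w u * g u) \<in> borel_measurable (lebesgue_on {0<..})"
        by (intro measurable_w_profile g) auto
      fix u :: real assume "u \<in> {0<..}"
      then have "w u * g u \<le> w u * (ennreal C * (f u * indicator S u + ennreal M * ennreal (min 1 (u / t))))"
        by (intro mult_left_mono le) auto
      then show "w u * g u \<le> ennreal C * (?F u + ennreal M * ?G u)"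
        by (simp add: distrib_left mult_ac)
    qed
    also have "\<dots> \<le> ennreal C * Lq_norm q {0<..} (\<lambda>u. ?F u + ennreal M * ?G u)"
      by (rule Lq_norm_cmult[OF q_pos borel_measurable_add[OF mF mMG]])
    also have "\<dots> \<le> ennreal C * (Lq_const q * (Lq_norm q {0<..} ?F + Lq_norm q {0<..} (\<lambda>u. ennreal M * ?G u)))"
      by (intro mult_left_mono Lq_norm_add[OF q_pos mF mMG]) auto
    also have "\<dots> \<le> ennreal C * (Lq_const q * (?L + ennreal M * ennreal (T * tail t)))"
    proof (intro mult_left_mono add_mono)
      show "Lq_norm q {0<..} ?F \<le> ?L"
        using S by (intro Lq_norm_indicator[OF q_pos mf]) auto
      show "Lq_norm q {0<..} (\<lambda>u. ennreal M * ?G u) \<le> ennreal M * ennreal (T * tail t)"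
        by (rule order.trans[OF Lq_norm_cmult[OF q_pos mG] mult_left_mono[OF T(2)[OF t]]]) simp
    qed auto
    also have "\<dots> \<le> ennreal C * (Lq_const q * (ennreal T' * (?L + ennreal (M * tail t))))"
    proof (intro mult_left_mono)
      have "?L \<le> ennreal T' * ?L"
        using mult_right_mono[of 1 "ennreal T'" ?L] T' by simp
      moreover have "ennreal M * ennreal (T * tail t) \<le> ennreal T' * ennreal (M * tail t)"
      proof -
        have "M * (T * tail t) \<le> T' * (M * tail t)"
          using T'(2) M tail_pos[OF t] mult_right_mono[of T T' "M * tail t"] by (simp add: mult_ac)
        then show ?thesis
          using M T(1) T'(1) tail_pos[OF t] by (simp add: ennreal_mult[symmetric] ennreal_leI)
      qed
      ultimately show "?L + ennreal M * ennreal (T * tail t) \<le> ennreal T' * (?L + ennreal (M * tail t))"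
        unfolding distrib_left by (rule add_mono)
    qed auto
    also have "\<dots> = ennreal B * (?L + ennreal (M * tail t))"
      using C Lq_const_ge_1[of q] T' by (simp add: B_def ennreal_mult mult.assoc)
    finally show ?thesis .
  qed
  then show ?thesis using B by (intro exI[of _ B]) blast
qed

end

section \<open>Hardy inequalities for powers of the tail\<close>

lemma ex_dyadic:
  assumes "1 \<le> (y::real)"
  shows "\<exists>k. 2 ^ k \<le> y \<and> y < 2 ^ Suc k"
proof -
  obtain n where n: "y < 2 ^ n"
    using real_arch_pow[of 2 y] by auto
  define m where "m = (LEAST n. y < 2 ^ n)"
  have m: "y < 2 ^ m" unfolding m_def using n by (rule LeastI)
  then obtain k where k: "m = Suc k" using assms by (cases m) auto
  have "\<not> y < 2 ^ k"
    using not_less_Least[of k "\<lambda>n. y < 2 ^ n"] k unfolding m_def by auto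
  then show ?thesis using m k by (intro exI[of _ k]) auto
qed

context sv_weight
begin

abbreviation p :: real where "p \<equiv> enn2real q"

text \<open>For \<open>q < \<infinity>\<close> the \<open>q\<close>-th power of the weighted norm is an integral with respect to the measure with density
\<open>W\<close>. The cut-off at \<open>0\<close> makes \<open>W\<close> measurable on the whole line.\<close>

definition W :: "real \<Rightarrow> ennreal" where "W u = epowr (w u) p * indicator {0<..} u"

lemma measurable_W: "W \<in> borel_measurable lebesgue"
proof -
  have "(\<lambda>u. epowr (w u) p) \<in> borel_measurable (lebesgue_on {0<..})"
    using measurable_w[of "{0<..}"] by measurable
  then show ?thesis
    unfolding W_def by (subst (asm) borel_measurable_restrict_space_iff_ennreal) auto
qed

lemma measurable_W_indicator:
  "A \<in> sets lebesgue \<Longrightarrow> (\<lambda>u. W u * indicator A u) \<in> borel_measurable lebesgue"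
  by (intro borel_measurable_times_ennreal measurable_W borel_measurable_indicator)

lemma W_finite: "W u < \<infinity>"
  using w_finite[of u] by (auto simp: W_def epowr_def split: split_indicator)

context
  assumes q_finite: "q \<noteq> \<infinity>"
begin

lemma p_pos: "0 < p"
  using enn2real_inverse(1)[OF q_pos q_finite] .

lemma epowr_Lq_norm_w:
  assumes "S \<subseteq> {0<..}" "S \<in> sets lebesgue"
  shows "epowr (Lq_norm q S (\<lambda>u. w u * F u)) p = (\<integral>\<^sup>+u. W u * epowr (F u) p * indicator S u \<partial>lebesgue)"
proof -
  have "epowr (Lq_norm q S (\<lambda>u. w u * F u)) p = (\<integral>\<^sup>+u. epowr (w u * F u) p \<partial>lebesgue_on S)"
    by (rule epowr_Lq_norm[OF q_pos q_finite])
  also have "\<dots> = (\<integral>\<^sup>+u. epowr (w u * F u) p * indicator S u \<partial>lebesgue)"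
    using assms by (intro nn_integral_restrict_space) auto
  also have "\<dots> = (\<integral>\<^sup>+u. W u * epowr (F u) p * indicator S u \<partial>lebesgue)"
    using assms(1) by (intro nn_integral_cong) (auto simp: W_def epowr_mult[OF p_pos] split: split_indicator)
  finally show ?thesis .
qed

lemma W_tail:
  assumes "0 < t"
  shows "(\<integral>\<^sup>+u. W u * indicator {t<..} u \<partial>lebesgue) = ennreal (tail t powr p)"
proof -
  have "epowr 1 p = 1" using epowr_ennreal[of 1 p] by simp
  then show ?thesis
    using epowr_Lq_norm_w[of "{t<..}" "\<lambda>_. 1"] assms tail_pos[OF assms]
    by (simp add: tail_eq epowr_ennreal less_imp_le greaterThan_subset_iff)
qed

text \<open>The distribution function of the tail under its own density: the set where the tail is at most \<open>s\<close> is a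
half-line with mass at most \<open>s\<^bsup>p\<^esup>\<close>. Enclosing it in the closed half-line avoids deciding whether it contains its
left end point.\<close>

lemma W_sublevel:
  assumes "0 \<le> s"
  shows "\<exists>A\<in>sets lebesgue. {u. 0 < u \<and> tail u \<le> s} \<subseteq> A \<and> (\<integral>\<^sup>+u. W u * indicator A u \<partial>lebesgue) \<le> ennreal (s powr p)"
proof (cases "{u. 0 < u \<and> tail u \<le> s} = {}")
  case True
  then show ?thesis by (intro bexI[of _ "{}"]) auto
next
  case False
  let ?D = "{u. 0 < u \<and> tail u \<le> s}"
  \<comment> \<open>Nothing is known at the left end point \<open>a\<close> itself, so the half-line is exhausted from the right.\<close>
  define a where "a = Inf ?D"
  have bdd: "bdd_below ?D" by (rule bdd_belowI[of _ 0]) auto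
  have a0: "0 \<le> a" unfolding a_def using False by (intro cInf_greatest) auto
  have up: "tail y \<le> s" if "a < y" for y
  proof -
    have "Inf ?D < y" using that by (simp add: a_def)
    from cInf_lessD[OF False this] obtain x where x: "0 < x" "tail x \<le> s" "x < y" by blast
    then show ?thesis using tail_antimono[of x y] by linarith
  qed
  have "(\<integral>\<^sup>+u. W u * indicator {a..} u \<partial>lebesgue) = (\<integral>\<^sup>+u. W u * indicator {a<..} u \<partial>lebesgue)"
  proof (rule nn_integral_cong_AE)
    have "AE u in lebesgue. u \<noteq> a"
      by (intro AE_completion AE_lborel_singleton)
    then show "AE u in lebesgue. W u * indicator {a..} u = W u * indicator {a<..} u"
      by eventually_elim (auto split: split_indicator)
  qed
  also have "\<dots> = (\<integral>\<^sup>+u. (SUP i. W u * indicator {a + 1 / real (Suc i)<..} u) \<partial>lebesgue)"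
  proof (rule nn_integral_cong)
    fix u
    show "W u * indicator {a<..} u = (SUP i. W u * indicator {a + 1 / real (Suc i)<..} u)"
    proof (cases "a < u")
      case True
      then obtain i where "1 / real (Suc i) < u - a"
        using nat_approx_posE[of "u - a"] by auto
      then show ?thesis
        using True by (intro antisym SUP_least SUP_upper2[of i]) (auto split: split_indicator)
    next
      case False
      then have "\<not> a + 1 / real (Suc i) < u" for i
        using divide_pos_pos[of 1 "real (Suc i)"] by linarith
      then show ?thesis using False by simp
    qed
  qed
  also have "\<dots> = (SUP i. \<integral>\<^sup>+u. W u * indicator {a + 1 / real (Suc i)<..} u \<partial>lebesgue)"
  proof (rule nn_integral_monotone_convergence_SUP)
    show "incseq (\<lambda>i u. W u * indicator {a + 1 / real (Suc i)<..} u)"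
    proof (intro monoI le_funI mult_left_mono)
      fix i j :: nat and u assume "i \<le> j"
      then have "1 / real (Suc j) \<le> 1 / real (Suc i)" by (simp add: frac_le)
      then show "(indicator {a + 1 / real (Suc i)<..} u :: ennreal) \<le> indicator {a + 1 / real (Suc j)<..} u"
        by (auto split: split_indicator)
    qed auto
    show "(\<lambda>u. W u * indicator {a + 1 / real (Suc i)<..} u) \<in> borel_measurable lebesgue" for i
      by (intro measurable_W_indicator) simp
  qed
  also have "\<dots> \<le> ennreal (s powr p)"
  proof (rule SUP_least)
    fix i
    have y: "0 < a + 1 / real (Suc i)" "a < a + 1 / real (Suc i)" using a0 by (simp_all add: add_nonneg_pos)
    show "(\<integral>\<^sup>+u. W u * indicator {a + 1 / real (Suc i)<..} u \<partial>lebesgue) \<le> ennreal (s powr p)"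
      unfolding W_tail[OF y(1)] using up[OF y(2)] tail_pos[OF y(1)] p_pos
      by (intro ennreal_leI powr_mono2) auto
  qed
  finally have "(\<integral>\<^sup>+u. W u * indicator {a..} u \<partial>lebesgue) \<le> ennreal (s powr p)" .
  moreover have "?D \<subseteq> {a..}" unfolding a_def by (auto intro: cInf_lower[OF _ bdd])
  ultimately show ?thesis by (intro bexI[of _ "{a..}"]) auto
qed

text \<open>Layer-cake estimate: \<open>E\<close> is covered by the level sets \<open>{tail \<le> s\<^sub>k}\<close>, on the part belonging to \<open>k\<close> the
integrand is at most \<open>a\<^sub>k\<close>, and the resulting series is geometric. It replaces the substitution \<open>x = tail(u)\<^bsup>p\<^esup>\<close>.\<close>

lemma W_layers:
  fixes a s :: "nat \<Rightarrow> real"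
  assumes E: "\<And>u. u \<in> E \<Longrightarrow> 0 < u" "\<And>u. u \<in> E \<Longrightarrow> \<exists>k. tail u \<le> s k \<and> h u \<le> ennreal (a k)"
    and nonneg: "\<And>k. 0 \<le> s k" "\<And>k. 0 \<le> a k"
    and geom: "\<And>k. a k * s k powr p \<le> K * \<theta> ^ k" and \<theta>: "0 < \<theta>" "\<theta> < 1"
  shows "(\<integral>\<^sup>+u. W u * h u * indicator E u \<partial>lebesgue) \<le> ennreal (K / (1 - \<theta>))"
proof -
  have "\<forall>k. \<exists>A\<in>sets lebesgue. {u. 0 < u \<and> tail u \<le> s k} \<subseteq> A \<and> (\<integral>\<^sup>+u. W u * indicator A u \<partial>lebesgue) \<le> ennreal (s k powr p)"
    using W_sublevel nonneg(1) by blast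
  then obtain A where A: "\<And>k. A k \<in> sets lebesgue" "\<And>k. {u. 0 < u \<and> tail u \<le> s k} \<subseteq> A k"
      "\<And>k. (\<integral>\<^sup>+u. W u * indicator (A k) u \<partial>lebesgue) \<le> ennreal (s k powr p)"
    by metis
  \<comment> \<open>Each point of \<open>E\<close> is counted in at least one layer; overlaps of the layers do no harm.\<close>
  have "(\<integral>\<^sup>+u. W u * h u * indicator E u \<partial>lebesgue)
      \<le> (\<integral>\<^sup>+u. (\<Sum>k. ennreal (a k) * (W u * indicator (A k) u)) \<partial>lebesgue)"
  proof (rule nn_integral_mono)
    fix u
    show "W u * h u * indicator E u \<le> (\<Sum>k. ennreal (a k) * (W u * indicator (A k) u))"
    proof (cases "u \<in> E")
      case True
      then obtain k where k: "tail u \<le> s k" "h u \<le> ennreal (a k)" using E(2) by blast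
      have "u \<in> A k" using A(2) k E(1)[OF True] by blast
      then have "W u * h u * indicator E u \<le> ennreal (a k) * (W u * indicator (A k) u)"
        using True mult_left_mono[OF k(2), of "W u"] by (simp add: mult.commute)
      also have "\<dots> \<le> (\<Sum>k. ennreal (a k) * (W u * indicator (A k) u))"
        using sum_le_suminf[of "\<lambda>k. ennreal (a k) * (W u * indicator (A k) u)" "{k}"] by auto
      finally show ?thesis .
    qed simp
  qed
  also have "\<dots> = (\<Sum>k. \<integral>\<^sup>+u. ennreal (a k) * (W u * indicator (A k) u) \<partial>lebesgue)"
    by (intro nn_integral_suminf borel_measurable_times_ennreal[OF borel_measurable_const] measurable_W_indicator A(1))
  also have "\<dots> = (\<Sum>k. ennreal (a k) * (\<integral>\<^sup>+u. W u * indicator (A k) u \<partial>lebesgue))"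
    by (intro suminf_cong nn_integral_cmult measurable_W_indicator A(1))
  also have "\<dots> \<le> (\<Sum>k. ennreal (K * \<theta> ^ k))"
  proof (intro suminf_le)
    fix k
    have "ennreal (a k) * (\<integral>\<^sup>+u. W u * indicator (A k) u \<partial>lebesgue) \<le> ennreal (a k) * ennreal (s k powr p)"
      by (intro mult_left_mono A(3)) auto
    also have "\<dots> = ennreal (a k * s k powr p)" using nonneg by (simp add: ennreal_mult)
    also have "\<dots> \<le> ennreal (K * \<theta> ^ k)" by (rule ennreal_leI[OF geom])
    finally show "ennreal (a k) * (\<integral>\<^sup>+u. W u * indicator (A k) u \<partial>lebesgue) \<le> ennreal (K * \<theta> ^ k)" .
  qed auto
  also have "\<dots> = ennreal (K / (1 - \<theta>))"
  proof (rule suminf_ennreal_eq)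
    have "0 \<le> a 0 * s 0 powr p" using nonneg by simp
    then have "0 \<le> K" using geom[of 0] by simp
    then show "0 \<le> K * \<theta> ^ k" for k using \<theta> by simp
    show "(\<lambda>k. K * \<theta> ^ k) sums (K / (1 - \<theta>))"
      using sums_mult[OF geometric_sums[of \<theta>], of K] \<theta> by simp
  qed
  finally show ?thesis .
qed

lemma Lq_norm_layers:
  fixes a s :: "nat \<Rightarrow> real"
  assumes E: "E \<subseteq> {0<..}" "E \<in> sets lebesgue" "\<And>u. u \<in> E \<Longrightarrow> \<exists>k. tail u \<le> s k \<and> h u \<le> a k"
    and nonneg: "\<And>k. 0 \<le> s k" "\<And>k. 0 \<le> a k" "\<And>u. 0 \<le> h u" "0 \<le> K"
    and geom: "\<And>k. a k * s k \<le> K * \<theta> ^ k" and \<theta>: "0 < \<theta>" "\<theta> < 1"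
  shows "Lq_norm q E (\<lambda>u. w u * ennreal (h u)) \<le> ennreal (K * (1 / (1 - \<theta> powr p)) powr (1 / p))"
proof -
  have \<theta>p: "0 < \<theta> powr p" "\<theta> powr p < 1"
    using \<theta> p_pos powr_less_mono2[of p \<theta> 1] by auto
  have "epowr (Lq_norm q E (\<lambda>u. w u * ennreal (h u))) p = (\<integral>\<^sup>+u. W u * ennreal (h u powr p) * indicator E u \<partial>lebesgue)"
    using epowr_Lq_norm_w[OF E(1,2), of "\<lambda>u. ennreal (h u)"] nonneg by (simp add: epowr_ennreal)
  also have "\<dots> \<le> ennreal (K powr p / (1 - \<theta> powr p))"
  proof (rule W_layers[where s = s and a = "\<lambda>k. a k powr p"])
    fix u assume "u \<in> E"
    then show "\<exists>k. tail u \<le> s k \<and> ennreal (h u powr p) \<le> ennreal (a k powr p)"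
      using E(3)[of u] nonneg p_pos by (force intro!: ennreal_leI powr_mono2)
  next
    fix k
    have "(a k * s k) powr p \<le> (K * \<theta> ^ k) powr p"
      using nonneg geom p_pos by (intro powr_mono2) auto
    also have "\<dots> = K powr p * (\<theta> powr p) ^ k"
      using nonneg \<theta> powr_powr_swap[of \<theta> "real k" p] by (simp add: powr_mult powr_realpow)
    finally show "a k powr p * s k powr p \<le> K powr p * (\<theta> powr p) ^ k"
      using nonneg by (simp add: powr_mult)
  qed (use E nonneg \<theta>p in auto)
  finally have "Lq_norm q E (\<lambda>u. w u * ennreal (h u)) \<le> epowr (ennreal (K powr p / (1 - \<theta> powr p))) (1 / p)"
    by (simp add: epowr_le_iff[OF p_pos])
  also have "\<dots> = ennreal ((K powr p * (1 / (1 - \<theta> powr p))) powr (1 / p))"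
    using \<theta>p by (simp add: epowr_ennreal)
  also have "(K powr p * (1 / (1 - \<theta> powr p))) powr (1 / p) = K * (1 / (1 - \<theta> powr p)) powr (1 / p)"
    using \<theta>p nonneg p_pos by (subst powr_mult) (auto simp: powr_powr)
  finally show ?thesis .
qed

text \<open>For \<open>q < \<infinity>\<close> the power \<open>tail\<^bsup>p\<^esup>\<close> is an indefinite integral, hence continuous. (For \<open>q = \<infinity>\<close> the tail may jump.)\<close>

lemma tail_IVT:
  assumes "0 < s" "s \<le> t" "tail t \<le> y" "y \<le> tail s"
  shows "\<exists>u. s \<le> u \<and> u \<le> t \<and> tail u = y"
proof -
  define F where "F x u = enn2real (W u) * indicator {x<..} u" for x u
  have F: "(F x has_integral tail x powr p) UNIV" if "0 < x" for x
  proof (subst has_integral_iff_nn_integral_lebesgue)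
    show "0 \<le> F x u" for u by (simp add: F_def)
    have "(\<integral>\<^sup>+u. ennreal (F x u) \<partial>lebesgue) = (\<integral>\<^sup>+u. W u * indicator {x<..} u \<partial>lebesgue)"
      using W_finite by (intro nn_integral_cong) (auto simp: F_def split: split_indicator)
    moreover have "F x \<in> borel_measurable lebesgue"
    proof -
      have "(\<lambda>u. enn2real (W u)) \<in> borel_measurable lebesgue"
        using measurable_W by measurable
      then show ?thesis
        unfolding F_def by (intro borel_measurable_times borel_measurable_indicator) auto
    qed
    ultimately show "F x \<in> borel_measurable lebesgue \<and> (\<integral>\<^sup>+u. ennreal (F x u) \<partial>lebesgue) = ennreal (tail x powr p) \<and> 0 \<le> tail x powr p"
      using W_tail[OF that] by simp
  qed
  have Fx: "(F s has_integral (tail s powr p - tail x powr p)) {s..x}" if "s \<le> x" for x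
  proof -
    have "((\<lambda>u. F s u - F x u) has_integral (tail s powr p - tail x powr p)) UNIV"
      using assms(1) that by (intro has_integral_diff F) auto
    also have "(\<lambda>u. F s u - F x u) = (\<lambda>u. if u \<in> {s..x} then F s u else 0)"
      using that by (auto simp: F_def fun_eq_iff split: split_indicator)
    finally show ?thesis by (simp only: has_integral_restrict_UNIV)
  qed
  have "continuous_on {s..t} (\<lambda>x. integral {s..x} (F s))"
    using Fx[OF assms(2)] by (intro indefinite_integral_continuous_1) (auto simp: integrable_on_def)
  then have "continuous_on {s..t} (\<lambda>x. tail s powr p - integral {s..x} (F s))"
    by (intro continuous_intros)
  then have c: "continuous_on {s..t} (\<lambda>x. tail x powr p)"
    by (rule continuous_on_eq) (simp add: integral_unique[OF Fx])
  have "\<exists>x\<ge>s. x \<le> t \<and> tail x powr p = y powr p"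
  proof (rule IVT2'[OF _ _ _ c])
    have "0 < tail t" using assms tail_pos by auto
    then show "tail t powr p \<le> y powr p" "y powr p \<le> tail s powr p"
      using assms p_pos by (auto intro!: powr_mono2)
  qed (use assms in auto)
  then obtain x where x: "s \<le> x" "x \<le> t" "tail x powr p = y powr p" by blast
  have pos: "0 < tail x" "0 < y"
    using tail_pos[of x] tail_pos[of t] x assms by auto
  have "(tail x powr p) powr (1 / p) = (y powr p) powr (1 / p)" using x(3) by simp
  then have "tail x = y" using pos p_pos by (simp add: powr_powr)
  then show ?thesis using x by blast
qed

end

lemma W_interval:
  assumes "q \<noteq> \<infinity>" "0 < x" "x < y"
  shows "(\<integral>\<^sup>+u. W u * indicator {x<..<y} u \<partial>lebesgue) = ennreal (tail x powr p - tail y powr p)"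
proof -
  let ?X = "\<integral>\<^sup>+u. W u * indicator {x<..<y} u \<partial>lebesgue"
  have "ennreal (tail x powr p) = (\<integral>\<^sup>+u. W u * indicator {x<..} u \<partial>lebesgue)"
    using W_tail[OF assms(1,2)] by simp
  also have "\<dots> = (\<integral>\<^sup>+u. W u * indicator {x<..<y} u + W u * indicator {y<..} u \<partial>lebesgue)"
  proof (rule nn_integral_cong_AE)
    have "AE u in lebesgue. u \<noteq> y"
      by (intro AE_completion AE_lborel_singleton)
    then show "AE u in lebesgue. W u * indicator {x<..} u = W u * indicator {x<..<y} u + W u * indicator {y<..} u"
      by eventually_elim (use assms(3) in \<open>auto split: split_indicator\<close>)
  qed
  also have "\<dots> = ?X + ennreal (tail y powr p)"
    using W_tail[OF assms(1), of y] assms by (subst nn_integral_add) (auto intro!: measurable_W_indicator)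
  finally have *: "ennreal (tail x powr p) = ?X + ennreal (tail y powr p)" .
  then have "?X < top"
    using ennreal_less_top[of "tail x powr p"] by (simp add: less_top ennreal_add_eq_top)
  then obtain z where z: "?X = ennreal z" "0 \<le> z" by (cases ?X) auto
  then have "tail x powr p = z + tail y powr p"
    using * by (simp add: ennreal_plus[symmetric] del: ennreal_plus)
  then show ?thesis using z by simp
qed

text \<open>For \<open>q < \<infinity>\<close> the \<open>p\<close>-th power of the left side becomes \<open>\<integral> x\<^bsup>-1-e\<^esup> dx\<close> over a subset of \<open>(tail(t)\<^bsup>p\<^esup>, \<infinity>)\<close> after
substituting \<open>x = tail(u)\<^bsup>p\<^esup>\<close>; the proof sums over the dyadic layers \<open>2\<^bsup>k\<^esup> tail(t) \<le> tail(u) < 2\<^bsup>k+1\<^esup> tail(t)\<close>. For \<open>q = \<infinity>\<close> the bound \<open>b \<lesssim> tail\<close> is enough.\<close>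

lemma Lq_norm_hardy_left:
  assumes e: "0 < e"
  shows "\<exists>C>0. \<forall>t>0. Lq_norm q {0<..<t} (\<lambda>u. w u * ennreal (tail u powr (- 1 - e))) \<le> ennreal (C * tail t powr (- e))"
proof (cases "q = \<infinity>")
  case True
  then have L_eq: "Lq_norm q S F = esssup (lebesgue_on S) F" for S F
    by (simp add: Lq_norm_top)
  have wb: "w u = ennreal (b u)" if "0 < u" for u
    unfolding w_eq using that True by simp
  obtain C where C: "C > 0" "\<And>t. t > 0 \<Longrightarrow> b t \<le> C * tail t"
    using b_le_tail by auto
  have "Lq_norm q {0<..<t} (\<lambda>u. w u * ennreal (tail u powr (- 1 - e))) \<le> ennreal (C * tail t powr (- e))"
    if t: "0 < t" for t
    unfolding L_eq
  proof (rule esssup_I)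
    show "(\<lambda>u. w u * ennreal (tail u powr (- 1 - e))) \<in> borel_measurable (lebesgue_on {0<..<t})"
      by (rule measurable_w_tail) auto
    show "AE u in lebesgue_on {0<..<t}. w u * ennreal (tail u powr (- 1 - e)) \<le> ennreal (C * tail t powr (- e))"
    proof (rule AE_I2)
      fix u assume "u \<in> space (lebesgue_on {0<..<t})"
      then have u: "0 < u" "u < t" by auto
      have "b u * tail u powr (- 1 - e) \<le> C * tail u * tail u powr (- 1 - e)"
        using C(2)[OF u(1)] by (intro mult_right_mono) auto
      also have "\<dots> = C * tail u powr (- e)"
        using tail_pos[OF u(1)] powr_add[of "tail u" 1 "-1-e"] by simp
      also have "\<dots> \<le> C * tail t powr (- e)"
        using tail_antimono[of u t] u e C(1) tail_pos[of t] by (intro mult_left_mono powr_mono2') auto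
      finally show "w u * ennreal (tail u powr (- 1 - e)) \<le> ennreal (C * tail t powr (- e))"
        using u b_pos[of u] by (simp add: wb ennreal_mult[symmetric] ennreal_leI)
    qed
  qed
  then show ?thesis using C(1) by blast
next
  case False
  define \<theta> where "\<theta> = (2::real) powr (- e)"
  have \<theta>: "0 < \<theta>" "\<theta> < 1" using e powr_less_mono[of "-e" 0 2] by (auto simp: \<theta>_def)
  define C where "C = 2 * (1 / (1 - \<theta> powr p)) powr (1 / p)"
  have "Lq_norm q {0<..<t} (\<lambda>u. w u * ennreal (tail u powr (- 1 - e))) \<le> ennreal (C * tail t powr (- e))"
    if t: "0 < t" for t
  proof -
    define a s where "a k = (2 ^ k * tail t) powr (- 1 - e)" and "s k = 2 ^ Suc k * tail t" for k :: nat
    have n: "0 < tail t" by (rule tail_pos[OF t])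
    have "Lq_norm q {0<..<t} (\<lambda>u. w u * ennreal (tail u powr (- 1 - e)))
       \<le> ennreal ((2 * tail t powr (- e)) * (1 / (1 - \<theta> powr p)) powr (1 / p))"
    proof (rule Lq_norm_layers[OF False, where a = a and s = s])
      fix u assume u: "u \<in> {0<..<t}"
      have "1 \<le> tail u / tail t" using tail_antimono[of u t] u n by simp
      then obtain k where k: "2 ^ k \<le> tail u / tail t" "tail u / tail t < 2 ^ Suc k"
        using ex_dyadic by blast
      have k': "2 ^ k * tail t \<le> tail u" "tail u \<le> 2 ^ Suc k * tail t"
        using k n by (simp_all add: field_simps)
      have "tail u powr (- 1 - e) \<le> a k"
        unfolding a_def using k'(1) n e by (intro powr_mono2') auto
      then show "\<exists>k. tail u \<le> s k \<and> tail u powr (- 1 - e) \<le> a k"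
        using k'(2) unfolding s_def by blast
    next
      fix k :: nat
      have "(2 ^ k * tail t) powr (- 1 - e) * (2 ^ k * tail t) = (2 ^ k * tail t) powr (- e)"
        using n powr_add[of "2 ^ k * tail t" "-1-e" 1] by simp
      also have "\<dots> = \<theta> ^ k * tail t powr (- e)"
        using n powr_powr_swap[of 2 "real k" "-e"] by (simp add: powr_mult \<theta>_def powr_realpow)
      finally show "a k * s k \<le> 2 * tail t powr (- e) * \<theta> ^ k"
        unfolding a_def s_def by simp
    qed (use n t \<theta> in \<open>auto simp: a_def s_def\<close>)
    then show ?thesis by (simp add: C_def mult_ac)
  qed
  moreover have "C > 0" using \<theta> powr_less_mono2[of p \<theta> 1] p_pos[OF False] by (auto simp: C_def)
  ultimately show ?thesis by blast
qed

text \<open>The counterpart beyond \<open>t\<close>: after substituting \<open>x = tail(u)\<^bsup>p\<^esup>\<close> it is \<open>\<integral> x\<^bsup>-a\<^esup> dx\<close> over \<open>(0, tail(t)\<^bsup>p\<^esup>)\<close>, which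
converges because \<open>a < 1\<close>.\<close>

lemma Lq_norm_hardy_right:
  assumes a: "0 < a" "a < 1"
  shows "\<exists>C>0. \<forall>t>0. Lq_norm q {t<..} (\<lambda>u. w u * ennreal (tail u powr (- a))) \<le> ennreal (C * tail t powr (1 - a))"
proof (cases "q = \<infinity>")
  case True
  then have L_eq: "Lq_norm q S F = esssup (lebesgue_on S) F" for S F
    by (simp add: Lq_norm_top)
  have wb: "w u = ennreal (b u)" if "0 < u" for u
    unfolding w_eq using that True by simp
  obtain C where C: "C > 0" "\<And>t. t > 0 \<Longrightarrow> b t \<le> C * tail t"
    using b_le_tail by auto
  have "Lq_norm q {t<..} (\<lambda>u. w u * ennreal (tail u powr (- a))) \<le> ennreal (C * tail t powr (1 - a))"
    if t: "0 < t" for t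
    unfolding L_eq
  proof (rule esssup_I)
    show "(\<lambda>u. w u * ennreal (tail u powr (- a))) \<in> borel_measurable (lebesgue_on {t<..})"
      using t by (intro measurable_w_tail) auto
    show "AE u in lebesgue_on {t<..}. w u * ennreal (tail u powr (- a)) \<le> ennreal (C * tail t powr (1 - a))"
    proof (rule AE_I2)
      fix u assume "u \<in> space (lebesgue_on {t<..})"
      then have u: "0 < u" "t < u" using t by auto
      have "b u * tail u powr (- a) \<le> C * tail u * tail u powr (- a)"
        using C(2)[OF u(1)] by (intro mult_right_mono) auto
      also have "\<dots> = C * tail u powr (1 - a)"
        using tail_pos[OF u(1)] powr_add[of "tail u" 1 "-a"] by simp
      also have "\<dots> \<le> C * tail t powr (1 - a)"
        using tail_antimono[of t u] u a C(1) t tail_pos[of u] by (intro mult_left_mono powr_mono2) auto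
      finally show "w u * ennreal (tail u powr (- a)) \<le> ennreal (C * tail t powr (1 - a))"
        using u b_pos[of u] by (simp add: wb ennreal_mult[symmetric] ennreal_leI)
    qed
  qed
  then show ?thesis using C(1) by blast
next
  case False
  define \<theta> where "\<theta> = (2::real) powr (- (1 - a))"
  have \<theta>: "0 < \<theta>" "\<theta> < 1" using a powr_less_mono[of "-(1 - a)" 0 2] by (auto simp: \<theta>_def)
  define C where "C = 2 powr a * (1 / (1 - \<theta> powr p)) powr (1 / p)"
  have "Lq_norm q {t<..} (\<lambda>u. w u * ennreal (tail u powr (- a))) \<le> ennreal (C * tail t powr (1 - a))"
    if t: "0 < t" for t
  proof -
    define h s where "h k = (tail t / 2 ^ Suc k) powr (- a)" and "s k = tail t / 2 ^ k" for k :: nat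
    have n: "0 < tail t" by (rule tail_pos[OF t])
    have "Lq_norm q {t<..} (\<lambda>u. w u * ennreal (tail u powr (- a)))
       \<le> ennreal ((2 powr a * tail t powr (1 - a)) * (1 / (1 - \<theta> powr p)) powr (1 / p))"
    proof (rule Lq_norm_layers[OF False, where a = h and s = s])
      fix u assume "u \<in> {t<..}"
      then have u: "0 < u" "t < u" using t by auto
      have nu: "0 < tail u" by (rule tail_pos[OF u(1)])
      have "1 \<le> tail t / tail u" using tail_antimono[of t u] u t nu by simp
      then obtain k where k: "2 ^ k \<le> tail t / tail u" "tail t / tail u < 2 ^ Suc k"
        using ex_dyadic by blast
      have k': "tail t / 2 ^ Suc k \<le> tail u" "tail u \<le> tail t / 2 ^ k"
        using k nu by (simp_all add: field_simps)
      have "tail u powr (- a) \<le> h k"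
        unfolding h_def using k'(1) n a by (intro powr_mono2') auto
      then show "\<exists>k. tail u \<le> s k \<and> tail u powr (- a) \<le> h k"
        using k'(2) unfolding s_def by blast
    next
      fix k :: nat
      have h: "h k = 2 powr a * (tail t / 2 ^ k) powr (- a)"
      proof -
        have "h k = ((1/2) * (tail t / 2 ^ k)) powr (- a)" by (simp add: h_def)
        also have "\<dots> = (1/2) powr (- a) * (tail t / 2 ^ k) powr (- a)"
          using n by (subst powr_mult) auto
        also have "(1/2::real) powr (- a) = 2 powr a" by (simp add: powr_minus powr_divide)
        finally show ?thesis .
      qed
      have "h k * s k = 2 powr a * ((tail t / 2 ^ k) powr (- a) * (tail t / 2 ^ k))"
        by (simp only: h s_def mult.assoc)
      also have "(tail t / 2 ^ k) powr (- a) * (tail t / 2 ^ k) = (tail t / 2 ^ k) powr (1 - a)"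
        using n powr_add[of "tail t / 2 ^ k" "-a" 1] by simp
      also have "(tail t / 2 ^ k) powr (1 - a) = tail t powr (1 - a) * \<theta> ^ k"
      proof -
        have "(2 ^ k) powr (1 - a) * \<theta> ^ k = 1"
          using powr_powr_swap[of 2 "real k" "-(1-a)"] powr_minus[of "2 ^ k" "1 - a"]
          by (simp add: \<theta>_def powr_realpow)
        then show ?thesis using n by (simp add: powr_divide field_simps)
      qed
      finally show "h k * s k \<le> 2 powr a * tail t powr (1 - a) * \<theta> ^ k"
        by simp
    qed (use n t \<theta> in \<open>auto simp: h_def s_def\<close>)
    then show ?thesis by (simp add: C_def mult_ac)
  qed
  moreover have "C > 0" using \<theta> powr_less_mono2[of p \<theta> 1] p_pos[OF False] by (auto simp: C_def)
  ultimately show ?thesis by blast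
qed

end

section \<open>Embeddings between two weighted cones of profiles\<close>

locale sv_pair = W0: sv_weight q0 b0 + W1: sv_weight q1 b1 for q0 b0 q1 b1
begin

definition r :: "real \<Rightarrow> real" where "r t = W0.tail t / W1.tail t"

lemma r_pos: "0 < t \<Longrightarrow> 0 < r t"
  by (simp add: r_def W0.tail_pos W1.tail_pos)

lemma rho_eq: "0 < t \<Longrightarrow> rho q0 b0 q1 b1 t = ennreal (r t)"
  using W0.tail_pos[of t] W1.tail_pos[of t]
  by (simp add: rho_def r_def W0.tail_eq W1.tail_eq divide_ennreal)

lemma rho_eps_eq: "0 < t \<Longrightarrow> rho_eps e q0 b0 q1 b1 t = ennreal (W0.tail t powr (1 + e) / W1.tail t)"
  using W0.tail_pos[of t] W1.tail_pos[of t]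
  by (simp add: rho_eps_def W0.tail_eq W1.tail_eq divide_ennreal epowr_ennreal)

lemma equiv_rho_eps:
  "equiv_nondecreasing (rho_eps e q0 b0 q1 b1) \<longleftrightarrow>
     (\<exists>c>0. \<forall>s t. 0 < s \<and> s \<le> t \<longrightarrow> W0.tail s powr (1 + e) / W1.tail s \<le> c * (W0.tail t powr (1 + e) / W1.tail t))"
proof (rule equiv_nondecreasing_iff)
  fix t :: real assume "0 < t"
  then show "0 < W0.tail t powr (1 + e) / W1.tail t"
    using W0.tail_pos[of t] W1.tail_pos[of t] by simp
qed (rule rho_eps_eq)

text \<open>The total norm over \<open>w\<^sub>1\<close> bounds the profile by a multiple of \<open>1/n\<^sub>1(u)\<close>, and the almost monotonicity of
\<open>n\<^sub>0\<^bsup>1+e\<^esup>/n\<^sub>1\<close> bounds this for \<open>u \<le> t\<close> by a multiple of \<open>n\<^sub>0(u)\<^bsup>-1-e\<^esup>\<close>, the integrand of the left Hardy inequality.\<close>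

lemma embedding_I_of_growth:
  assumes e: "0 < e" and c: "0 < c"
    "\<And>s t. 0 < s \<Longrightarrow> s \<le> t \<Longrightarrow> W0.tail s powr (1 + e) / W1.tail s \<le> c * (W0.tail t powr (1 + e) / W1.tail t)"
  shows "\<exists>C>0. \<forall>k t. profile k \<and> 0 < t \<longrightarrow>
     Lq_norm q0 {0<..<t} (\<lambda>u. W0.w u * k u) \<le> ennreal (C * r t) * Lq_norm q1 {0<..} (\<lambda>u. W1.w u * k u)"
proof -
  obtain C where C: "C > 0" "\<And>t. 0 < t \<Longrightarrow> Lq_norm q0 {0<..<t} (\<lambda>u. W0.w u * ennreal (W0.tail u powr (- 1 - e))) \<le> ennreal (C * W0.tail t powr (- e))"
    using W0.Lq_norm_hardy_left[OF e] by auto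
  have "Lq_norm q0 {0<..<t} (\<lambda>u. W0.w u * k u) \<le> ennreal ((c * C) * r t) * Lq_norm q1 {0<..} (\<lambda>u. W1.w u * k u)"
    if k: "profile k" and t: "0 < t" for k t
  proof -
    let ?N = "Lq_norm q1 {0<..} (\<lambda>u. W1.w u * k u)"
    define M where "M = c * (W0.tail t powr (1 + e) / W1.tail t)"
    have n: "0 < W0.tail t" "0 < W1.tail t" using t W0.tail_pos W1.tail_pos by auto
    have M: "0 \<le> M" using c n by (simp add: M_def)
    have "Lq_norm q0 {0<..<t} (\<lambda>u. W0.w u * k u)
       \<le> Lq_norm q0 {0<..<t} (\<lambda>u. (?N * ennreal M) * (W0.w u * ennreal (W0.tail u powr (- 1 - e))))"
    proof (rule Lq_norm_mono[OF W0.q_pos W0.measurable_w_profile[OF k]])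
      fix u assume "u \<in> {0<..<t}"
      then have u: "0 < u" "u \<le> t" by auto
      have nu: "0 < W0.tail u" "0 < W1.tail u" using u W0.tail_pos W1.tail_pos by auto
      have "1 / W1.tail u = (W0.tail u powr (1 + e) / W1.tail u) * W0.tail u powr (- 1 - e)"
        using nu powr_add[of "W0.tail u" "1 + e" "- 1 - e"] by simp
      also have "\<dots> \<le> M * W0.tail u powr (- 1 - e)"
        unfolding M_def by (intro mult_right_mono c(2) u) auto
      finally have *: "1 / W1.tail u \<le> M * W0.tail u powr (- 1 - e)" .
      have "k u \<le> ?N * ennreal (1 / W1.tail u)"
        by (rule W1.profile_le_total[OF k u(1)])
      also have "\<dots> \<le> ?N * ennreal (M * W0.tail u powr (- 1 - e))"
        using * by (intro mult_left_mono ennreal_leI) auto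
      also have "\<dots> = ?N * ennreal M * ennreal (W0.tail u powr (- 1 - e))"
        using M by (simp add: ennreal_mult mult.assoc)
      finally have "k u \<le> ?N * ennreal M * ennreal (W0.tail u powr (- 1 - e))" .
      from mult_left_mono[OF this, of "W0.w u"]
      show "W0.w u * k u \<le> (?N * ennreal M) * (W0.w u * ennreal (W0.tail u powr (- 1 - e)))"
        by (simp add: mult_ac)
    qed auto
    also have "\<dots> \<le> (?N * ennreal M) * Lq_norm q0 {0<..<t} (\<lambda>u. W0.w u * ennreal (W0.tail u powr (- 1 - e)))"
      by (intro Lq_norm_cmult[OF W0.q_pos] W0.measurable_w_tail) auto
    also have "\<dots> \<le> (?N * ennreal M) * ennreal (C * W0.tail t powr (- e))"
      by (intro mult_left_mono C t) auto
    also have "\<dots> = ?N * ennreal (M * (C * W0.tail t powr (- e)))"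
      using M C(1) by (simp add: ennreal_mult mult.assoc)
    also have "M * (C * W0.tail t powr (- e)) = (c * C) * r t"
    proof -
      have "W0.tail t powr (1 + e) * W0.tail t powr (- e) = W0.tail t"
        using n powr_add[of "W0.tail t" "1 + e" "- e"] by simp
      then show ?thesis by (simp add: M_def r_def mult_ac)
    qed
    finally show ?thesis by (simp add: mult.commute)
  qed
  then show ?thesis using C(1) c(1) by (intro exI[of _ "c * C"]) auto
qed

text \<open>The same idea beyond \<open>t\<close>: there the assumption bounds \<open>1/n\<^sub>0(u)\<close> by a multiple of \<open>n\<^sub>1(u)\<^bsup>-a\<^esup>\<close> with
\<open>a = 1/(1+e) < 1\<close>.\<close>

lemma embedding_J_of_growth:
  assumes e: "0 < e" and c: "0 < c"
    "\<And>s t. 0 < s \<Longrightarrow> s \<le> t \<Longrightarrow> W0.tail s powr (1 + e) / W1.tail s \<le> c * (W0.tail t powr (1 + e) / W1.tail t)"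
  shows "\<exists>C>0. \<forall>k t. profile k \<and> 0 < t \<longrightarrow>
     Lq_norm q1 {t<..} (\<lambda>u. W1.w u * k u) \<le> ennreal (C / r t) * Lq_norm q0 {0<..} (\<lambda>u. W0.w u * k u)"
proof -
  define a where "a = 1 / (1 + e)"
  have a: "0 < a" "a < 1" "(1 + e) * a = 1" using e by (simp_all add: a_def)
  obtain C where C: "C > 0" "\<And>t. 0 < t \<Longrightarrow> Lq_norm q1 {t<..} (\<lambda>u. W1.w u * ennreal (W1.tail u powr (- a))) \<le> ennreal (C * W1.tail t powr (1 - a))"
    using W1.Lq_norm_hardy_right[OF a(1,2)] by auto
  have "Lq_norm q1 {t<..} (\<lambda>u. W1.w u * k u) \<le> ennreal ((c powr a * C) / r t) * Lq_norm q0 {0<..} (\<lambda>u. W0.w u * k u)"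
    if k: "profile k" and t: "0 < t" for k t
  proof -
    let ?N = "Lq_norm q0 {0<..} (\<lambda>u. W0.w u * k u)"
    define M where "M = c powr a * W1.tail t powr a / W0.tail t"
    have n: "0 < W0.tail t" "0 < W1.tail t" using t W0.tail_pos W1.tail_pos by auto
    have M: "0 \<le> M" using c n by (simp add: M_def)
    have "Lq_norm q1 {t<..} (\<lambda>u. W1.w u * k u)
       \<le> Lq_norm q1 {t<..} (\<lambda>u. (?N * ennreal M) * (W1.w u * ennreal (W1.tail u powr (- a))))"
    proof (rule Lq_norm_mono[OF W1.q_pos W1.measurable_w_profile[OF k]])
      fix u assume "u \<in> {t<..}"
      then have u: "0 < u" "t \<le> u" using t by auto
      have nu: "0 < W0.tail u" "0 < W1.tail u" using u W0.tail_pos W1.tail_pos by auto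
      have "(W0.tail t powr (1 + e) / W1.tail t) powr a \<le> (c * (W0.tail u powr (1 + e) / W1.tail u)) powr a"
        using c(2)[OF t u(2)] n a by (intro powr_mono2) auto
      then have "W0.tail t / W1.tail t powr a \<le> c powr a * (W0.tail u / W1.tail u powr a)"
        using n nu c(1) a(3) by (simp add: powr_divide powr_mult powr_powr)
      then have *: "1 / W0.tail u \<le> M * W1.tail u powr (- a)"
        using n nu by (simp add: M_def powr_minus field_simps)
      have "k u \<le> ?N * ennreal (1 / W0.tail u)"
        by (rule W0.profile_le_total[OF k u(1)])
      also have "\<dots> \<le> ?N * ennreal (M * W1.tail u powr (- a))"
        using * by (intro mult_left_mono ennreal_leI) auto
      also have "\<dots> = ?N * ennreal M * ennreal (W1.tail u powr (- a))"
        using M by (simp add: ennreal_mult mult.assoc)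
      finally have "k u \<le> ?N * ennreal M * ennreal (W1.tail u powr (- a))" .
      from mult_left_mono[OF this, of "W1.w u"]
      show "W1.w u * k u \<le> (?N * ennreal M) * (W1.w u * ennreal (W1.tail u powr (- a)))"
        by (simp add: mult_ac)
    qed (use t in auto)
    also have "\<dots> \<le> (?N * ennreal M) * Lq_norm q1 {t<..} (\<lambda>u. W1.w u * ennreal (W1.tail u powr (- a)))"
      using t by (intro Lq_norm_cmult[OF W1.q_pos] W1.measurable_w_tail) auto
    also have "\<dots> \<le> (?N * ennreal M) * ennreal (C * W1.tail t powr (1 - a))"
      by (intro mult_left_mono C t) auto
    also have "\<dots> = ?N * ennreal (M * (C * W1.tail t powr (1 - a)))"
      using M C(1) by (simp add: ennreal_mult mult.assoc)
    also have "M * (C * W1.tail t powr (1 - a)) = (c powr a * C) / r t"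
    proof -
      have "W1.tail t powr a * W1.tail t powr (1 - a) = W1.tail t"
        using n powr_add[of "W1.tail t" "a" "1 - a"] by simp
      then show ?thesis by (simp add: M_def r_def mult_ac)
    qed
    finally show ?thesis by (simp add: mult.commute)
  qed
  then show ?thesis using C(1) c(1) by (intro exI[of _ "c powr a * C"]) auto
qed

end

section \<open>The K-functional of a couple of quasi-normed spaces\<close>

lemma K_fun_le:
  "f0 \<in> qspace A0 \<Longrightarrow> f1 \<in> qspace A1 \<Longrightarrow> K_fun A0 A1 t (f0 + f1) \<le> ennreal (qnorm A0 f0) + t * ennreal (qnorm A1 f1)"
  unfolding K_fun_def by (intro Inf_lower) blast

lemma K_fun_greatest:
  assumes "\<And>f0 f1. f0 \<in> qspace A0 \<Longrightarrow> f1 \<in> qspace A1 \<Longrightarrow> f = f0 + f1 \<Longrightarrow>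
    c \<le> ennreal (qnorm A0 f0) + t * ennreal (qnorm A1 f1)"
  shows "c \<le> K_fun A0 A1 t f"
  unfolding K_fun_def using assms by (intro Inf_greatest) blast

lemma K_fun_near_optimal:
  assumes "K_fun A0 A1 t f < c"
  obtains f0 f1 where "f0 \<in> qspace A0" "f1 \<in> qspace A1" "f = f0 + f1"
    "ennreal (qnorm A0 f0) + t * ennreal (qnorm A1 f1) < c"
  using assms unfolding K_fun_def Inf_less_iff by blast

lemma sum_spaceI: "f0 \<in> qspace A0 \<Longrightarrow> f1 \<in> qspace A1 \<Longrightarrow> f0 + f1 \<in> sum_space A0 A1"
  by (auto simp: sum_space_def)

lemma sum_spaceE:
  assumes "f \<in> sum_space A0 A1"
  obtains f0 f1 where "f0 \<in> qspace A0" "f1 \<in> qspace A1" "f = f0 + f1"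
  using assms by (auto simp: sum_space_def elim!: set_plus_elim)

lemma K_fun_profile:
  assumes "f \<in> sum_space A0 A1"
  shows "profile (\<lambda>u. K_fun A0 A1 (ennreal u) f)"
  unfolding profile_def
proof (intro conjI allI impI)
  fix t :: real assume "0 < t"
  obtain f0 f1 where f: "f0 \<in> qspace A0" "f1 \<in> qspace A1" "f = f0 + f1"
    using assms by (rule sum_spaceE)
  have "K_fun A0 A1 (ennreal t) f \<le> ennreal (qnorm A0 f0) + ennreal t * ennreal (qnorm A1 f1)"
    unfolding f(3) by (rule K_fun_le[OF f(1,2)])
  also have "\<dots> < \<infinity>" by (simp add: ennreal_mult_less_top)
  finally show "K_fun A0 A1 (ennreal t) f < \<infinity>" .
next
  fix s t :: real assume st: "0 < s \<and> s \<le> t"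
  show "K_fun A0 A1 (ennreal s) f \<le> K_fun A0 A1 (ennreal t) f"
  proof (rule K_fun_greatest)
    fix f0 f1 assume f: "f0 \<in> qspace A0" "f1 \<in> qspace A1" "f = f0 + f1"
    have "K_fun A0 A1 (ennreal s) f \<le> ennreal (qnorm A0 f0) + ennreal s * ennreal (qnorm A1 f1)"
      unfolding f(3) by (rule K_fun_le[OF f(1,2)])
    also have "\<dots> \<le> ennreal (qnorm A0 f0) + ennreal t * ennreal (qnorm A1 f1)"
      using st by (intro add_left_mono mult_right_mono ennreal_leI) auto
    finally show "K_fun A0 A1 (ennreal s) f \<le> \<dots>" .
  qed
  show "ennreal (s / t) * K_fun A0 A1 (ennreal t) f \<le> K_fun A0 A1 (ennreal s) f"
  proof (rule K_fun_greatest)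
    fix f0 f1 assume f: "f0 \<in> qspace A0" "f1 \<in> qspace A1" "f = f0 + f1"
    have "ennreal (s / t) * K_fun A0 A1 (ennreal t) f \<le> ennreal (s / t) * (ennreal (qnorm A0 f0) + ennreal t * ennreal (qnorm A1 f1))"
      unfolding f(3) by (intro mult_left_mono K_fun_le f(1,2)) auto
    also have "\<dots> = ennreal (s / t) * ennreal (qnorm A0 f0) + ennreal s * ennreal (qnorm A1 f1)"
      using st by (simp add: distrib_left mult.assoc[symmetric] ennreal_mult[symmetric])
    also have "\<dots> \<le> 1 * ennreal (qnorm A0 f0) + ennreal s * ennreal (qnorm A1 f1)"
      using st by (intro add_right_mono mult_right_mono) (auto simp: ennreal_le_1)
    finally show "ennreal (s / t) * K_fun A0 A1 (ennreal t) f \<le> ennreal (qnorm A0 f0) + ennreal s * ennreal (qnorm A1 f1)"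
      by simp
  qed
qed

locale quasi_normed_couple =
  fixes A0 A1 :: "'a::real_vector quasi_normed"
  assumes qns: "quasi_normed_space A0" "quasi_normed_space A1"
begin

lemma zero_mem: "0 \<in> qspace A0" "0 \<in> qspace A1" and qnorm_zero: "qnorm A0 0 = 0" "qnorm A1 0 = 0"
  using qns by (auto simp: quasi_normed_space_def subspace_def)

lemma K_fun_le_left: "f \<in> qspace A0 \<Longrightarrow> K_fun A0 A1 t f \<le> ennreal (qnorm A0 f)"
  using K_fun_le[of f A0 0 A1 t] zero_mem qnorm_zero by simp

lemma K_fun_le_right: "f \<in> qspace A1 \<Longrightarrow> K_fun A0 A1 t f \<le> t * ennreal (qnorm A1 f)"
  using K_fun_le[of 0 A0 f A1 t] zero_mem qnorm_zero by simp

lemma qspace_subset_sum: "f \<in> qspace A0 \<or> f \<in> qspace A1 \<Longrightarrow> f \<in> sum_space A0 A1"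
  using sum_spaceI[of f A0 0 A1] sum_spaceI[of 0 A0 f A1] zero_mem by auto

lemma qspace_uminus: "f \<in> qspace A0 \<Longrightarrow> - f \<in> qspace A0" "f \<in> qspace A1 \<Longrightarrow> - f \<in> qspace A1"
  using qns by (auto simp: quasi_normed_space_def subspace_neg)

lemma qnorm_uminus: "f \<in> qspace A0 \<Longrightarrow> qnorm A0 (- f) = qnorm A0 f" "f \<in> qspace A1 \<Longrightarrow> qnorm A1 (- f) = qnorm A1 f"
proof -
  show "f \<in> qspace A0 \<Longrightarrow> qnorm A0 (- f) = qnorm A0 f"
    using qns(1) unfolding quasi_normed_space_def by (metis abs_neg_one mult_1 scaleR_minus1_left)
  show "f \<in> qspace A1 \<Longrightarrow> qnorm A1 (- f) = qnorm A1 f"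
    using qns(2) unfolding quasi_normed_space_def by (metis abs_neg_one mult_1 scaleR_minus1_left)
qed

lemma K_fun_quasi_add:
  "\<exists>C\<ge>1. \<forall>t f g. K_fun A0 A1 t (f + g) \<le> ennreal C * (K_fun A0 A1 t f + K_fun A0 A1 t g)"
proof -
  have "\<exists>C\<ge>1. \<forall>x\<in>qspace A0. \<forall>y\<in>qspace A0. qnorm A0 (x + y) \<le> C * (qnorm A0 x + qnorm A0 y)"
    using qns(1) by (simp add: quasi_normed_space_def)
  then obtain C0 where C0: "C0 \<ge> 1" "\<And>x y. x \<in> qspace A0 \<Longrightarrow> y \<in> qspace A0 \<Longrightarrow> qnorm A0 (x + y) \<le> C0 * (qnorm A0 x + qnorm A0 y)"
    by metis
  have "\<exists>C\<ge>1. \<forall>x\<in>qspace A1. \<forall>y\<in>qspace A1. qnorm A1 (x + y) \<le> C * (qnorm A1 x + qnorm A1 y)"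
    using qns(2) by (simp add: quasi_normed_space_def)
  then obtain C1 where C1: "C1 \<ge> 1" "\<And>x y. x \<in> qspace A1 \<Longrightarrow> y \<in> qspace A1 \<Longrightarrow> qnorm A1 (x + y) \<le> C1 * (qnorm A1 x + qnorm A1 y)"
    by metis
  define C where "C = max C0 C1"
  have C: "1 \<le> C" "C0 \<le> C" "C1 \<le> C" using C0 C1 by (auto simp: C_def)
  have nn: "x \<in> qspace A0 \<Longrightarrow> 0 \<le> qnorm A0 x" "x \<in> qspace A1 \<Longrightarrow> 0 \<le> qnorm A1 x" for x
    using qns by (auto simp: quasi_normed_space_def)
  have "K_fun A0 A1 t (f + g) \<le> ennreal C * (K_fun A0 A1 t f + K_fun A0 A1 t g)" for t f g
  proof (rule ennreal_le_epsilon)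
    fix e :: real assume e: "0 < e" and fin: "ennreal C * (K_fun A0 A1 t f + K_fun A0 A1 t g) < top"
    define d where "d = e / (2 * C)"
    have d: "0 < d" using e C by (simp add: d_def)
    have fin': "K_fun A0 A1 t f < top" "K_fun A0 A1 t g < top"
      using fin C by (auto simp: ennreal_mult_less_top)
    have lt: "x < top \<Longrightarrow> x < x + ennreal d" for x
      using d by (cases x) (auto simp: ennreal_plus[symmetric] simp del: ennreal_plus intro!: ennreal_lessI)
    obtain f0 f1 where f: "f0 \<in> qspace A0" "f1 \<in> qspace A1" "f = f0 + f1"
      "ennreal (qnorm A0 f0) + t * ennreal (qnorm A1 f1) < K_fun A0 A1 t f + ennreal d"
      using K_fun_near_optimal[OF lt[OF fin'(1)]] .
    obtain g0 g1 where g: "g0 \<in> qspace A0" "g1 \<in> qspace A1" "g = g0 + g1"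
      "ennreal (qnorm A0 g0) + t * ennreal (qnorm A1 g1) < K_fun A0 A1 t g + ennreal d"
      using K_fun_near_optimal[OF lt[OF fin'(2)]] .
    have mem: "f0 + g0 \<in> qspace A0" "f1 + g1 \<in> qspace A1"
      using qns f g by (auto simp: quasi_normed_space_def subspace_add)
    have q0: "ennreal (qnorm A0 (f0 + g0)) \<le> ennreal C * (ennreal (qnorm A0 f0) + ennreal (qnorm A0 g0))"
    proof -
      have "qnorm A0 (f0 + g0) \<le> C0 * (qnorm A0 f0 + qnorm A0 g0)" using C0 f g by blast
      also have "\<dots> \<le> C * (qnorm A0 f0 + qnorm A0 g0)"
        using C nn f g by (intro mult_right_mono) (auto intro: add_nonneg_nonneg)
      finally show ?thesis using C nn f g by (simp add: ennreal_plus[symmetric] ennreal_mult[symmetric] ennreal_leI del: ennreal_plus)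
    qed
    have q1: "ennreal (qnorm A1 (f1 + g1)) \<le> ennreal C * (ennreal (qnorm A1 f1) + ennreal (qnorm A1 g1))"
    proof -
      have "qnorm A1 (f1 + g1) \<le> C1 * (qnorm A1 f1 + qnorm A1 g1)" using C1 f g by blast
      also have "\<dots> \<le> C * (qnorm A1 f1 + qnorm A1 g1)"
        using C nn f g by (intro mult_right_mono) (auto intro: add_nonneg_nonneg)
      finally show ?thesis using C nn f g by (simp add: ennreal_plus[symmetric] ennreal_mult[symmetric] ennreal_leI del: ennreal_plus)
    qed
    have "f + g = (f0 + g0) + (f1 + g1)" using f(3) g(3) by simp
    then have "K_fun A0 A1 t (f + g) \<le> ennreal (qnorm A0 (f0 + g0)) + t * ennreal (qnorm A1 (f1 + g1))"
      using K_fun_le[OF mem] by simp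
    also have "\<dots> \<le> ennreal C * (ennreal (qnorm A0 f0) + ennreal (qnorm A0 g0)) + t * (ennreal C * (ennreal (qnorm A1 f1) + ennreal (qnorm A1 g1)))"
      by (intro add_mono mult_left_mono q0 q1) auto
    also have "\<dots> = ennreal C * ((ennreal (qnorm A0 f0) + t * ennreal (qnorm A1 f1)) + (ennreal (qnorm A0 g0) + t * ennreal (qnorm A1 g1)))"
      by (simp add: distrib_left mult_ac add_ac)
    also have "\<dots> \<le> ennreal C * ((K_fun A0 A1 t f + ennreal d) + (K_fun A0 A1 t g + ennreal d))"
      using add_mono[OF less_imp_le[OF f(4)] less_imp_le[OF g(4)]] by (rule mult_left_mono) simp
    also have "\<dots> = ennreal C * (K_fun A0 A1 t f + K_fun A0 A1 t g) + ennreal C * (ennreal d + ennreal d)"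
      by (simp add: distrib_left add_ac)
    also have "ennreal C * (ennreal d + ennreal d) = ennreal e"
      using C d by (simp add: ennreal_plus[symmetric] ennreal_mult[symmetric] d_def del: ennreal_plus)
    finally show "K_fun A0 A1 t (f + g) \<le> ennreal C * (K_fun A0 A1 t f + K_fun A0 A1 t g) + ennreal e" .
  qed
  then show ?thesis using C by blast
qed

text \<open>The parts of a decomposition of cost at most \<open>M\<close> at level \<open>t\<close>. On the side of \<open>t\<close> where the cost of the
part itself is too large, write the part as the whole minus the other part.\<close>

lemma K_fun_parts_le:
  "\<exists>C\<ge>1. \<forall>f0 f1 t M. f0 \<in> qspace A0 \<and> f1 \<in> qspace A1 \<and> 0 < t \<and>
      ennreal (qnorm A0 f0) + ennreal t * ennreal (qnorm A1 f1) \<le> ennreal M \<longrightarrow>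
      (\<forall>u>0. K_fun A0 A1 (ennreal u) f0 \<le> ennreal C * (K_fun A0 A1 (ennreal u) (f0 + f1) * indicator {0<..<t} u + ennreal M * ennreal (min 1 (u / t)))) \<and>
      (\<forall>u>0. K_fun A0 A1 (ennreal u) f1 \<le> ennreal C * (K_fun A0 A1 (ennreal u) (f0 + f1) * indicator {t<..} u + ennreal M * ennreal (min 1 (u / t))))"
proof -
  obtain C where C: "C \<ge> 1" "\<And>t f g. K_fun A0 A1 t (f + g) \<le> ennreal C * (K_fun A0 A1 t f + K_fun A0 A1 t g)"
    using K_fun_quasi_add by blast
  show ?thesis
  proof (intro exI[of _ C] conjI allI impI)
    fix f0 f1 and t M u :: real
    assume "f0 \<in> qspace A0 \<and> f1 \<in> qspace A1 \<and> 0 < t \<and>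
      ennreal (qnorm A0 f0) + ennreal t * ennreal (qnorm A1 f1) \<le> ennreal M" and u: "0 < u"
    then have f: "f0 \<in> qspace A0" "f1 \<in> qspace A1" and t: "0 < t"
      and M: "ennreal (qnorm A0 f0) + ennreal t * ennreal (qnorm A1 f1) \<le> ennreal M" by auto
    have M0: "ennreal (qnorm A0 f0) \<le> ennreal M" and M1: "ennreal t * ennreal (qnorm A1 f1) \<le> ennreal M"
      using M by (auto intro: order.trans[rotated])
    have M1': "ennreal u * ennreal (qnorm A1 f1) \<le> ennreal M * ennreal (u / t)"
    proof -
      have "ennreal u * ennreal (qnorm A1 f1) = (ennreal t * ennreal (qnorm A1 f1)) * ennreal (u / t)"
      proof -
        have "ennreal t * ennreal (u / t) = ennreal u"
          using t u by (simp add: ennreal_mult[symmetric])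
        then show ?thesis by (metis mult.assoc mult.commute)
      qed
      also have "\<dots> \<le> ennreal M * ennreal (u / t)" by (rule mult_right_mono[OF M1]) simp
      finally show ?thesis .
    qed
    have C1: "x \<le> ennreal C * x" for x using C(1) mult_right_mono[of 1 "ennreal C" x] by simp
    show "K_fun A0 A1 (ennreal u) f0 \<le> ennreal C * (K_fun A0 A1 (ennreal u) (f0 + f1) * indicator {0<..<t} u + ennreal M * ennreal (min 1 (u / t)))"
    proof (cases "u < t")
      case True
      then have m: "min 1 (u / t) = u / t" using t u by simp
      have "K_fun A0 A1 (ennreal u) f0 = K_fun A0 A1 (ennreal u) ((f0 + f1) + - f1)" by simp
      also have "\<dots> \<le> ennreal C * (K_fun A0 A1 (ennreal u) (f0 + f1) + K_fun A0 A1 (ennreal u) (- f1))" by (rule C(2))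
      also have "\<dots> \<le> ennreal C * (K_fun A0 A1 (ennreal u) (f0 + f1) + ennreal M * ennreal (u / t))"
        using K_fun_le_right[OF qspace_uminus(2)[OF f(2)], of "ennreal u"] M1' qnorm_uminus(2)[OF f(2)]
        by (intro mult_left_mono add_left_mono) auto
      finally show ?thesis using True u m by simp
    next
      case False
      then have m: "min 1 (u / t) = 1" using t u by simp
      have "K_fun A0 A1 (ennreal u) f0 \<le> ennreal M"
        using K_fun_le_left[OF f(1)] M0 by (rule order.trans)
      then show ?thesis using False m C1[of "ennreal M"] by simp
    qed
    show "K_fun A0 A1 (ennreal u) f1 \<le> ennreal C * (K_fun A0 A1 (ennreal u) (f0 + f1) * indicator {t<..} u + ennreal M * ennreal (min 1 (u / t)))"
    proof (cases "t < u")
      case True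
      then have m: "min 1 (u / t) = 1" using t u by simp
      have "K_fun A0 A1 (ennreal u) f1 = K_fun A0 A1 (ennreal u) ((f0 + f1) + - f0)" by simp
      also have "\<dots> \<le> ennreal C * (K_fun A0 A1 (ennreal u) (f0 + f1) + K_fun A0 A1 (ennreal u) (- f0))" by (rule C(2))
      also have "\<dots> \<le> ennreal C * (K_fun A0 A1 (ennreal u) (f0 + f1) + ennreal M)"
        using K_fun_le_left[OF qspace_uminus(1)[OF f(1)], of "ennreal u"] M0 qnorm_uminus(1)[OF f(1)]
        by (intro mult_left_mono add_left_mono) auto
      finally show ?thesis using True u m by simp
    next
      case False
      then have m: "min 1 (u / t) = u / t" using t u by simp
      have "K_fun A0 A1 (ennreal u) f1 \<le> ennreal M * ennreal (u / t)"
        using K_fun_le_right[OF f(2)] M1' by (rule order.trans)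
      then show ?thesis using False m C1[of "ennreal M * ennreal (u / t)"] by simp
    qed
  qed (use C in auto)
qed

end

section \<open>The reiteration formula under the growth condition\<close>

locale reiteration = quasi_normed_couple A0 A1 + sv_pair q0 b0 q1 b1
  for A0 A1 :: "'a::real_vector quasi_normed" and q0 b0 q1 b1
begin

abbreviation k :: "'a \<Rightarrow> real \<Rightarrow> ennreal" where "k f \<equiv> \<lambda>u. K_fun A0 A1 (ennreal u) f"

abbreviation X0 :: "'a quasi_normed" where "X0 \<equiv> interp_space A0 A1 0 q0 b0"

abbreviation X1 :: "'a quasi_normed" where "X1 \<equiv> interp_space A0 A1 0 q1 b1"

abbreviation N0 :: "'a \<Rightarrow> ennreal" where "N0 f \<equiv> interp_norm A0 A1 0 q0 b0 f"

abbreviation N1 :: "'a \<Rightarrow> ennreal" where "N1 f \<equiv> interp_norm A0 A1 0 q1 b1 f"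

lemma X_mem: "f \<in> qspace X0 \<longleftrightarrow> f \<in> sum_space A0 A1 \<and> N0 f < \<infinity>" "f \<in> qspace X1 \<longleftrightarrow> f \<in> sum_space A0 A1 \<and> N1 f < \<infinity>"
  by (auto simp: interp_space_def)

lemma X_norm: "f \<in> qspace X0 \<Longrightarrow> ennreal (qnorm X0 f) = N0 f" "f \<in> qspace X1 \<Longrightarrow> ennreal (qnorm X1 f) = N1 f"
  by (auto simp: interp_space_def)

text \<open>A decomposition of cost at most \<open>K(t, f) + d\<close> with arbitrary \<open>d > 0\<close> is used, so that the case
\<open>K(t, f) = 0\<close> is not special.\<close>

lemma upper_estimate:
  "\<exists>C>0. \<forall>f\<in>sum_space A0 A1. \<forall>t>0.
     K_fun X0 X1 (ennreal (r t)) f \<le> ennreal C * (I_fun A0 A1 q0 b0 t f + ennreal (r t) * J_fun A0 A1 q1 b1 t f)"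
proof -
  obtain C where C: "C \<ge> 1" and parts: "\<And>f0 f1 t M u. f0 \<in> qspace A0 \<Longrightarrow> f1 \<in> qspace A1 \<Longrightarrow> 0 < t \<Longrightarrow>
      ennreal (qnorm A0 f0) + ennreal t * ennreal (qnorm A1 f1) \<le> ennreal M \<Longrightarrow> 0 < u \<Longrightarrow>
      k f0 u \<le> ennreal C * (k (f0 + f1) u * indicator {0<..<t} u + ennreal M * ennreal (min 1 (u / t)))"
      "\<And>f0 f1 t M u. f0 \<in> qspace A0 \<Longrightarrow> f1 \<in> qspace A1 \<Longrightarrow> 0 < t \<Longrightarrow>
      ennreal (qnorm A0 f0) + ennreal t * ennreal (qnorm A1 f1) \<le> ennreal M \<Longrightarrow> 0 < u \<Longrightarrow>
      k f1 u \<le> ennreal C * (k (f0 + f1) u * indicator {t<..} u + ennreal M * ennreal (min 1 (u / t)))"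
    using K_fun_parts_le by metis
  have C0: "0 < C" using C by simp
  obtain B0 where B0: "0 < B0" "\<forall>f g t M S. profile f \<and> profile g \<and> 0 < t \<and> S \<in> sets lebesgue \<and> S \<subseteq> {0<..} \<and> 0 \<le> M \<and>
     (\<forall>u>0. g u \<le> ennreal C * (f u * indicator S u + ennreal M * ennreal (min 1 (u / t)))) \<longrightarrow>
       Lq_norm q0 {0<..} (\<lambda>u. W0.w u * g u) \<le> ennreal B0 * (Lq_norm q0 S (\<lambda>u. W0.w u * f u) + ennreal (M * W0.tail t))"
    using W0.Lq_norm_le_part_plus_truncation[OF C0] by (elim exE conjE) (rule that)
  obtain B1 where B1: "0 < B1" "\<forall>f g t M S. profile f \<and> profile g \<and> 0 < t \<and> S \<in> sets lebesgue \<and> S \<subseteq> {0<..} \<and> 0 \<le> M \<and>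
     (\<forall>u>0. g u \<le> ennreal C * (f u * indicator S u + ennreal M * ennreal (min 1 (u / t)))) \<longrightarrow>
       Lq_norm q1 {0<..} (\<lambda>u. W1.w u * g u) \<le> ennreal B1 * (Lq_norm q1 S (\<lambda>u. W1.w u * f u) + ennreal (M * W1.tail t))"
    using W1.Lq_norm_le_part_plus_truncation[OF C0] by (elim exE conjE) (rule that)
  define B where "B = max B0 B1"
  have B: "0 < B" "B0 \<le> B" "B1 \<le> B" using B0(1) by (auto simp: B_def)
  have "K_fun X0 X1 (ennreal (r t)) f \<le> ennreal (3 * B) * (I_fun A0 A1 q0 b0 t f + ennreal (r t) * J_fun A0 A1 q1 b1 t f)"
    if f: "f \<in> sum_space A0 A1" and t: "0 < t" for f t
  proof (rule ennreal_le_epsilon)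
    let ?I = "I_fun A0 A1 q0 b0 t f" and ?J = "J_fun A0 A1 q1 b1 t f"
    fix e :: real assume e: "0 < e" and fin: "ennreal (3 * B) * (?I + ennreal (r t) * ?J) < top"
    have finI: "?I < top" "?J < top"
      using fin B r_pos[OF t] by (auto simp: ennreal_mult_less_top ennreal_mult_eq_top_iff less_top[symmetric])
    have n: "0 < W0.tail t" "0 < W1.tail t" using t W0.tail_pos W1.tail_pos by auto
    \<comment> \<open>The excess \<open>d\<close> enters the final bound as \<open>2 B d n\<^sub>0(t)\<close>.\<close>
    define d where "d = e / (2 * B * W0.tail t)"
    have d: "0 < d" using e B n by (simp add: d_def)
    obtain \<kappa> where \<kappa>: "k f t = ennreal \<kappa>" "0 \<le> \<kappa>"
      using profileD(1)[OF K_fun_profile[OF f] t] by (cases "k f t") auto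
    define M where "M = \<kappa> + d"
    have "k f t < ennreal M" using \<kappa> d by (simp add: M_def ennreal_lessI)
    then obtain f0 f1 where fp: "f0 \<in> qspace A0" "f1 \<in> qspace A1" "f = f0 + f1"
      "ennreal (qnorm A0 f0) + ennreal t * ennreal (qnorm A1 f1) < ennreal M"
      by (rule K_fun_near_optimal)
    have fs: "f0 \<in> sum_space A0 A1" "f1 \<in> sum_space A0 A1" using fp qspace_subset_sum by auto
    have M: "0 \<le> M" using \<kappa> d by (simp add: M_def)
    have n0: "N0 f0 \<le> ennreal B * (?I + ennreal (M * W0.tail t))"
    proof -
      have "N0 f0 \<le> ennreal B0 * (?I + ennreal (M * W0.tail t))"
        unfolding I_fun_def interp_norm_def
        by (rule B0(2)[rule_format], intro conjI allI impI K_fun_profile fs f t M)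
          (use parts(1)[OF fp(1,2) t less_imp_le[OF fp(4)]] in \<open>auto simp: fp(3)\<close>)
      also have "\<dots> \<le> ennreal B * (?I + ennreal (M * W0.tail t))"
        using B by (intro mult_right_mono ennreal_leI) auto
      finally show ?thesis .
    qed
    have n1: "N1 f1 \<le> ennreal B * (?J + ennreal (M * W1.tail t))"
    proof -
      have "N1 f1 \<le> ennreal B1 * (?J + ennreal (M * W1.tail t))"
        unfolding J_fun_def interp_norm_def
        by (rule B1(2)[rule_format], intro conjI allI impI K_fun_profile fs f t M)
          (use parts(2)[OF fp(1,2) t less_imp_le[OF fp(4)]] t in \<open>auto simp: fp(3)\<close>)
      also have "\<dots> \<le> ennreal B * (?J + ennreal (M * W1.tail t))"
        using B by (intro mult_right_mono ennreal_leI) auto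
      finally show ?thesis .
    qed
    have "N0 f0 < top" using n0 finI by (auto simp: ennreal_mult_less_top elim!: order.strict_trans1)
    then have x0: "f0 \<in> qspace X0" using fs by (simp add: X_mem)
    have "N1 f1 < top" using n1 finI by (auto simp: ennreal_mult_less_top elim!: order.strict_trans1)
    then have x1: "f1 \<in> qspace X1" using fs by (simp add: X_mem)
    have r1: "ennreal (r t) * ennreal (M * W1.tail t) = ennreal (M * W0.tail t)"
      using n M r_pos[OF t] by (simp add: ennreal_mult[symmetric] r_def)
    have \<kappa>J: "ennreal (\<kappa> * W0.tail t) \<le> ennreal (r t) * ?J"
    proof -
      have "ennreal (\<kappa> * W0.tail t) = ennreal (r t) * (k f t * ennreal (W1.tail t))"
        using n \<kappa> r_pos[OF t] by (simp add: ennreal_mult[symmetric] r_def)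
      also have "\<dots> \<le> ennreal (r t) * ?J"
        unfolding J_fun_def by (intro mult_left_mono W1.profile_tail_le K_fun_profile f t) auto
      finally show ?thesis .
    qed
    have "K_fun X0 X1 (ennreal (r t)) f \<le> N0 f0 + ennreal (r t) * N1 f1"
      using K_fun_le[OF x0 x1, of "ennreal (r t)"] X_norm(1)[OF x0] X_norm(2)[OF x1] fp(3) by simp
    also have "\<dots> \<le> ennreal B * (?I + ennreal (M * W0.tail t)) + ennreal (r t) * (ennreal B * (?J + ennreal (M * W1.tail t)))"
      by (intro add_mono mult_left_mono n0 n1) auto
    also have "\<dots> = ennreal B * (?I + ennreal (M * W0.tail t) + (ennreal (r t) * ?J + ennreal (r t) * ennreal (M * W1.tail t)))"
      by (simp add: distrib_left mult_ac add_ac)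
    also have "\<dots> = ennreal B * (?I + ennreal (r t) * ?J + 2 * ennreal (M * W0.tail t))"
      unfolding r1 by (simp add: mult_2 add_ac)
    also have "ennreal (M * W0.tail t) = ennreal (\<kappa> * W0.tail t) + ennreal (d * W0.tail t)"
      using \<kappa> d n by (simp add: M_def distrib_right)
    also have "ennreal B * (?I + ennreal (r t) * ?J + 2 * (ennreal (\<kappa> * W0.tail t) + ennreal (d * W0.tail t)))
       \<le> ennreal B * ((?I + ennreal (r t) * ?J) + 2 * ((?I + ennreal (r t) * ?J) + ennreal (d * W0.tail t)))"
      using \<kappa>J by (intro mult_left_mono add_mono add_increasing) auto
    also have "\<dots> = ennreal (3 * B) * (?I + ennreal (r t) * ?J) + ennreal (2 * B) * ennreal (d * W0.tail t)"
    proof -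
      have 3: "x + 2 * (x + y) = 3 * x + 2 * y" for x y :: ennreal
        by (metis (no_types, opaque_lifting) add.assoc distrib_left mult_1 distrib_right one_add_one numeral_Bit1 numeral_One add.commute mult_2)
      show ?thesis
        unfolding 3 using B(1) by (simp add: distrib_left ennreal_mult mult_ac)
    qed
    also have "ennreal (2 * B) * ennreal (d * W0.tail t) = ennreal e"
      using B d n e by (simp add: ennreal_mult[symmetric] d_def)
    finally show "K_fun X0 X1 (ennreal (r t)) f \<le> ennreal (3 * B) * (?I + ennreal (r t) * ?J) + ennreal e" .
  qed
  then show ?thesis using B(1) by (intro exI[of _ "3 * B"]) auto
qed

text \<open>For each decomposition \<open>f = f\<^sub>0 + f\<^sub>1\<close> over the two interpolation spaces, the diagonal terms (\<open>I\<close> of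
\<open>f\<^sub>0\<close>, \<open>J\<close> of \<open>f\<^sub>1\<close>) are parts of the norms, and the cross terms are covered by \<open>embedding_I_of_growth\<close> and \<open>embedding_J_of_growth\<close>.\<close>

lemma lower_estimate:
  assumes e: "0 < e" and c: "0 < c"
    "\<And>s t. 0 < s \<Longrightarrow> s \<le> t \<Longrightarrow> W0.tail s powr (1 + e) / W1.tail s \<le> c * (W0.tail t powr (1 + e) / W1.tail t)"
  shows "\<exists>C>0. \<forall>f\<in>sum_space A0 A1. \<forall>t>0.
     I_fun A0 A1 q0 b0 t f + ennreal (r t) * J_fun A0 A1 q1 b1 t f \<le> ennreal C * K_fun X0 X1 (ennreal (r t)) f"
proof -
  obtain C where C: "C \<ge> 1" "\<And>t f g. K_fun A0 A1 t (f + g) \<le> ennreal C * (K_fun A0 A1 t f + K_fun A0 A1 t g)"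
    using K_fun_quasi_add by metis
  obtain CI where CI: "CI > 0" "\<And>k t. profile k \<Longrightarrow> 0 < t \<Longrightarrow>
     Lq_norm q0 {0<..<t} (\<lambda>u. W0.w u * k u) \<le> ennreal (CI * r t) * Lq_norm q1 {0<..} (\<lambda>u. W1.w u * k u)"
    using embedding_I_of_growth[OF e c] by metis
  obtain CJ where CJ: "CJ > 0" "\<And>k t. profile k \<Longrightarrow> 0 < t \<Longrightarrow>
     Lq_norm q1 {t<..} (\<lambda>u. W1.w u * k u) \<le> ennreal (CJ / r t) * Lq_norm q0 {0<..} (\<lambda>u. W0.w u * k u)"
    using embedding_J_of_growth[OF e c] by metis
  define D0 D1 where "D0 = C * (Lq_const q0 * (1 + CI))" and "D1 = C * (Lq_const q1 * (1 + CJ))"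
  have D: "0 < D0" "0 < D1"
    using C(1) CI(1) CJ(1) Lq_const_ge_1[of q0] Lq_const_ge_1[of q1] by (auto simp: D0_def D1_def intro!: mult_pos_pos)
  have "I_fun A0 A1 q0 b0 t f + ennreal (r t) * J_fun A0 A1 q1 b1 t f \<le> ennreal (D0 + D1) * K_fun X0 X1 (ennreal (r t)) f"
    if f: "f \<in> sum_space A0 A1" and t: "0 < t" for f t
  proof -
    let ?s = "I_fun A0 A1 q0 b0 t f + ennreal (r t) * J_fun A0 A1 q1 b1 t f"
    have r: "0 < r t" by (rule r_pos[OF t])
    have inv: "ennreal (D0 + D1) * ennreal (1 / (D0 + D1)) = 1"
      using D by (subst ennreal_mult[symmetric]) auto
    have "ennreal (1 / (D0 + D1)) * ?s \<le> K_fun X0 X1 (ennreal (r t)) f"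
    proof (rule K_fun_greatest)
      fix f0 f1 assume X: "f0 \<in> qspace X0" "f1 \<in> qspace X1" and ff: "f = f0 + f1"
      have fs: "f0 \<in> sum_space A0 A1" "f1 \<in> sum_space A0 A1" using X by (auto simp: X_mem)
      note pr = K_fun_profile[OF fs(1)] K_fun_profile[OF fs(2)] K_fun_profile[OF f]
      have kle: "k f u \<le> ennreal C * (k f0 u + k f1 u)" for u unfolding ff by (rule C(2))
      have "I_fun A0 A1 q0 b0 t f \<le> ennreal C * (Lq_const q0 * (Lq_norm q0 {0<..<t} (\<lambda>u. W0.w u * k f0 u) + Lq_norm q0 {0<..<t} (\<lambda>u. W0.w u * k f1 u)))"
        unfolding I_fun_def by (rule W0.Lq_norm_profile_add[OF pr _ kle]) auto
      also have "\<dots> \<le> ennreal C * (Lq_const q0 * (N0 f0 + ennreal (CI * r t) * N1 f1))"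
        unfolding interp_norm_def
        by (intro mult_left_mono add_mono CI(2) pr t Lq_norm_mono_set[OF W0.q_pos W0.measurable_w_profile[OF pr(1)]]) auto
      also have "\<dots> \<le> ennreal C * (Lq_const q0 * (ennreal (1 + CI) * (N0 f0 + ennreal (r t) * N1 f1)))"
      proof (intro mult_left_mono)
        have "N0 f0 \<le> ennreal (1 + CI) * N0 f0"
          using mult_right_mono[of 1 "ennreal (1 + CI)" "N0 f0"] CI(1) by simp
        moreover have "ennreal (CI * r t) * N1 f1 \<le> ennreal (1 + CI) * (ennreal (r t) * N1 f1)"
          using CI(1) r by (simp add: mult.assoc[symmetric] ennreal_mult[symmetric] del: ennreal_plus)
            (auto intro!: mult_right_mono ennreal_leI)
        ultimately show "N0 f0 + ennreal (CI * r t) * N1 f1 \<le> ennreal (1 + CI) * (N0 f0 + ennreal (r t) * N1 f1)"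
          unfolding distrib_left by (rule add_mono)
      qed auto
      also have "\<dots> = ennreal D0 * (N0 f0 + ennreal (r t) * N1 f1)"
        using C(1) CI(1) Lq_const_ge_1[of q0] by (simp add: D0_def ennreal_mult mult.assoc del: ennreal_plus)
      finally have 1: "I_fun A0 A1 q0 b0 t f \<le> ennreal D0 * (N0 f0 + ennreal (r t) * N1 f1)" .
      have "J_fun A0 A1 q1 b1 t f \<le> ennreal C * (Lq_const q1 * (Lq_norm q1 {t<..} (\<lambda>u. W1.w u * k f0 u) + Lq_norm q1 {t<..} (\<lambda>u. W1.w u * k f1 u)))"
        unfolding J_fun_def using t by (intro W1.Lq_norm_profile_add[OF pr _ kle]) auto
      also have "\<dots> \<le> ennreal C * (Lq_const q1 * (ennreal (CJ / r t) * N0 f0 + N1 f1))"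
        unfolding interp_norm_def using t
        by (intro mult_left_mono add_mono CJ(2) pr Lq_norm_mono_set[OF W1.q_pos W1.measurable_w_profile[OF pr(2)]]) auto
      finally have "ennreal (r t) * J_fun A0 A1 q1 b1 t f \<le> ennreal (r t) * (ennreal C * (Lq_const q1 * (ennreal (CJ / r t) * N0 f0 + N1 f1)))"
        by (rule mult_left_mono) simp
      also have "\<dots> = ennreal C * (Lq_const q1 * (ennreal (r t) * ennreal (CJ / r t) * N0 f0 + ennreal (r t) * N1 f1))"
        by (simp add: distrib_left mult_ac)
      also have "ennreal (r t) * ennreal (CJ / r t) = ennreal CJ"
        using r CJ(1) by (simp add: ennreal_mult[symmetric])
      also have "ennreal C * (Lq_const q1 * (ennreal CJ * N0 f0 + ennreal (r t) * N1 f1))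
          \<le> ennreal C * (Lq_const q1 * (ennreal (1 + CJ) * (N0 f0 + ennreal (r t) * N1 f1)))"
      proof (intro mult_left_mono)
        have "ennreal (r t) * N1 f1 \<le> ennreal (1 + CJ) * (ennreal (r t) * N1 f1)"
          using mult_right_mono[of 1 "ennreal (1 + CJ)" "ennreal (r t) * N1 f1"] CJ(1) by simp
        moreover have "ennreal CJ * N0 f0 \<le> ennreal (1 + CJ) * N0 f0"
          by (intro mult_right_mono ennreal_leI) auto
        ultimately show "ennreal CJ * N0 f0 + ennreal (r t) * N1 f1 \<le> ennreal (1 + CJ) * (N0 f0 + ennreal (r t) * N1 f1)"
          unfolding distrib_left by (rule add_mono[rotated])
      qed auto
      also have "\<dots> = ennreal D1 * (N0 f0 + ennreal (r t) * N1 f1)"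
        using C(1) CJ(1) Lq_const_ge_1[of q1] by (simp add: D1_def ennreal_mult mult.assoc del: ennreal_plus)
      finally have 2: "ennreal (r t) * J_fun A0 A1 q1 b1 t f \<le> ennreal D1 * (N0 f0 + ennreal (r t) * N1 f1)" .
      have "?s \<le> ennreal (D0 + D1) * (N0 f0 + ennreal (r t) * N1 f1)"
        using add_mono[OF 1 2] D by (simp add: distrib_right)
      then have "ennreal (1 / (D0 + D1)) * ?s \<le> ennreal (1 / (D0 + D1)) * (ennreal (D0 + D1) * (N0 f0 + ennreal (r t) * N1 f1))"
        by (rule mult_left_mono) simp
      also have "\<dots> = N0 f0 + ennreal (r t) * N1 f1"
        using inv by (metis mult.assoc mult.commute mult_1)
      finally show "ennreal (1 / (D0 + D1)) * ?s \<le> ennreal (qnorm X0 f0) + ennreal (r t) * ennreal (qnorm X1 f1)"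
        by (simp only: X_norm(1)[OF X(1)] X_norm(2)[OF X(2)])
    qed
    then have "ennreal (D0 + D1) * (ennreal (1 / (D0 + D1)) * ?s) \<le> ennreal (D0 + D1) * K_fun X0 X1 (ennreal (r t)) f"
      by (rule mult_left_mono) simp
    then show ?thesis by (simp only: mult.assoc[symmetric] inv mult_1)
  qed
  then show ?thesis using D by (intro exI[of _ "D0 + D1"]) auto
qed

lemma reiteration_formula_iff:
  "reiteration_formula A0 A1 q0 b0 q1 b1 \<longleftrightarrow>
    (\<exists>C>0. \<forall>f\<in>sum_space A0 A1. \<forall>t>0.
     K_fun X0 X1 (ennreal (r t)) f \<le> ennreal C * (I_fun A0 A1 q0 b0 t f + ennreal (r t) * J_fun A0 A1 q1 b1 t f)) \<and>
    (\<exists>C>0. \<forall>f\<in>sum_space A0 A1. \<forall>t>0.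
     I_fun A0 A1 q0 b0 t f + ennreal (r t) * J_fun A0 A1 q1 b1 t f \<le> ennreal C * K_fun X0 X1 (ennreal (r t)) f)"
  unfolding reiteration_formula_def approx_on_def lesssim_on_def
  by (simp add: Ball_def rho_eq imp_conjL)

theorem sufficiency:
  assumes "0 < e" "equiv_nondecreasing (rho_eps e q0 b0 q1 b1)"
  shows "reiteration_formula A0 A1 q0 b0 q1 b1"
proof -
  obtain c where c: "c > 0" "\<And>s t. 0 < s \<Longrightarrow> s \<le> t \<Longrightarrow> W0.tail s powr (1 + e) / W1.tail s \<le> c * (W0.tail t powr (1 + e) / W1.tail t)"
    using assms(2) unfolding equiv_rho_eps by auto
  show ?thesis
    unfolding reiteration_formula_iff using upper_estimate lower_estimate[OF assms(1) c] ..
qed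

end

section \<open>Uniform constants\<close>

context sv_weight
begin

text \<open>A uniform boundedness principle on the cone of positive profiles. If there were no uniform constant, take
profiles \<open>\<phi>\<^sub>n\<close> of norm \<open>1\<close> on which some \<open>P\<^sub>i\<close> exceeds \<open>4\<^bsup>n\<^esup>\<close>; their hump \<open>\<Psi> = sup 2\<^bsup>-n\<^esup> \<phi>\<^sub>n\<close> is again a profile of
finite norm, but the \<open>P\<^sub>i\<close> are unbounded on it. It is needed because the constants in \<open>K\<close>-surjectivity
depend on the profile.\<close>

lemma uniform_bound:
  fixes P :: "'i \<Rightarrow> (real \<Rightarrow> ennreal) \<Rightarrow> ennreal"
  assumes hom: "\<And>i c \<phi> \<psi>. i \<in> X \<Longrightarrow> profile \<phi> \<Longrightarrow> profile \<psi> \<Longrightarrow> 0 < c \<Longrightarrow> (\<And>u. 0 < u \<Longrightarrow> ennreal c * \<phi> u \<le> \<psi> u) \<Longrightarrow> ennreal c * P i \<phi> \<le> P i \<psi>"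
    and pointwise: "\<And>\<phi>. profile \<phi> \<Longrightarrow> (\<And>u. 0 < u \<Longrightarrow> 0 < \<phi> u) \<Longrightarrow> Lq_norm q {0<..} (\<lambda>u. w u * \<phi> u) < \<infinity> \<Longrightarrow> \<exists>C::real. \<forall>i\<in>X. P i \<phi> \<le> ennreal C"
  shows "\<exists>C>0::real. \<forall>i\<in>X. \<forall>\<phi>. profile \<phi> \<and> (\<forall>u>0. 0 < \<phi> u) \<longrightarrow> P i \<phi> \<le> ennreal C * Lq_norm q {0<..} (\<lambda>u. w u * \<phi> u)"
proof (rule ccontr)
  let ?L = "\<lambda>\<phi>. Lq_norm q {0<..} (\<lambda>u. w u * \<phi> u)"
  assume "\<not> ?thesis"
  then have neg: "\<not> (\<forall>i\<in>X. \<forall>\<phi>. profile \<phi> \<and> (\<forall>u>0. 0 < \<phi> u) \<longrightarrow> P i \<phi> \<le> ennreal C * ?L \<phi>)" if "0 < C" for C :: real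
    using that by blast
  have "\<exists>i \<phi>. i \<in> X \<and> profile \<phi> \<and> (\<forall>u>0. 0 < \<phi> u) \<and> ennreal (4 ^ n) * ?L \<phi> < P i \<phi>" for n :: nat
    using neg[of "4 ^ n"] by (auto simp: not_le)
  then obtain i \<phi> where i: "\<And>n. i n \<in> X" and \<phi>: "\<And>n. profile (\<phi> n)" "\<And>n u. 0 < u \<Longrightarrow> 0 < \<phi> n u"
    and big: "\<And>n::nat. ennreal (4 ^ n) * ?L (\<phi> n) < P (i n) (\<phi> n)"
    by metis
  define l where "l n = enn2real (?L (\<phi> n))" for n
  have L_fin: "?L (\<phi> n) < top" for n
  proof (rule ccontr)
    assume "\<not> ?thesis"
    then have "?L (\<phi> n) = top" by (simp add: less_top[symmetric])
    then show False using big[of n] by (simp add: ennreal_mult_top)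
  qed
  then have L_eq: "?L (\<phi> n) = ennreal (l n)" for n
    by (simp add: l_def)
  have "0 < \<phi> n 1 * ennreal (tail 1)" for n
    using \<phi>(2)[of 1 n] tail_pos[of 1] by (simp add: ennreal_zero_less_mult_iff)
  moreover have "\<phi> n 1 * ennreal (tail 1) \<le> ?L (\<phi> n)" for n
    by (intro order.trans[OF profile_tail_le[OF \<phi>(1)]] Lq_norm_mono_set[OF q_pos measurable_w_profile[OF \<phi>(1)]]) auto
  ultimately have "0 < ?L (\<phi> n)" for n
    by (rule less_le_trans)
  then have l: "0 < l n" for n
    unfolding L_eq by simp
  \<comment> \<open>Normalised to norm at most \<open>2\<^bsup>-n\<^esup>\<close>, while the values of the functionals still exceed \<open>2\<^bsup>n\<^esup>\<close>.\<close>
  define \<psi> where "\<psi> n u = ennreal ((1/2) ^ n / l n) * \<phi> n u" for n u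
  have \<psi>: "profile (\<psi> n)" for n
    unfolding \<psi>_def by (intro profile_cmult \<phi>) simp
  have \<psi>_norm: "?L (\<psi> n) \<le> ennreal ((1/2) ^ n)" for n
  proof -
    have "?L (\<psi> n) = Lq_norm q {0<..} (\<lambda>u. ennreal ((1/2) ^ n / l n) * (w u * \<phi> n u))"
      by (simp add: \<psi>_def mult_ac)
    also have "\<dots> \<le> ennreal ((1/2) ^ n / l n) * ?L (\<phi> n)"
      by (intro Lq_norm_cmult[OF q_pos measurable_w_profile[OF \<phi>(1)]]) simp
    also have "\<dots> = ennreal ((1/2) ^ n)"
      using l[of n] by (simp add: L_eq ennreal_mult[symmetric])
    finally show ?thesis .
  qed
  define \<Psi> where "\<Psi> u = (SUP n. \<psi> n u)" for u
  have \<Psi>_prof: "profile \<Psi>"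
    unfolding \<Psi>_def
  proof (rule profile_SUP[OF \<psi>])
    fix t :: real assume t: "0 < t"
    have "\<psi> n t \<le> ennreal (1 / tail t)" for n
    proof -
      have "\<psi> n t \<le> ?L (\<psi> n) * ennreal (1 / tail t)"
        by (rule profile_le_total[OF \<psi> t])
      also have "\<dots> \<le> 1 * ennreal (1 / tail t)"
        by (intro mult_right_mono order.trans[OF \<psi>_norm]) (auto simp: power_le_one)
      finally show ?thesis by simp
    qed
    then have "(SUP n. \<psi> n t) \<le> ennreal (1 / tail t)" by (rule SUP_least)
    then show "(SUP n. \<psi> n t) < \<infinity>" by (rule order.strict_trans1) simp
  qed
  have le: "\<psi> n u \<le> \<Psi> u" for n u
    unfolding \<Psi>_def by (rule SUP_upper) simp
  have "\<psi> 0 u > 0" if "0 < u" for u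
    using \<phi>(2)[OF that, of 0] l[of 0] by (simp add: \<psi>_def ennreal_zero_less_mult_iff)
  then have \<Psi>_pos: "0 < \<Psi> u" if "0 < u" for u
    using le[of 0 u] that by (meson less_le_trans)
  have "?L \<Psi> < \<infinity>"
    unfolding \<Psi>_def SUP_mult_left_ennreal
    by (rule Lq_norm_SUP_geometric[OF q_pos measurable_w_profile[OF \<psi>] \<psi>_norm]) simp
  then obtain C :: real where C: "\<And>i. i \<in> X \<Longrightarrow> P i \<Psi> \<le> ennreal C"
    using pointwise[OF \<Psi>_prof \<Psi>_pos] by blast
  have pow: "2 ^ n \<le> C" for n
  proof -
    have "ennreal (2 ^ n) = ennreal ((1/2) ^ n / l n) * (ennreal (4 ^ n) * ?L (\<phi> n))"
    proof -
      have "(1/2) ^ n / l n * (4 ^ n * l n) = (2::real) ^ n"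
        using l[of n] by (simp add: power_mult_distrib[symmetric])
      then show ?thesis
        using l[of n] by (simp add: L_eq ennreal_mult[symmetric])
    qed
    also have "\<dots> \<le> ennreal ((1/2) ^ n / l n) * P (i n) (\<phi> n)"
      by (intro mult_left_mono less_imp_le[OF big]) simp
    also have "\<dots> \<le> P (i n) \<Psi>"
      using l[of n] le[of n] by (intro hom i \<phi> \<Psi>_prof) (auto simp: \<psi>_def)
    also have "\<dots> \<le> ennreal C" by (rule C[OF i])
    finally have *: "ennreal (2 ^ n) \<le> ennreal C" .
    show ?thesis
    proof (rule ccontr)
      assume "\<not> ?thesis"
      then have "C < 2 ^ n" by simp
      then have "ennreal C < ennreal (2 ^ n)" by (intro ennreal_lessI) auto
      then show False using * by simp
    qed
  qed
  obtain n where "C < 2 ^ n" using real_arch_pow[of 2 C] by auto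
  then show False using pow[of n] by simp
qed

end

section \<open>Growth of the ratio of the tails\<close>

text \<open>If \<open>\<rho>\<close> doubles whenever \<open>n\<close> drops by the factor \<open>B = 2\<^bsup>m\<^esup>\<close>, then \<open>\<rho>\<close> grows at least like \<open>n\<^bsup>-1/m\<^esup>\<close>: iterate,
locating the intermediate points by the intermediate value property.\<close>

lemma dyadic_growth:
  fixes n \<rho> :: "real \<Rightarrow> real"
  assumes n_pos: "\<And>t. 0 < t \<Longrightarrow> 0 < n t" and n_anti: "\<And>s t. 0 < s \<Longrightarrow> s \<le> t \<Longrightarrow> n t \<le> n s"
    and n_IVT: "\<And>s t y. 0 < s \<Longrightarrow> s \<le> t \<Longrightarrow> n t \<le> y \<Longrightarrow> y \<le> n s \<Longrightarrow> \<exists>u. s \<le> u \<and> u \<le> t \<and> n u = y"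
    and \<rho>_pos: "\<And>t. 0 < t \<Longrightarrow> 0 < \<rho> t"
    and c: "0 < c" and almost: "\<And>s t. 0 < s \<Longrightarrow> s \<le> t \<Longrightarrow> \<rho> s \<le> c * \<rho> t"
    and doubling: "\<And>s t. 0 < s \<Longrightarrow> s < t \<Longrightarrow> 2 ^ K * n t \<le> n s \<Longrightarrow> 2 * \<rho> s \<le> \<rho> t"
  shows "\<exists>\<epsilon>>0. \<epsilon> < 1 \<and> (\<exists>C>0. \<forall>s t. 0 < s \<and> s \<le> t \<longrightarrow> \<rho> s * n s powr \<epsilon> \<le> C * (\<rho> t * n t powr \<epsilon>))"
proof -
  \<comment> \<open>Enlarging \<open>K\<close> weakens the doubling hypothesis; \<open>m \<ge> 2\<close> makes the exponent \<open>1/m\<close> smaller than \<open>1\<close>.\<close>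
  define m where "m = max K 2"
  have m: "K \<le> m" "2 \<le> m" by (auto simp: m_def)
  define B where "B = (2::real) ^ m"
  have B: "1 < B" using m by (simp add: B_def one_less_power)
  have dbl: "2 * \<rho> s \<le> \<rho> t" if "0 < s" "s < t" "B * n t \<le> n s" for s t
  proof (rule doubling[OF that(1,2)])
    have "(2::real) ^ K \<le> B" unfolding B_def using m by (intro power_increasing) auto
    then have "2 ^ K * n t \<le> B * n t" using n_pos[of t] that by (intro mult_right_mono) auto
    then show "2 ^ K * n t \<le> n s" using that by simp
  qed
  have iter: "2 ^ j * \<rho> s \<le> c * \<rho> t" if "0 < s" "s \<le> t" "B ^ j * n t \<le> n s" for j s t
    using that
  proof (induction j arbitrary: s)
    case 0
    then show ?case using almost by simp
  next
    case (Suc j)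
    have nt: "0 < n t" using n_pos[of t] Suc.prems by simp
    have Bj: "1 \<le> B ^ j" using B by simp
    have 1: "B ^ j * n t \<le> n s / B" using Suc.prems B by (simp add: field_simps)
    have "n t \<le> B ^ j * n t" using Bj nt by simp
    then have 2: "n t \<le> n s / B" using 1 by simp
    have ns: "0 < n s" using n_pos Suc.prems by simp
    have 3: "n s / B < n s" using B ns by (simp add: field_simps)
    obtain u where u: "s \<le> u" "u \<le> t" "n u = n s / B"
      using n_IVT[OF Suc.prems(1,2) 2] 3 by auto
    then have su: "s < u" using 3 by (cases "s = u") auto
    have "2 * \<rho> s \<le> \<rho> u"
      using u B by (intro dbl Suc.prems su) auto
    then have "2 ^ Suc j * \<rho> s \<le> 2 ^ j * \<rho> u" by simp
    also have "\<dots> \<le> c * \<rho> t"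
      using Suc.prems su u 1 by (intro Suc.IH) auto
    finally show ?case .
  qed
  define \<epsilon> where "\<epsilon> = 1 / real m"
  have \<epsilon>: "0 < \<epsilon>" "\<epsilon> < 1" using m by (auto simp: \<epsilon>_def)
  have "\<rho> s * n s powr \<epsilon> \<le> (2 * c) * (\<rho> t * n t powr \<epsilon>)" if st: "0 < s" "s \<le> t" for s t
  proof -
    have pos: "0 < n s" "0 < n t" "0 < \<rho> s" "0 < \<rho> t" using st n_pos \<rho>_pos by auto
    define y where "y = (n s / n t) powr \<epsilon>"
    have "1 \<le> n s / n t" using n_anti[OF st] pos by simp
    then have "1 \<le> y" unfolding y_def using \<epsilon> by (intro ge_one_powr_ge_zero) auto
    then obtain j where j: "2 ^ j \<le> y" "y < 2 ^ Suc j" using ex_dyadic by blast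
    have "(2 ^ j) powr real m \<le> y powr real m" using j(1) by (intro powr_mono2) auto
    also have "y powr real m = n s / n t" using pos m by (simp add: y_def powr_powr \<epsilon>_def)
    also have "(2 ^ j) powr real m = B ^ j"
      by (simp add: B_def powr_realpow power_mult[symmetric] mult.commute)
    finally have "B ^ j * n t \<le> n s" using pos by (simp add: field_simps)
    then have *: "2 ^ j * \<rho> s \<le> c * \<rho> t" by (rule iter[OF st])
    have "n s powr \<epsilon> = y * n t powr \<epsilon>" using pos by (simp add: y_def powr_divide)
    also have "\<dots> \<le> 2 ^ Suc j * n t powr \<epsilon>" using j(2) by (intro mult_right_mono) auto
    finally have "\<rho> s * n s powr \<epsilon> \<le> \<rho> s * (2 ^ Suc j * n t powr \<epsilon>)"
      using pos by (intro mult_left_mono) auto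
    also have "\<dots> = 2 * (2 ^ j * \<rho> s) * n t powr \<epsilon>" by simp
    also have "\<dots> \<le> 2 * (c * \<rho> t) * n t powr \<epsilon>"
      using * by (intro mult_right_mono mult_left_mono) auto
    finally show ?thesis by (simp add: mult_ac)
  qed
  then show ?thesis using \<epsilon> c by (intro exI[of _ \<epsilon>] conjI exI[of _ "2 * c"]) auto
qed

context sv_pair
begin

text \<open>Stated for an abstract pair of weights, as it is applied with the two weights in either order. The
maximum in \<open>emb\<close> is the common weakening of the two embeddings to \<open>(s, t)\<close>, in which the factor is the
value of the ratio at the right, respectively left, end point; on a plateau the difference is immaterial.\<close>

lemma no_long_plateau:
  assumes q_finite: "q0 \<noteq> \<infinity>" and exps: "enn2real (1 / q1) < enn2real (1 / q0)"
    and C: "0 < C" and D: "1 \<le> D"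
    and emb: "\<And>s t \<phi>. 0 < s \<Longrightarrow> s < t \<Longrightarrow> profile \<phi> \<Longrightarrow> (\<And>u. 0 < u \<Longrightarrow> 0 < \<phi> u) \<Longrightarrow>
      Lq_norm q0 {s<..<t} (\<lambda>u. W0.w u * \<phi> u) \<le> ennreal (C * max (r s) (r t)) * Lq_norm q1 {0<..} (\<lambda>u. W1.w u * \<phi> u)"
  shows "\<exists>K. \<forall>s t. 0 < s \<and> s < t \<and> (\<forall>u. s \<le> u \<and> u \<le> t \<longrightarrow> r s \<le> D * r u \<and> r u \<le> D * r s) \<longrightarrow>
     W0.tail s < 2 ^ K * W0.tail t"
proof -
  define \<beta> where "\<beta> = enn2real (1 / q1)"
  have p: "0 < W0.p" by (rule W0.p_pos[OF q_finite])
  define \<alpha> where "\<alpha> = 1 / W0.p"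
  have \<alpha>: "enn2real (1 / q0) = \<alpha>" unfolding \<alpha>_def by (rule enn2real_inverse(2)[OF W0.q_pos q_finite])
  have \<alpha>0: "0 < \<alpha>" using p by (simp add: \<alpha>_def)
  have \<beta>: "0 \<le> \<beta>" "\<beta> < \<alpha>" using exps by (auto simp: \<beta>_def \<alpha>)
  obtain T where T: "T > 0" "\<And>t. 0 < t \<Longrightarrow> Lq_norm q1 {0<..} (\<lambda>u. W1.w u * ennreal (min 1 (u / t))) \<le> ennreal (T * W1.tail t)"
    using W1.Lq_norm_truncation by blast
  define \<eta> where "\<eta> = 1 - 2 powr (- W0.p)"
  have \<eta>: "0 < \<eta>" using p powr_less_mono[of "- W0.p" 0 2] by (simp add: \<eta>_def)
  define \<kappa> where "\<kappa> = \<eta> powr \<alpha>"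
  have \<kappa>: "0 < \<kappa>" using \<eta> by (simp add: \<kappa>_def)
  \<comment> \<open>The test below gives \<open>K\<^bsup>\<alpha>-\<beta>\<^esup> \<le> G\<close> for every \<open>K\<close> that admits a plateau.\<close>
  define G where "G = C * T * D\<^sup>2 * 2 powr \<beta> / \<kappa>"
  obtain K :: nat where K: "max 1 (G powr (1 / (\<alpha> - \<beta>))) < real K"
    using reals_Archimedean2 by blast
  have K1: "1 < real K" using K by simp
  have "W0.tail s < 2 ^ K * W0.tail t"
    if st: "0 < s" "s < t" and plateau: "\<And>u. s \<le> u \<Longrightarrow> u \<le> t \<Longrightarrow> r s \<le> D * r u \<and> r u \<le> D * r s" for s t
  proof (rule ccontr)
    assume "\<not> ?thesis"
    then have drop: "2 ^ K * W0.tail t \<le> W0.tail s" by simp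
    define n where "n = W0.tail s"
    have n: "0 < n" unfolding n_def by (rule W0.tail_pos[OF st(1)])
    have nt: "0 < W0.tail t" using W0.tail_pos[of t] st by simp
    have rs: "0 < r s" by (rule r_pos[OF st(1)])
    have "\<exists>x. s \<le> x \<and> x \<le> t \<and> W0.tail x = n / 2 ^ k" if "k \<le> K" for k
    proof (rule W0.tail_IVT[OF q_finite st(1)])
      have "2 ^ k * W0.tail t \<le> 2 ^ K * W0.tail t"
        using nt that by (intro mult_right_mono power_increasing) auto
      then have "2 ^ k * W0.tail t \<le> n" using drop by (simp add: n_def)
      then show "W0.tail t \<le> n / 2 ^ k" by (simp add: field_simps)
      have "n / 2 ^ k \<le> n / 1" using n by (intro divide_left_mono) auto
      then show "n / 2 ^ k \<le> W0.tail s" by (simp add: n_def)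
    qed (use st in auto)
    then obtain x where x: "\<And>k. k \<le> K \<Longrightarrow> s \<le> x k" "\<And>k. k \<le> K \<Longrightarrow> x k \<le> t" "\<And>k. k \<le> K \<Longrightarrow> W0.tail (x k) = n / 2 ^ k"
      by metis
    have x0: "0 < x k" if "k \<le> K" for k using x(1)[OF that] st by simp
    have x_less: "x k < x (Suc k)" if "Suc k \<le> K" for k
    proof (rule ccontr)
      assume "\<not> ?thesis"
      then have "W0.tail (x k) \<le> W0.tail (x (Suc k))" using x0[OF that] by (intro W0.tail_antimono) auto
      then show False using x(3)[OF that] x(3)[of k] that n by (simp add: field_simps)
    qed
    have x_first: "x 0 \<le> x j" if "j \<le> K" for j
      using that
    proof (induction j)
      case (Suc j)
      then show ?case using x_less[OF Suc.prems] by simp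
    qed simp
    \<comment> \<open>The value \<open>0\<close> for \<open>k > K\<close> only makes the family total.\<close>
    define F where "F k u = (if k \<le> K then ennreal (2 ^ k) * ennreal (min 1 (u / x k)) else 0)" for k u
    define \<phi> where "\<phi> u = (SUP k\<in>{..K}. F k u)" for u
    have F_prof: "profile (F k)" for k
    proof (cases "k \<le> K")
      case True
      then show ?thesis unfolding F_def using x0[OF True] by (simp add: profile_cmult profile_truncation)
    qed (simp add: F_def profile_def)
    have \<phi>_prof: "profile \<phi>"
      unfolding \<phi>_def
    proof (rule profile_SUP[OF F_prof])
      fix u :: real
      have "F k u \<le> ennreal (2 ^ K)" if "k \<le> K" for k
      proof -
        have "F k u \<le> ennreal (2 ^ k) * 1"
          using that mult_left_mono[of "ennreal (min 1 (u / x k))" 1 "ennreal (2 ^ k)"] by (simp add: F_def)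
        also have "\<dots> \<le> ennreal (2 ^ K)" using that by (auto intro!: ennreal_leI power_increasing)
        finally show ?thesis .
      qed
      then have "(SUP k\<in>{..K}. F k u) \<le> ennreal (2 ^ K)" by (intro SUP_least) auto
      then show "(SUP k\<in>{..K}. F k u) < \<infinity>" by (rule order.strict_trans1) simp
    qed
    have F_le: "F k u \<le> \<phi> u" if "k \<le> K" for k u
      unfolding \<phi>_def using that by (intro SUP_upper) auto
    have \<phi>_pos: "0 < \<phi> u" if "0 < u" for u
    proof -
      have "0 < F 0 u" using x0[of 0] that by (simp add: F_def)
      then show ?thesis using F_le[of 0 u] by simp
    qed
    have \<phi>_ge: "ennreal (2 ^ k) \<le> \<phi> u" if "k \<le> K" "x k \<le> u" for k u
      using F_le[OF that(1), of u] that x0[OF that(1)] by (simp add: F_def min_def split: if_splits)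
    define M where "M = T * D * n / r s"
    have M: "0 < M" using T D n rs by (simp add: M_def)
    \<comment> \<open>On the plateau \<open>n\<^sub>1\<close> is proportional to \<open>n\<^sub>0\<close>, so all \<open>K + 1\<close> pieces have norm at most \<open>M\<close>.\<close>
    have upper: "Lq_norm q1 {0<..} (\<lambda>u. W1.w u * \<phi> u) \<le> ennreal (real (Suc K) powr \<beta>) * ennreal M"
      unfolding \<phi>_def SUP_mult_left_ennreal \<beta>_def
    proof (rule Lq_norm_SUP_upto[OF W1.q_pos W1.measurable_w_profile[OF F_prof]])
      fix k assume k: "k \<le> K"
      have rx: "0 < r (x k)" by (rule r_pos[OF x0[OF k]])
      have "Lq_norm q1 {0<..} (\<lambda>u. W1.w u * F k u) = Lq_norm q1 {0<..} (\<lambda>u. ennreal (2 ^ k) * (W1.w u * ennreal (min 1 (u / x k))))"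
        using k by (simp add: F_def mult_ac)
      also have "\<dots> \<le> ennreal (2 ^ k) * Lq_norm q1 {0<..} (\<lambda>u. W1.w u * ennreal (min 1 (u / x k)))"
        by (intro Lq_norm_cmult[OF W1.q_pos] W1.measurable_w_profile profile_truncation x0[OF k]) auto
      also have "\<dots> \<le> ennreal (2 ^ k) * ennreal (T * W1.tail (x k))"
        by (intro mult_left_mono T(2) x0[OF k]) auto
      also have "\<dots> = ennreal (2 ^ k * (T * W1.tail (x k)))"
        using T(1) W1.tail_pos[OF x0[OF k]] by (simp add: ennreal_mult[symmetric])
      also have "\<dots> \<le> ennreal M"
      proof (rule ennreal_leI)
        have "W1.tail (x k) = W0.tail (x k) / r (x k)"
          using W0.tail_pos[OF x0[OF k]] W1.tail_pos[OF x0[OF k]] by (simp add: r_def)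
        also have "\<dots> = n / 2 ^ k * (1 / r (x k))" by (simp add: x(3)[OF k])
        also have "\<dots> \<le> n / 2 ^ k * (D / r s)"
          using plateau[OF x(1,2)[OF k]] rs rx n by (intro mult_left_mono) (auto simp: field_simps)
        finally have "2 ^ k * (T * W1.tail (x k)) \<le> 2 ^ k * (T * (n / 2 ^ k * (D / r s)))"
          using T(1) by (intro mult_left_mono) auto
        then show "2 ^ k * (T * W1.tail (x k)) \<le> M" by (simp add: M_def mult_ac)
      qed
      finally show "Lq_norm q1 {0<..} (\<lambda>u. W1.w u * F k u) \<le> ennreal M" .
    qed simp
    have m\<phi>: "\<phi> \<in> borel_measurable (lebesgue_on {0<..})"
      by (rule measurable_profile[OF \<phi>_prof]) simp
    define V where "V u = W0.W u * epowr (\<phi> u) W0.p" for u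
    have mV: "(\<lambda>u. V u * indicator S u) \<in> borel_measurable lebesgue" if S: "S \<in> sets lebesgue" for S
    proof -
      have "(\<lambda>u. epowr (\<phi> u) W0.p) \<in> borel_measurable (lebesgue_on {0<..})"
        using m\<phi> by measurable
      then have "(\<lambda>u. epowr (\<phi> u) W0.p * indicator {0<..} u) \<in> borel_measurable lebesgue"
        by (subst (asm) borel_measurable_restrict_space_iff_ennreal) auto
      then have "(\<lambda>u. W0.W u * indicator S u * (epowr (\<phi> u) W0.p * indicator {0<..} u)) \<in> borel_measurable lebesgue"
        by (rule borel_measurable_times_ennreal[OF W0.measurable_W_indicator[OF S]])
      also have "(\<lambda>u. W0.W u * indicator S u * (epowr (\<phi> u) W0.p * indicator {0<..} u)) = (\<lambda>u. V u * indicator S u)"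
        by (auto simp: V_def W0.W_def fun_eq_iff split: split_indicator)
      finally show ?thesis .
    qed
    \<comment> \<open>On \<open>(x\<^sub>k, x\<^sub>k\<^sub>+\<^sub>1)\<close> the test function is at least \<open>2\<^bsup>k\<^esup>\<close>, while the mass is \<open>2\<^bsup>-kp\<^esup>\<close> times a constant.\<close>
    have layer: "ennreal (\<eta> * n powr W0.p) \<le> (\<integral>\<^sup>+u. V u * indicator {x k<..<x (Suc k)} u \<partial>lebesgue)" if k: "Suc k \<le> K" for k
    proof -
      have "ennreal (\<eta> * n powr W0.p) = ennreal ((2 ^ k) powr W0.p) * ennreal (W0.tail (x k) powr W0.p - W0.tail (x (Suc k)) powr W0.p)"
      proof -
        have 1: "W0.tail (x k) powr W0.p = n powr W0.p / (2 ^ k) powr W0.p"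
          using k n by (simp add: x(3) powr_divide)
        have 2: "W0.tail (x (Suc k)) powr W0.p = n powr W0.p / (2 ^ k) powr W0.p * 2 powr (- W0.p)"
        proof -
          have "W0.tail (x (Suc k)) = (n / 2 ^ k) / 2" using x(3)[OF k] by simp
          then show ?thesis using n by (simp only: powr_divide) (simp add: powr_divide powr_minus field_simps)
        qed
        have "(2 ^ k) powr W0.p * (W0.tail (x k) powr W0.p - W0.tail (x (Suc k)) powr W0.p) = \<eta> * n powr W0.p"
          unfolding 1 2 \<eta>_def by (simp add: field_simps)
        moreover have "0 \<le> W0.tail (x k) powr W0.p - W0.tail (x (Suc k)) powr W0.p"
        proof -
          have "W0.tail (x (Suc k)) \<le> W0.tail (x k)"
            using x0[of k] x_less[OF k] k by (intro W0.tail_antimono) auto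
          then show ?thesis
            using W0.tail_pos[OF x0[OF k]] p by (simp add: powr_mono2)
        qed
        ultimately show ?thesis by (simp add: ennreal_mult[symmetric])
      qed
      also have "\<dots> = (\<integral>\<^sup>+u. ennreal ((2 ^ k) powr W0.p) * (W0.W u * indicator {x k<..<x (Suc k)} u) \<partial>lebesgue)"
        using W0.W_interval[OF q_finite x0 x_less[OF k]] k
        by (subst nn_integral_cmult) (auto intro!: W0.measurable_W_indicator)
      also have "\<dots> \<le> (\<integral>\<^sup>+u. V u * indicator {x k<..<x (Suc k)} u \<partial>lebesgue)"
      proof (rule nn_integral_mono)
        fix u
        show "ennreal ((2 ^ k) powr W0.p) * (W0.W u * indicator {x k<..<x (Suc k)} u) \<le> V u * indicator {x k<..<x (Suc k)} u"
        proof (cases "u \<in> {x k<..<x (Suc k)}")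
          case True
          then have "epowr (ennreal (2 ^ k)) W0.p \<le> epowr (\<phi> u) W0.p"
            using k p by (intro epowr_mono \<phi>_ge) auto
          then have "W0.W u * ennreal ((2 ^ k) powr W0.p) \<le> V u"
            unfolding V_def by (intro mult_left_mono) (simp_all add: epowr_ennreal)
          then show ?thesis using True by (simp add: mult.commute)
        qed simp
      qed
      finally show ?thesis .
    qed
    have layers: "ennreal (real j * (\<eta> * n powr W0.p)) \<le> (\<integral>\<^sup>+u. V u * indicator {x 0<..<x j} u \<partial>lebesgue)" if "j \<le> K" for j
      using that
    proof (induction j)
      case (Suc j)
      have "ennreal (real (Suc j) * (\<eta> * n powr W0.p)) = ennreal (real j * (\<eta> * n powr W0.p)) + ennreal (\<eta> * n powr W0.p)"
        using \<eta> by (subst ennreal_plus[symmetric]) (auto simp: distrib_right)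
      also have "\<dots> \<le> (\<integral>\<^sup>+u. V u * indicator {x 0<..<x j} u \<partial>lebesgue) + (\<integral>\<^sup>+u. V u * indicator {x j<..<x (Suc j)} u \<partial>lebesgue)"
        using Suc by (intro add_mono Suc.IH layer) auto
      also have "\<dots> = (\<integral>\<^sup>+u. V u * indicator {x 0<..<x j} u + V u * indicator {x j<..<x (Suc j)} u \<partial>lebesgue)"
        by (rule nn_integral_add[symmetric]) (auto intro!: mV)
      also have "\<dots> \<le> (\<integral>\<^sup>+u. V u * indicator {x 0<..<x (Suc j)} u \<partial>lebesgue)"
      proof (rule nn_integral_mono)
        have "x 0 \<le> x j" using Suc.prems by (intro x_first) simp
        then show "V u * indicator {x 0<..<x j} u + V u * indicator {x j<..<x (Suc j)} u \<le> V u * indicator {x 0<..<x (Suc j)} u" for u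
          using x_less[OF Suc.prems] by (auto split: split_indicator)
      qed
      finally show ?case .
    qed simp
    have "ennreal (real K * (\<eta> * n powr W0.p)) \<le> (\<integral>\<^sup>+u. V u * indicator {s<..<t} u \<partial>lebesgue)"
      by (rule order.trans[OF layers[OF order.refl] nn_integral_mono])
        (use x(1)[of 0] x(2)[of K] in \<open>auto split: split_indicator\<close>)
    also have "\<dots> = epowr (Lq_norm q0 {s<..<t} (\<lambda>u. W0.w u * \<phi> u)) W0.p"
      unfolding V_def using st by (subst W0.epowr_Lq_norm_w[OF q_finite]) auto
    finally have "epowr (ennreal (real K * (\<eta> * n powr W0.p))) \<alpha> \<le> epowr (epowr (Lq_norm q0 {s<..<t} (\<lambda>u. W0.w u * \<phi> u)) W0.p) \<alpha>"
      using \<alpha>0 by (rule epowr_mono)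
    then have lower: "epowr (ennreal (real K * (\<eta> * n powr W0.p))) \<alpha> \<le> Lq_norm q0 {s<..<t} (\<lambda>u. W0.w u * \<phi> u)"
      using p by (simp add: epowr_epowr \<alpha>_def)
    have "epowr (ennreal (real K * (\<eta> * n powr W0.p))) \<alpha> = ennreal (real K powr \<alpha> * \<kappa> * n)"
    proof -
      have "(real K * (\<eta> * n powr W0.p)) powr \<alpha> = real K powr \<alpha> * \<kappa> * n"
        using n p \<eta> K1 by (simp add: powr_mult powr_powr \<alpha>_def \<kappa>_def)
      then show ?thesis using \<eta> by (subst epowr_ennreal) auto
    qed
    then have "ennreal (real K powr \<alpha> * \<kappa> * n) \<le> Lq_norm q0 {s<..<t} (\<lambda>u. W0.w u * \<phi> u)"
      using lower by simp
    also have "\<dots> \<le> ennreal (C * max (r s) (r t)) * Lq_norm q1 {0<..} (\<lambda>u. W1.w u * \<phi> u)"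
      by (rule emb[OF st \<phi>_prof \<phi>_pos])
    also have "\<dots> \<le> ennreal (C * (D * r s)) * (ennreal (real (Suc K) powr \<beta>) * ennreal M)"
    proof (intro mult_mono upper ennreal_leI mult_left_mono)
      show "max (r s) (r t) \<le> D * r s"
        using plateau[of t] plateau[of s] st by auto
    qed (use C rs in \<open>auto simp: le_max_iff_disj\<close>)
    also have "\<dots> = ennreal (C * (D * r s) * (real (Suc K) powr \<beta> * M))"
      using C D rs M by (simp add: ennreal_mult)
    finally have "real K powr \<alpha> * \<kappa> * n \<le> C * (D * r s) * (real (Suc K) powr \<beta> * M)"
      by (rule ennreal_le_iff[THEN iffD1, rotated]) (use C D rs M in auto)
    also have "\<dots> = (C * T * D\<^sup>2) * real (Suc K) powr \<beta> * n"
      using rs by (simp add: M_def power2_eq_square)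
    finally have "real K powr \<alpha> * \<kappa> \<le> (C * T * D\<^sup>2) * real (Suc K) powr \<beta>"
      using n by simp
    also have "\<dots> \<le> (C * T * D\<^sup>2) * (2 * real K) powr \<beta>"
      using C T D \<beta> K1 by (intro mult_left_mono powr_mono2) auto
    also have "\<dots> = (G * \<kappa>) * real K powr \<beta>"
      using \<kappa> by (simp add: G_def powr_mult)
    finally have "real K powr \<alpha> \<le> G * real K powr \<beta>"
      using \<kappa> by (simp add: mult_ac)
    then have "real K powr \<alpha> / real K powr \<beta> \<le> G"
      using K1 by (simp add: divide_le_eq)
    then have "real K powr (\<alpha> - \<beta>) \<le> G"
      by (simp add: powr_diff)
    moreover have "G < real K powr (\<alpha> - \<beta>)"
    proof -
      have "0 \<le> G" using C T \<kappa> by (simp add: G_def)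
      then have "G = (G powr (1 / (\<alpha> - \<beta>))) powr (\<alpha> - \<beta>)"
        using \<beta> by (simp add: powr_powr)
      also have "\<dots> < real K powr (\<alpha> - \<beta>)"
        using K \<beta> by (intro powr_less_mono2) auto
      finally show ?thesis .
    qed
    ultimately show False by simp
  qed
  then show ?thesis by blast
qed

end

section \<open>Necessity of the growth condition\<close>

lemma ennreal_scale_le:
  assumes "0 < r" "ennreal r * x \<le> y"
  shows "x \<le> ennreal (1 / r) * y"
proof -
  have "x = ennreal (1 / r) * (ennreal r * x)"
    using assms(1) by (simp add: mult.assoc[symmetric] ennreal_mult[symmetric])
  also have "\<dots> \<le> ennreal (1 / r) * y" by (rule mult_left_mono[OF assms(2)]) simp
  finally show ?thesis .
qed

context reiteration
begin

lemma zero_mem_X: "0 \<in> qspace X0" "0 \<in> qspace X1" and norm_zero_X: "qnorm X0 0 = 0" "qnorm X1 0 = 0"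
proof -
  have sum0: "0 \<in> sum_space A0 A1" using qspace_subset_sum zero_mem by blast
  have k0: "k 0 u = 0" for u using K_fun_le_left[OF zero_mem(1), of "ennreal u"] qnorm_zero(1) by simp
  have "Lq_norm q {0<..} (\<lambda>u::real. 0) = 0" if "0 < q" for q
    using Lq_norm_cmult[OF that, of "\<lambda>_. 0" "{0<..}" 0] by simp
  then have N: "N0 0 = 0" "N1 0 = 0"
    unfolding interp_norm_def k0 by (simp_all add: W0.q_pos W1.q_pos)
  show "0 \<in> qspace X0" "0 \<in> qspace X1" using sum0 N by (simp_all add: X_mem)
  show "qnorm X0 0 = 0" "qnorm X1 0 = 0" using N by (simp_all add: interp_space_def)
qed

text \<open>Real quasi-concave functions are exactly what positive profiles become under \<^const>\<open>enn2real\<close>, so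
\<open>K\<close>-surjectivity applies to profiles.\<close>

lemma realize_profile:
  assumes "K_surjective A0 A1" "profile \<phi>" "\<And>u. 0 < u \<Longrightarrow> 0 < \<phi> u"
  obtains f c d where "f \<in> sum_space A0 A1" "0 < c" "0 < d"
    "\<forall>u>0. \<phi> u \<le> ennreal c * k f u" "\<forall>u>0. k f u \<le> ennreal d * \<phi> u"
proof -
  have "quasi_concave (\<lambda>u. enn2real (\<phi> u))"
    using assms(2,3) by (rule quasi_concave_of_profile)
  then obtain f where f: "f \<in> sum_space A0 A1" "approx_on {0<..} (\<lambda>t. ennreal (enn2real (\<phi> t))) (k f)"
    using assms(1) unfolding K_surjective_def by blast
  have eq: "ennreal (enn2real (\<phi> u)) = \<phi> u" if "0 < u" for u
    using profileD(1)[OF assms(2) that] by simp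
  obtain c where c: "0 < c" "\<forall>u>0. \<phi> u \<le> ennreal c * k f u"
    using f(2) eq unfolding approx_on_def lesssim_on_def by force
  obtain d where d: "0 < d" "\<forall>u>0. k f u \<le> ennreal d * \<phi> u"
    using f(2) eq unfolding approx_on_def lesssim_on_def by force
  show thesis by (rule that[OF f(1) c(1) d(1) c(2) d(2)])
qed

context
  assumes surj: "K_surjective A0 A1" and formula: "reiteration_formula A0 A1 q0 b0 q1 b1"
begin

text \<open>For \<open>f\<close> in the second space the trivial decomposition \<open>0 + f\<close> gives \<open>K(\<rho>(t), f) \<le> \<rho>(t) \<parallel>f\<parallel>\<close>, so the formula
bounds \<open>I(t, f)\<close>; \<open>uniform_bound\<close> is applied to the functionals \<open>\<rho>(t)\<^bsup>-1\<^esup> \<parallel>w\<^sub>0 \<phi>\<parallel>\<close> on \<open>(0, t)\<close>, indexed by \<open>t\<close>.\<close>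

lemma embedding_I:
  "\<exists>C>0. \<forall>t \<phi>. 0 < t \<and> profile \<phi> \<and> (\<forall>u>0. 0 < \<phi> u) \<longrightarrow>
    Lq_norm q0 {0<..<t} (\<lambda>u. W0.w u * \<phi> u) \<le> ennreal (C * r t) * Lq_norm q1 {0<..} (\<lambda>u. W1.w u * \<phi> u)"
proof -
  obtain c where c: "0 < c" "\<And>f t. f \<in> sum_space A0 A1 \<Longrightarrow> 0 < t \<Longrightarrow>
     I_fun A0 A1 q0 b0 t f + ennreal (r t) * J_fun A0 A1 q1 b1 t f \<le> ennreal c * K_fun X0 X1 (ennreal (r t)) f"
    using formula unfolding reiteration_formula_iff by blast
  define P where "P t \<phi> = ennreal (1 / r t) * Lq_norm q0 {0<..<t} (\<lambda>u. W0.w u * \<phi> u)" for t \<phi>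
  have "\<exists>C>0. \<forall>t\<in>{0<..}. \<forall>\<phi>. profile \<phi> \<and> (\<forall>u>0. 0 < \<phi> u) \<longrightarrow> P t \<phi> \<le> ennreal C * Lq_norm q1 {0<..} (\<lambda>u. W1.w u * \<phi> u)"
  proof (rule W1.uniform_bound)
    fix t a \<phi> \<psi> assume "t \<in> {0::real<..}" "profile \<phi>" "profile \<psi>" "0 < (a::real)" "\<And>u. 0 < u \<Longrightarrow> ennreal a * \<phi> u \<le> \<psi> u"
    then show "ennreal a * P t \<phi> \<le> P t \<psi>"
      unfolding P_def using W0.Lq_norm_profile_hom[of \<phi> \<psi> "{0<..<t}" a "1 / r t"] by (simp add: mult_ac greaterThanLessThan_def)
  next
    fix \<phi> assume \<phi>: "profile \<phi>" "\<And>u. 0 < u \<Longrightarrow> 0 < \<phi> u" and fin: "Lq_norm q1 {0<..} (\<lambda>u. W1.w u * \<phi> u) < \<infinity>"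
    obtain f a d where f: "f \<in> sum_space A0 A1" and ad: "0 < a" "0 < d"
      and "\<forall>u>0. \<phi> u \<le> ennreal a * k f u" "\<forall>u>0. k f u \<le> ennreal d * \<phi> u"
      by (rule realize_profile[OF surj \<phi>])
    then have le: "\<And>u. 0 < u \<Longrightarrow> \<phi> u \<le> ennreal a * k f u" "\<And>u. 0 < u \<Longrightarrow> k f u \<le> ennreal d * \<phi> u"
      by blast+
    have N: "N1 f \<le> ennreal d * Lq_norm q1 {0<..} (\<lambda>u. W1.w u * \<phi> u)"
      unfolding interp_norm_def by (intro W1.Lq_norm_profile_mono K_fun_profile f \<phi> le) auto
    also have "\<dots> < \<infinity>" using fin by (simp add: ennreal_mult_less_top)
    finally have Nfin: "N1 f < \<infinity>" .
    then have X: "f \<in> qspace X1" using f by (simp add: X_mem)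
    have "P t \<phi> \<le> ennreal (a * c * enn2real (N1 f))" if t: "t \<in> {0<..}" for t
    proof -
      have t: "0 < t" using t by simp
      have r: "0 < r t" by (rule r_pos[OF t])
      have "Lq_norm q0 {0<..<t} (\<lambda>u. W0.w u * \<phi> u) \<le> ennreal a * I_fun A0 A1 q0 b0 t f"
        unfolding I_fun_def by (intro W0.Lq_norm_profile_mono K_fun_profile f \<phi> le) auto
      also have "I_fun A0 A1 q0 b0 t f \<le> ennreal c * K_fun X0 X1 (ennreal (r t)) f"
        by (rule order.trans[OF _ c(2)[OF f t]]) simp
      also have "K_fun X0 X1 (ennreal (r t)) f \<le> ennreal (r t) * N1 f"
        using K_fun_le[OF zero_mem_X(1) X, of "ennreal (r t)"] norm_zero_X(1) X_norm(2)[OF X] by simp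
      finally have "P t \<phi> \<le> ennreal (1 / r t) * (ennreal a * (ennreal c * (ennreal (r t) * N1 f)))"
        unfolding P_def by (simp add: mult_left_mono)
      also have "N1 f = ennreal (enn2real (N1 f))" using Nfin by simp
      also have "ennreal (1 / r t) * (ennreal a * (ennreal c * (ennreal (r t) * ennreal (enn2real (N1 f))))) = ennreal (a * c * enn2real (N1 f))"
        using ad c(1) r by (simp add: ennreal_mult[symmetric])
      finally show ?thesis .
    qed
    then show "\<exists>C::real. \<forall>t\<in>{0<..}. P t \<phi> \<le> ennreal C" by blast
  qed
  then obtain C where C: "0 < C" "\<And>t \<phi>. 0 < t \<Longrightarrow> profile \<phi> \<Longrightarrow> (\<forall>u>0. 0 < \<phi> u) \<Longrightarrow> P t \<phi> \<le> ennreal C * Lq_norm q1 {0<..} (\<lambda>u. W1.w u * \<phi> u)"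
    by auto
  have "Lq_norm q0 {0<..<t} (\<lambda>u. W0.w u * \<phi> u) \<le> ennreal (C * r t) * Lq_norm q1 {0<..} (\<lambda>u. W1.w u * \<phi> u)"
    if "0 < t" "profile \<phi>" "\<forall>u>0. 0 < \<phi> u" for t \<phi>
    using ennreal_scale_le[OF _ C(2)[OF that, unfolded P_def]] r_pos[OF that(1)] C(1)
    by (simp add: mult.assoc[symmetric] ennreal_mult[symmetric] mult.commute)
  then show ?thesis using C(1) by blast
qed

text \<open>Likewise, with the trivial decomposition \<open>f + 0\<close> and the functionals \<open>\<rho>(t) \<parallel>w\<^sub>1 \<phi>\<parallel>\<close> on \<open>(t, \<infinity>)\<close>.\<close>

lemma embedding_J:
  "\<exists>C>0. \<forall>t \<phi>. 0 < t \<and> profile \<phi> \<and> (\<forall>u>0. 0 < \<phi> u) \<longrightarrow>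
    Lq_norm q1 {t<..} (\<lambda>u. W1.w u * \<phi> u) \<le> ennreal (C / r t) * Lq_norm q0 {0<..} (\<lambda>u. W0.w u * \<phi> u)"
proof -
  obtain c where c: "0 < c" "\<And>f t. f \<in> sum_space A0 A1 \<Longrightarrow> 0 < t \<Longrightarrow>
     I_fun A0 A1 q0 b0 t f + ennreal (r t) * J_fun A0 A1 q1 b1 t f \<le> ennreal c * K_fun X0 X1 (ennreal (r t)) f"
    using formula unfolding reiteration_formula_iff by blast
  define P where "P t \<phi> = ennreal (r t) * Lq_norm q1 {t<..} (\<lambda>u. W1.w u * \<phi> u)" for t \<phi>
  have "\<exists>C>0. \<forall>t\<in>{0<..}. \<forall>\<phi>. profile \<phi> \<and> (\<forall>u>0. 0 < \<phi> u) \<longrightarrow> P t \<phi> \<le> ennreal C * Lq_norm q0 {0<..} (\<lambda>u. W0.w u * \<phi> u)"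
  proof (rule W0.uniform_bound)
    fix t a \<phi> \<psi> assume *: "t \<in> {0::real<..}" "profile \<phi>" "profile \<psi>" "0 < (a::real)" "\<And>u. 0 < u \<Longrightarrow> ennreal a * \<phi> u \<le> \<psi> u"
    then have "{t<..} \<subseteq> {0<..}" by auto
    then show "ennreal a * P t \<phi> \<le> P t \<psi>"
      unfolding P_def using W1.Lq_norm_profile_hom[of \<phi> \<psi> "{t<..}" a "r t"] * by (simp add: mult_ac)
  next
    fix \<phi> assume \<phi>: "profile \<phi>" "\<And>u. 0 < u \<Longrightarrow> 0 < \<phi> u" and fin: "Lq_norm q0 {0<..} (\<lambda>u. W0.w u * \<phi> u) < \<infinity>"
    obtain f a d where f: "f \<in> sum_space A0 A1" and ad: "0 < a" "0 < d"
      and "\<forall>u>0. \<phi> u \<le> ennreal a * k f u" "\<forall>u>0. k f u \<le> ennreal d * \<phi> u"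
      by (rule realize_profile[OF surj \<phi>])
    then have le: "\<And>u. 0 < u \<Longrightarrow> \<phi> u \<le> ennreal a * k f u" "\<And>u. 0 < u \<Longrightarrow> k f u \<le> ennreal d * \<phi> u"
      by blast+
    have N: "N0 f \<le> ennreal d * Lq_norm q0 {0<..} (\<lambda>u. W0.w u * \<phi> u)"
      unfolding interp_norm_def by (intro W0.Lq_norm_profile_mono K_fun_profile f \<phi> le) auto
    also have "\<dots> < \<infinity>" using fin by (simp add: ennreal_mult_less_top)
    finally have Nfin: "N0 f < \<infinity>" .
    then have X: "f \<in> qspace X0" using f by (simp add: X_mem)
    have "P t \<phi> \<le> ennreal (a * c * enn2real (N0 f))" if t: "t \<in> {0<..}" for t
    proof -
      have t: "0 < t" using t by simp
      have "P t \<phi> \<le> ennreal (r t) * (ennreal a * J_fun A0 A1 q1 b1 t f)"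
        unfolding J_fun_def P_def using t by (intro mult_left_mono W1.Lq_norm_profile_mono K_fun_profile f \<phi> le) auto
      also have "\<dots> = ennreal a * (ennreal (r t) * J_fun A0 A1 q1 b1 t f)"
        by (simp add: mult_ac)
      also have "ennreal (r t) * J_fun A0 A1 q1 b1 t f \<le> ennreal c * K_fun X0 X1 (ennreal (r t)) f"
        by (rule order.trans[OF _ c(2)[OF f t]]) simp
      also have "K_fun X0 X1 (ennreal (r t)) f \<le> N0 f"
        using K_fun_le[OF X zero_mem_X(2), of "ennreal (r t)"] norm_zero_X(2) X_norm(1)[OF X] by simp
      finally have "P t \<phi> \<le> ennreal a * (ennreal c * N0 f)"
        by (simp add: mult_left_mono)
      also have "N0 f = ennreal (enn2real (N0 f))" using Nfin by simp
      also have "ennreal a * (ennreal c * ennreal (enn2real (N0 f))) = ennreal (a * c * enn2real (N0 f))"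
        using ad c(1) by (simp add: ennreal_mult[symmetric])
      finally show ?thesis .
    qed
    then show "\<exists>C::real. \<forall>t\<in>{0<..}. P t \<phi> \<le> ennreal C" by blast
  qed
  then obtain C where C: "0 < C" "\<And>t \<phi>. 0 < t \<Longrightarrow> profile \<phi> \<Longrightarrow> (\<forall>u>0. 0 < \<phi> u) \<Longrightarrow> P t \<phi> \<le> ennreal C * Lq_norm q0 {0<..} (\<lambda>u. W0.w u * \<phi> u)"
    by auto
  have "Lq_norm q1 {t<..} (\<lambda>u. W1.w u * \<phi> u) \<le> ennreal (C / r t) * Lq_norm q0 {0<..} (\<lambda>u. W0.w u * \<phi> u)"
    if "0 < t" "profile \<phi>" "\<forall>u>0. 0 < \<phi> u" for t \<phi>
    using ennreal_scale_le[OF _ C(2)[OF that, unfolded P_def]] r_pos[OF that(1)] C(1)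
    by (simp add: mult.assoc[symmetric] ennreal_mult[symmetric])
  then show ?thesis using C(1) by blast
qed

text \<open>Test \<open>embedding_J\<close> at \<open>s\<close> with the truncation at \<open>t\<close>: the left side is at least \<open>n\<^sub>1(t)\<close>, the right
side at most a multiple of \<open>n\<^sub>0(t)/\<rho>(s)\<close>.\<close>

lemma r_almost_increasing: "\<exists>c\<ge>1. \<forall>s t. 0 < s \<and> s \<le> t \<longrightarrow> r s \<le> c * r t"
proof -
  obtain C where C: "0 < C" "\<And>t \<phi>. 0 < t \<Longrightarrow> profile \<phi> \<Longrightarrow> (\<forall>u>0. 0 < \<phi> u) \<Longrightarrow>
    Lq_norm q1 {t<..} (\<lambda>u. W1.w u * \<phi> u) \<le> ennreal (C / r t) * Lq_norm q0 {0<..} (\<lambda>u. W0.w u * \<phi> u)"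
    using embedding_J by blast
  obtain T where T: "T > 0" "\<And>t. 0 < t \<Longrightarrow> Lq_norm q0 {0<..} (\<lambda>u. W0.w u * ennreal (min 1 (u / t))) \<le> ennreal (T * W0.tail t)"
    using W0.Lq_norm_truncation by blast
  have "r s \<le> max 1 (C * T) * r t" if st: "0 < s" "s \<le> t" for s t
  proof -
    have t: "0 < t" using st by simp
    let ?\<phi> = "\<lambda>u. ennreal (min 1 (u / t))"
    have prof: "profile ?\<phi>" by (rule profile_truncation[OF t])
    have n: "0 < W0.tail t" "0 < W1.tail t" using W0.tail_pos W1.tail_pos t by auto
    have r: "0 < r s" by (rule r_pos[OF st(1)])
    have "?\<phi> t * ennreal (W1.tail t) \<le> Lq_norm q1 {t<..} (\<lambda>u. W1.w u * ?\<phi> u)"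
      by (rule W1.profile_tail_le[OF prof t])
    also have "\<dots> \<le> Lq_norm q1 {s<..} (\<lambda>u. W1.w u * ?\<phi> u)"
      using st by (intro Lq_norm_mono_set[OF W1.q_pos W1.measurable_w_profile[OF prof]]) auto
    also have "\<dots> \<le> ennreal (C / r s) * Lq_norm q0 {0<..} (\<lambda>u. W0.w u * ?\<phi> u)"
      using t by (intro C(2) st prof) auto
    also have "\<dots> \<le> ennreal (C / r s) * ennreal (T * W0.tail t)"
      by (intro mult_left_mono T(2) t) simp
    also have "\<dots> = ennreal (C / r s * (T * W0.tail t))"
      using C(1) T(1) n r by (simp add: ennreal_mult[symmetric])
    finally have "W1.tail t \<le> C / r s * (T * W0.tail t)"
      using t C(1) T(1) n r by (simp add: ennreal_le_iff)
    then have "r s \<le> (C * T) * r t"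
      using r n by (simp add: r_def[of t] field_simps)
    also have "\<dots> \<le> max 1 (C * T) * r t"
      using r_pos[OF t] by (intro mult_right_mono) auto
    finally show ?thesis .
  qed
  then show ?thesis by (intro exI[of _ "max 1 (C * T)"]) auto
qed

text \<open>Where the ratio does not double between \<open>s\<close> and \<open>t\<close>, its almost monotonicity makes \<open>[s, t]\<close> a
plateau, which is short by \<open>no_long_plateau\<close>. The weight with the smaller exponent, for which the tail
is continuous, plays the first role there.\<close>

theorem necessity:
  assumes "q0 \<noteq> q1"
  shows "\<exists>\<epsilon>>0. equiv_nondecreasing (rho_eps \<epsilon> q0 b0 q1 b1)"
proof -
  obtain c where c: "1 \<le> c" "\<And>s t. 0 < s \<Longrightarrow> s \<le> t \<Longrightarrow> r s \<le> c * r t"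
    using r_almost_increasing by blast
  have c0: "0 < c" "1 \<le> 2 * c" using c(1) by auto
  have plateau: "r s \<le> 2 * c * r u \<and> r u \<le> 2 * c * r s"
    if st: "0 < s" "s < t" "r t < 2 * r s" and u: "s \<le> u" "u \<le> t" for s t u
  proof
    have ru: "0 < r u" using r_pos u st by simp
    have "r s \<le> c * r u" using c(2) st u by simp
    also have "\<dots> \<le> 2 * c * r u" using ru c0 by simp
    finally show "r s \<le> 2 * c * r u" .
    have "r u \<le> c * r t" using c(2)[of u t] st u by simp
    also have "\<dots> \<le> c * (2 * r s)" using st c0 by (intro mult_left_mono) auto
    finally show "r u \<le> 2 * c * r s" by simp
  qed
  consider "q0 < q1" | "q1 < q0" using assms by force
  then show ?thesis
  proof cases
    case 1
    then have fin: "q0 \<noteq> \<infinity>" by auto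
    obtain C where C: "0 < C" "\<And>t \<phi>. 0 < t \<Longrightarrow> profile \<phi> \<Longrightarrow> (\<forall>u>0. 0 < \<phi> u) \<Longrightarrow>
       Lq_norm q0 {0<..<t} (\<lambda>u. W0.w u * \<phi> u) \<le> ennreal (C * r t) * Lq_norm q1 {0<..} (\<lambda>u. W1.w u * \<phi> u)"
      using embedding_I by blast
    have "\<exists>K. \<forall>s t. 0 < s \<and> s < t \<and> (\<forall>u. s \<le> u \<and> u \<le> t \<longrightarrow> r s \<le> 2 * c * r u \<and> r u \<le> 2 * c * r s) \<longrightarrow>
       W0.tail s < 2 ^ K * W0.tail t"
    proof (rule no_long_plateau[OF fin enn2real_inverse_less[OF W0.q_pos 1] C(1) c0(2)])
      fix s t :: real and \<phi> assume st: "0 < s" "s < t" and \<phi>: "profile \<phi>" "\<And>u. 0 < u \<Longrightarrow> 0 < \<phi> u"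
      have "Lq_norm q0 {s<..<t} (\<lambda>u. W0.w u * \<phi> u) \<le> Lq_norm q0 {0<..<t} (\<lambda>u. W0.w u * \<phi> u)"
        using st by (intro Lq_norm_mono_set[OF W0.q_pos W0.measurable_w_profile[OF \<phi>(1)]]) auto
      also have "\<dots> \<le> ennreal (C * r t) * Lq_norm q1 {0<..} (\<lambda>u. W1.w u * \<phi> u)"
        using st \<phi> by (intro C(2)) auto
      also have "\<dots> \<le> ennreal (C * max (r s) (r t)) * Lq_norm q1 {0<..} (\<lambda>u. W1.w u * \<phi> u)"
        using C(1) by (intro mult_right_mono ennreal_leI mult_left_mono) auto
      finally show "Lq_norm q0 {s<..<t} (\<lambda>u. W0.w u * \<phi> u) \<le> ennreal (C * max (r s) (r t)) * Lq_norm q1 {0<..} (\<lambda>u. W1.w u * \<phi> u)" .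
    qed
    then obtain K where K: "\<And>s t. 0 < s \<Longrightarrow> s < t \<Longrightarrow> (\<And>u. s \<le> u \<Longrightarrow> u \<le> t \<Longrightarrow> r s \<le> 2 * c * r u \<and> r u \<le> 2 * c * r s) \<Longrightarrow>
       W0.tail s < 2 ^ K * W0.tail t" by blast
    have "\<exists>\<epsilon>>0. \<epsilon> < 1 \<and> (\<exists>C>0. \<forall>s t. 0 < s \<and> s \<le> t \<longrightarrow> r s * W0.tail s powr \<epsilon> \<le> C * (r t * W0.tail t powr \<epsilon>))"
    proof (rule dyadic_growth[OF W0.tail_pos W0.tail_antimono W0.tail_IVT[OF fin] r_pos c0(1) c(2)])
      fix s t :: real assume st: "0 < s" "s < t" "2 ^ K * W0.tail t \<le> W0.tail s"
      show "2 * r s \<le> r t"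
      proof (rule ccontr)
        assume "\<not> ?thesis"
        then have "W0.tail s < 2 ^ K * W0.tail t" using st by (intro K plateau) auto
        then show False using st by simp
      qed
    qed
    then obtain \<epsilon> D where \<epsilon>: "0 < \<epsilon>" and D: "0 < D"
      "\<And>s t. 0 < s \<Longrightarrow> s \<le> t \<Longrightarrow> r s * W0.tail s powr \<epsilon> \<le> D * (r t * W0.tail t powr \<epsilon>)" by blast
    have eq: "W0.tail t powr (1 + \<epsilon>) / W1.tail t = r t * W0.tail t powr \<epsilon>" if "0 < t" for t
      using W0.tail_pos[OF that] by (simp add: r_def powr_add)
    have "equiv_nondecreasing (rho_eps \<epsilon> q0 b0 q1 b1)"
      unfolding equiv_rho_eps using D by (intro exI[of _ D]) (auto simp: eq)
    then show ?thesis using \<epsilon> by blast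
  next
    case 2
    then have fin: "q1 \<noteq> \<infinity>" by auto
    \<comment> \<open>With the weights exchanged the ratio is replaced by its reciprocal; plateaus stay plateaus.\<close>
    interpret S: sv_pair q1 b1 q0 b0 ..
    have Sr: "S.r t = 1 / r t" for t by (simp add: S.r_def r_def)
    obtain C where C: "0 < C" "\<And>t \<phi>. 0 < t \<Longrightarrow> profile \<phi> \<Longrightarrow> (\<forall>u>0. 0 < \<phi> u) \<Longrightarrow>
       Lq_norm q1 {t<..} (\<lambda>u. W1.w u * \<phi> u) \<le> ennreal (C / r t) * Lq_norm q0 {0<..} (\<lambda>u. W0.w u * \<phi> u)"
      using embedding_J by blast
    have "\<exists>K. \<forall>s t. 0 < s \<and> s < t \<and> (\<forall>u. s \<le> u \<and> u \<le> t \<longrightarrow> S.r s \<le> 2 * c * S.r u \<and> S.r u \<le> 2 * c * S.r s) \<longrightarrow>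
       W1.tail s < 2 ^ K * W1.tail t"
    proof (rule S.no_long_plateau[OF fin enn2real_inverse_less[OF W1.q_pos 2] C(1) c0(2)])
      fix s t :: real and \<phi> assume st: "0 < s" "s < t" and \<phi>: "profile \<phi>" "\<And>u. 0 < u \<Longrightarrow> 0 < \<phi> u"
      have "Lq_norm q1 {s<..<t} (\<lambda>u. W1.w u * \<phi> u) \<le> Lq_norm q1 {s<..} (\<lambda>u. W1.w u * \<phi> u)"
        using st by (intro Lq_norm_mono_set[OF W1.q_pos W1.measurable_w_profile[OF \<phi>(1)]]) auto
      also have "\<dots> \<le> ennreal (C / r s) * Lq_norm q0 {0<..} (\<lambda>u. W0.w u * \<phi> u)"
        using st \<phi> by (intro C(2)) auto
      also have "\<dots> \<le> ennreal (C * max (S.r s) (S.r t)) * Lq_norm q0 {0<..} (\<lambda>u. W0.w u * \<phi> u)"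
      proof (intro mult_right_mono ennreal_leI)
        have "C * (1 / r s) \<le> C * max (S.r s) (S.r t)" using C(1) by (intro mult_left_mono) (auto simp: Sr)
        then show "C / r s \<le> C * max (S.r s) (S.r t)" by simp
      qed auto
      finally show "Lq_norm q1 {s<..<t} (\<lambda>u. W1.w u * \<phi> u) \<le> ennreal (C * max (S.r s) (S.r t)) * Lq_norm q0 {0<..} (\<lambda>u. W0.w u * \<phi> u)" .
    qed
    then obtain K where K: "\<And>s t. 0 < s \<Longrightarrow> s < t \<Longrightarrow> (\<And>u. s \<le> u \<Longrightarrow> u \<le> t \<Longrightarrow> S.r s \<le> 2 * c * S.r u \<and> S.r u \<le> 2 * c * S.r s) \<Longrightarrow>
       W1.tail s < 2 ^ K * W1.tail t" by blast
    have "\<exists>\<epsilon>>0. \<epsilon> < 1 \<and> (\<exists>C>0. \<forall>s t. 0 < s \<and> s \<le> t \<longrightarrow> r s * W1.tail s powr \<epsilon> \<le> C * (r t * W1.tail t powr \<epsilon>))"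
    proof (rule dyadic_growth[OF W1.tail_pos W1.tail_antimono W1.tail_IVT[OF fin] r_pos c0(1) c(2)])
      fix s t :: real assume st: "0 < s" "s < t" "2 ^ K * W1.tail t \<le> W1.tail s"
      show "2 * r s \<le> r t"
      proof (rule ccontr)
        assume neg: "\<not> ?thesis"
        have "W1.tail s < 2 ^ K * W1.tail t"
        proof (rule K[OF st(1,2)])
          fix u assume u: "s \<le> u" "u \<le> t"
          have "r s \<le> 2 * c * r u \<and> r u \<le> 2 * c * r s" using neg st u by (intro plateau) auto
          then show "S.r s \<le> 2 * c * S.r u \<and> S.r u \<le> 2 * c * S.r s"
            using r_pos[of s] r_pos[of u] u st by (simp add: Sr field_simps)
        qed
        then show False using st by simp
      qed
    qed
    then obtain \<epsilon> D where \<epsilon>: "0 < \<epsilon>" "\<epsilon> < 1" and D: "0 < D"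
      "\<And>s t. 0 < s \<Longrightarrow> s \<le> t \<Longrightarrow> r s * W1.tail s powr \<epsilon> \<le> D * (r t * W1.tail t powr \<epsilon>)" by blast
    \<comment> \<open>The power turning \<open>n\<^sub>0/n\<^sub>1\<^bsup>1-\<epsilon>\<^esup>\<close> into \<open>n\<^sub>0\<^bsup>a\<^esup>/n\<^sub>1\<close>; it exceeds \<open>1\<close> because \<open>0 < \<epsilon> < 1\<close>.\<close>
    define a where "a = 1 / (1 - \<epsilon>)"
    have a: "1 < a" "(1 - \<epsilon>) * a = 1" using \<epsilon> by (auto simp: a_def)
    have eq: "W0.tail t powr (1 + (a - 1)) / W1.tail t = (r t * W1.tail t powr \<epsilon>) powr a" if t: "0 < t" for t
    proof -
      have n: "0 < W0.tail t" "0 < W1.tail t" using W0.tail_pos W1.tail_pos t by auto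
      have "r t * W1.tail t powr \<epsilon> = W0.tail t / W1.tail t powr (1 - \<epsilon>)"
        using n by (simp add: r_def powr_diff)
      then show ?thesis using n a by (simp add: powr_divide powr_powr)
    qed
    have "W0.tail s powr (1 + (a - 1)) / W1.tail s \<le> D powr a * (W0.tail t powr (1 + (a - 1)) / W1.tail t)"
      if st: "0 < s" "s \<le> t" for s t
    proof -
      have rt: "0 < r s" "0 < r t" using r_pos st by auto
      have "(r s * W1.tail s powr \<epsilon>) powr a \<le> (D * (r t * W1.tail t powr \<epsilon>)) powr a"
        using D(2)[OF st] a rt by (intro powr_mono2) auto
      also have "\<dots> = D powr a * (r t * W1.tail t powr \<epsilon>) powr a"
        by (rule powr_mult)
      finally show ?thesis using st by (simp only: eq)
    qed
    then have "equiv_nondecreasing (rho_eps (a - 1) q0 b0 q1 b1)"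
      unfolding equiv_rho_eps using D(1) by (intro exI[of _ "D powr a"]) auto
    then show ?thesis using a by (intro exI[of _ "a - 1"]) auto
  qed
qed

end

end

theorem theorem3p2:
  fixes A0 A1 :: "'a::hausdorff_tvs quasi_normed"
    and q0 q1 :: ennreal
    and b0 b1 :: "real \<Rightarrow> real"
  assumes "compatible_couple A0 A1"
    and "0 < q0" and "0 < q1" and "q0 \<noteq> q1"
    and "b0 \<in> SV0 q0" and "b1 \<in> SV0 q1"
  shows "((\<exists>\<epsilon>>0. equiv_nondecreasing (rho_eps \<epsilon> q0 b0 q1 b1)) \<longrightarrow>
            reiteration_formula A0 A1 q0 b0 q1 b1) \<and>
         (K_surjective A0 A1 \<longrightarrow> reiteration_formula A0 A1 q0 b0 q1 b1 \<longrightarrow>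
            (\<exists>\<epsilon>>0. equiv_nondecreasing (rho_eps \<epsilon> q0 b0 q1 b1)))"
proof -
  interpret reiteration A0 A1 q0 b0 q1 b1
    by standard (use assms in \<open>auto simp: compatible_couple_def\<close>)
  show ?thesis
    using sufficiency necessity[OF _ _ assms(4)] by blast
qed

end
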